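(* Let $\tau\in\mathfrak M_{1,c}(\mathcal P)$. Suppose that $\hat K(G_\tau)=\emptyset$. Then all of the following hold. 1. $J_{\ker}(G_\tau)=\emptyset$. 2. $F_{meas}(\tau)=\mathfrak M_1(\hat{\mathbb C})$ and $(M_\tau^* )^n(\nu)\to\delta_\infty$ as $n\to\infty$ uniformly on $\nu\in\mathfrak M_1(\hat{\mathbb C})$. 3. $T_{\infty,\tau}\equiv1$ on $\hat{\mathbb C}$. 4. For $\tilde\tau$-a.e. $\gamma\in\mathcal P^{\mathbb N}$: (a) $\mathrm{Leb}_2(K_\gamma)=0$; (b) $K_\gamma=J_\gamma$; and (c) $K_\gamma=J_\gamma$ has uncountably many connected components.
   Context: $\hat{\mathbb C}$ is the Riemann sphere with spherical distance $d$. $\mathcal P$ is the set of polynomial maps $\hat{\mathbb C}\to\hat{\mathbb C}$ of degree at least $2$, with the metric $\kappa(f,g)=\sup_zd(f(z),g(z))$. $\mathfrak M_1(X)$ is the space of Borel probability measures on $X$ with the topology of weak convergence ($\mathfrak M_1(\hat{\mathbb C})$ is compact metrizable; fix a metric inducing its topology); $\mathfrak M_{1,c}(\mathcal P)$ is the set of those on $\mathcal P$ with compact topological support. $\mathrm{Leb}_2$ is two-dimensional Lebesgue measure. For a semigroup $G$ of polynomials, $F(G)$ is the set of $z\in\hat{\mathbb C}$ having a neighborhood on which $G$ is equicontinuous with respect to $d$; $J(G)=\hat{\mathbb C}\setminus F(G)$; $J_{\ker}(G)=\bigcap_{g\in G}g^{-1}(J(G))$; $\hat K(G)=\{z\in\mathbb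 C:\{g(z):g\in G\}\text{ is bounded in }\mathbb C\}$. $G_\tau$ is the semigroup generated under composition by $\operatorname{supp}\tau$, and $\tilde\tau=\otimes_{j=1}^\infty\tau$. For $\gamma=(\gamma_1,\gamma_2,\dots)\in\mathcal P^{\mathbb N}$, write $\gamma_{n,1}=\gamma_n\circ\cdots\circ\gamma_1$; $K_\gamma=\{z\in\mathbb C:\{\gamma_{n,1}(z)\}_{n\in\mathbb N}\text{ is bounded in }\mathbb C\}$; $J_\gamma$ is the complement of the set of points having a neighborhood on which $\{\gamma_{n,1}\}_{n\in\mathbb N}$ is equicontinuous. $T_{\infty,\tau}(z)=\tilde\tau(\{\gamma:\gamma_{n,1}(z)\to\infty\})$. $M_\tau(\varphi)(z)=\int\varphi(g(z))\,d\tau(g)$ on $C(\hat{\mathbb C})$, with dual $M_\tau^*:\mathfrak M_1(\hat{\mathbb C})\to\mathfrak M_1(\hat{\mathbb C})$. $F_{meas}(\tau)$ is the set of $\mu\in\mathfrak M_1(\hat{\mathbb C})$ having a neighborhood $B$ such that $\{(M_\tau^* )^n|_B\}_{n\in\mathbb N}$ is equicontinuous on $B$. $\delta_\infty$ is the Dirac measure at $\infty$. *)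

theory Defs
  imports "HOL-Probability.Probability" "HOL-Computational_Algebra.Polynomial"
begin

section \<open>The Riemann sphere with the spherical metric\<close>

datatype riemann_sphere = Fin complex | Infty

text \<open>Inverse stereographic projection onto the unit sphere of \<open>\<complex> \<times> \<real>\<close>.\<close>

fun stereo :: "riemann_sphere \<Rightarrow> complex \<times> real" where
  "stereo (Fin z) = ((2 / (1 + (cmod z)\<^sup>2)) *\<^sub>R z, ((cmod z)\<^sup>2 - 1) / (1 + (cmod z)\<^sup>2))"
| "stereo Infty = (0, 1)"

lemma norm_stereo: "norm (stereo p) = 1"
proof (cases p)
  case (Fin z)
  define t where "t = (cmod z)\<^sup>2"
  have t: "1 + t > 0" unfolding t_def by (simp add: add_pos_nonneg)
  have "(norm (stereo p))\<^sup>2 = (2 / (1 + t))\<^sup>2 * t + ((t - 1) / (1 + t))\<^sup>2"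
    by (simp add: Fin norm_Pair t_def power_mult_distrib power_divide)
  also have "\<dots> = (4 * t + (t - 1)\<^sup>2) / (1 + t)\<^sup>2"
    by (simp add: power_divide add_divide_distrib)
  also have "4 * t + (t - 1)\<^sup>2 = (1 + t)\<^sup>2"
    by (simp add: power2_eq_square algebra_simps)
  also have "(1 + t)\<^sup>2 / (1 + t)\<^sup>2 = 1"
    using t by simp
  finally have "(norm (stereo p))\<^sup>2 = 1" .
  then show ?thesis
    by (metis norm_ge_zero power2_eq_1_iff le_minus_one_simps(3) not_less)
qed (simp add: norm_Pair)

lemma inj_stereo: "stereo p = stereo q \<Longrightarrow> p = q"
proof -
  have *: "1 - snd (stereo (Fin z)) = 2 / (1 + (cmod z)\<^sup>2)" for z
    using add_pos_nonneg[of 1 "(cmod z)\<^sup>2"] by (simp add: field_simps)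
  have pos: "2 / (1 + (cmod z)\<^sup>2) > 0" for z
    by (simp add: add_pos_nonneg)
  have **: "fst (stereo (Fin z)) = (1 - snd (stereo (Fin z))) *\<^sub>R z" for z
    by (simp only: *) simp
  have ne: "1 - snd (stereo (Fin z)) \<noteq> 0" for z
    using pos[of z] by (simp only: *)
  assume eq: "stereo p = stereo q"
  show "p = q"
  proof (cases p)
    case p: (Fin z)
    show ?thesis
    proof (cases q)
      case q: (Fin w)
      show ?thesis
        using **[of z] **[of w] ne[of z] eq p q by (metis scaleR_cancel_left)
    next
      case Infty
      then show ?thesis using ne[of z] eq p by (simp del: stereo.simps(1))
    qed
  next
    case p: Infty
    show ?thesis
    proof (cases q)
      case (Fin w)
      then show ?thesis using ne[of w] eq[symmetric] p by (simp del: stereo.simps(1))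
    qed (simp add: p)
  qed
qed

lemma arccos_inner_triangle:
  fixes x y z :: "'a::real_inner"
  assumes "norm x = 1" "norm y = 1" "norm z = 1"
  shows "arccos (x \<bullet> z) \<le> arccos (x \<bullet> y) + arccos (y \<bullet> z)"
proof -
  have b: "\<bar>u \<bullet> v\<bar> \<le> 1" if "norm u = 1" "norm v = 1" for u v :: 'a
    using Cauchy_Schwarz_ineq2[of u v] that by simp
  define a where "a = x \<bullet> y"
  define c where "c = y \<bullet> z"
  have ac: "\<bar>a\<bar> \<le> 1" "\<bar>c\<bar> \<le> 1" "\<bar>x \<bullet> z\<bar> \<le> 1"
    using b assms by (auto simp: a_def c_def)
  have sq: "x \<bullet> x = 1" "y \<bullet> y = 1" "z \<bullet> z = 1"
    using assms by (simp_all add: dot_square_norm)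
  show ?thesis
  proof (cases "arccos a + arccos c \<le> pi")
    case False
    then show ?thesis
      using arccos_ubound[of "x \<bullet> z"] ac(3) unfolding a_def c_def by linarith
  next
    case True
    have n1: "norm (x - a *\<^sub>R y) = sqrt (1 - a\<^sup>2)"
      by (simp add: norm_eq_sqrt_inner inner_diff sq a_def inner_commute power2_eq_square)
    have n2: "norm (z - c *\<^sub>R y) = sqrt (1 - c\<^sup>2)"
      by (simp add: norm_eq_sqrt_inner inner_diff sq c_def inner_commute power2_eq_square)
    have "(x - a *\<^sub>R y) \<bullet> (z - c *\<^sub>R y) = x \<bullet> z - a * c"
      by (simp add: inner_diff sq a_def c_def inner_commute)
    then have "\<bar>x \<bullet> z - a * c\<bar> \<le> sqrt (1 - a\<^sup>2) * sqrt (1 - c\<^sup>2)"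
      using Cauchy_Schwarz_ineq2[of "x - a *\<^sub>R y" "z - c *\<^sub>R y"] n1 n2 by simp
    then have "cos (arccos a + arccos c) \<le> x \<bullet> z"
      using ac by (simp add: cos_add cos_arccos_abs sin_arccos_abs abs_le_iff)
    then have "arccos (x \<bullet> z) \<le> arccos (cos (arccos a + arccos c))"
      using ac by (intro arccos_le_arccos) (auto simp: abs_le_iff)
    also have "\<dots> = arccos a + arccos c"
      using True ac arccos_lbound[of a] arccos_lbound[of c]
      by (intro arccos_cos) (auto simp: abs_le_iff)
    finally show ?thesis unfolding a_def c_def .
  qed
qed

text \<open>The distance is the geodesic (great-circle) one.\<close>

instantiation riemann_sphere :: metric_space
begin

definition dist_riemann_sphere :: "riemann_sphere \<Rightarrow> riemann_sphere \<Rightarrow> real" where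
  "dist_riemann_sphere p q = arccos (stereo p \<bullet> stereo q)"

definition uniformity_riemann_sphere :: "(riemann_sphere \<times> riemann_sphere) filter" where
  "uniformity_riemann_sphere = (INF e\<in>{0 <..}. principal {(x, y). dist x y < e})"

definition open_riemann_sphere :: "riemann_sphere set \<Rightarrow> bool" where
  "open_riemann_sphere U \<longleftrightarrow> (\<forall>x\<in>U. eventually (\<lambda>(x', y). x' = x \<longrightarrow> y \<in> U) uniformity)"

instance
proof
  fix p q r :: riemann_sphere
  have b: "\<bar>stereo p \<bullet> stereo q\<bar> \<le> 1" for p q
    using Cauchy_Schwarz_ineq2[of "stereo p" "stereo q"] by (simp add: norm_stereo)
  show "dist p q = 0 \<longleftrightarrow> p = q"
  proof
    assume "dist p q = 0"
    then have 1: "stereo p \<bullet> stereo q = 1"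
      unfolding dist_riemann_sphere_def using b[of p q] by (metis cos_arccos_abs cos_zero)
    have "(norm (stereo p - stereo q))\<^sup>2 = 0"
      using 1 norm_eq_1[of "stereo p"] norm_eq_1[of "stereo q"]
      by (simp add: power2_norm_eq_inner inner_diff inner_commute norm_stereo)
    then show "p = q" by (simp add: inj_stereo)
  next
    assume "p = q"
    then show "dist p q = 0"
      by (simp add: dist_riemann_sphere_def dot_square_norm norm_stereo)
  qed
  show "dist p q \<le> dist p r + dist q r"
    using arccos_inner_triangle[OF norm_stereo norm_stereo norm_stereo, of p q r]
    by (simp add: dist_riemann_sphere_def inner_commute)
qed (simp_all add: uniformity_riemann_sphere_def open_riemann_sphere_def)

end

lemma dist_riemann_sphere_le_pi: "dist p q \<le> pi" for p q :: riemann_sphere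
  unfolding dist_riemann_sphere_def
  using Cauchy_Schwarz_ineq2[of "stereo p" "stereo q"]
  by (intro arccos_ubound) (auto simp: norm_stereo abs_le_iff)

section \<open>Polynomial maps of degree at least two\<close>

fun sphere_map :: "complex poly \<Rightarrow> riemann_sphere \<Rightarrow> riemann_sphere" where
  "sphere_map p (Fin z) = Fin (poly p z)"
| "sphere_map p Infty = Infty"

typedef poly_map = "{sphere_map p | p. degree p \<ge> 2}"
  morphisms app_map Abs_poly_map
  by (rule exI[of _ "sphere_map (monom 1 2)"], auto intro!: exI[of _ "monom 1 2"] simp: degree_monom_eq)

instantiation poly_map :: metric_space
begin

definition dist_poly_map :: "poly_map \<Rightarrow> poly_map \<Rightarrow> real" where
  "dist_poly_map f g = (SUP z. dist (app_map f z) (app_map g z))"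

definition uniformity_poly_map :: "(poly_map \<times> poly_map) filter" where
  "uniformity_poly_map = (INF e\<in>{0 <..}. principal {(x, y). dist x y < e})"

definition open_poly_map :: "poly_map set \<Rightarrow> bool" where
  "open_poly_map U \<longleftrightarrow> (\<forall>x\<in>U. eventually (\<lambda>(x', y). x' = x \<longrightarrow> y \<in> U) uniformity)"

instance
proof
  fix f g h :: poly_map
  have bdd: "bdd_above (range (\<lambda>z. dist (app_map f z) (app_map g z)))" for f g
    by (rule bdd_aboveI[of _ pi]) (auto simp: dist_riemann_sphere_le_pi)
  have le: "dist (app_map f z) (app_map g z) \<le> dist f g" for f g z
    unfolding dist_poly_map_def by (rule cSUP_upper[OF _ bdd]) simp
  show "dist f g = 0 \<longleftrightarrow> f = g"
  proof
    assume "dist f g = 0"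
    then have "app_map f z = app_map g z" for z
      using le[of f z g] by simp
    then show "f = g" by (simp add: app_map_inject[symmetric] fun_eq_iff)
  next
    assume "f = g"
    then show "dist f g = 0" by (simp add: dist_poly_map_def)
  qed
  show "dist f g \<le> dist f h + dist g h"
    unfolding dist_poly_map_def[of f g]
  proof (rule cSUP_least)
    fix z
    show "dist (app_map f z) (app_map g z) \<le> dist f h + dist g h"
      using dist_triangle2[of "app_map f z" "app_map g z" "app_map h z"] le[of f z h] le[of g z h]
      by linarith
  qed simp
qed (simp_all add: uniformity_poly_map_def open_poly_map_def)

end

section \<open>Spaces of Borel probability measures\<close>

definition prob_measures :: "'a::topological_space measure set" where
  "prob_measures = {\<mu>. sets \<mu> = sets borel \<and> prob_space \<mu>}"

text \<open>The coarsest topology making \<open>\<mu> \<mapsto> \<integral>\<phi> d\<mu>\<close> continuous for all bounded continuous \<open>\<phi>\<close>.\<close>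

definition weak_topology :: "'a::topological_space measure topology" where
  "weak_topology = topology_generated_by
     {{\<mu> \<in> prob_measures. integral\<^sup>L \<mu> \<phi> \<in> U} | (\<phi> :: 'a \<Rightarrow> real) U.
        continuous_on UNIV \<phi> \<and> bounded (range \<phi>) \<and> open U}"

definition metrizes_weak_topology ::
  "('a::topological_space measure \<Rightarrow> 'a measure \<Rightarrow> real) \<Rightarrow> bool" where
  "metrizes_weak_topology d \<longleftrightarrow>
     Metric_space prob_measures d \<and> Metric_space.mtopology prob_measures d = weak_topology"

definition topological_support :: "'a::topological_space measure \<Rightarrow> 'a set" where
  "topological_support \<mu> = {x. \<forall>U. open U \<and> x \<in> U \<longrightarrow> emeasure \<mu> U > 0}"

definition compactly_supported_prob_measures :: "'a::topological_space measure set" where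
  "compactly_supported_prob_measures = {\<mu> \<in> prob_measures. compact (topological_support \<mu>)}"

section \<open>Equicontinuity, Fatou and Julia sets of semigroups\<close>

definition equicontinuous_on ::
  "('a \<Rightarrow> 'a \<Rightarrow> real) \<Rightarrow> ('b \<Rightarrow> 'b \<Rightarrow> real) \<Rightarrow> 'a set \<Rightarrow> ('a \<Rightarrow> 'b) set \<Rightarrow> bool" where
  "equicontinuous_on d d' B \<F> \<longleftrightarrow>
     (\<forall>x\<in>B. \<forall>\<epsilon>>0. \<exists>\<delta>>0. \<forall>f\<in>\<F>. \<forall>y\<in>B. d x y < \<delta> \<longrightarrow> d' (f x) (f y) < \<epsilon>)"

definition fatou_set :: "(riemann_sphere \<Rightarrow> riemann_sphere) set \<Rightarrow> riemann_sphere set" where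
  "fatou_set G = {z. \<exists>U. open U \<and> z \<in> U \<and> equicontinuous_on dist dist U G}"

definition julia_set :: "(riemann_sphere \<Rightarrow> riemann_sphere) set \<Rightarrow> riemann_sphere set" where
  "julia_set G = - fatou_set G"

definition kernel_julia_set :: "(riemann_sphere \<Rightarrow> riemann_sphere) set \<Rightarrow> riemann_sphere set" where
  "kernel_julia_set G = (\<Inter>g\<in>G. g -` julia_set G)"

definition bounded_in_plane :: "riemann_sphere set \<Rightarrow> bool" where
  "bounded_in_plane A \<longleftrightarrow> (\<exists>B. bounded B \<and> A \<subseteq> Fin ` B)"

definition smallest_filled_julia_set :: "(riemann_sphere \<Rightarrow> riemann_sphere) set \<Rightarrow> complex set" where
  "smallest_filled_julia_set G = {z. bounded_in_plane {g (Fin z) | g. g \<in> G}}"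

inductive_set generated_semigroup :: "poly_map set \<Rightarrow> (riemann_sphere \<Rightarrow> riemann_sphere) set"
  for S :: "poly_map set" where
  generator: "f \<in> S \<Longrightarrow> app_map f \<in> generated_semigroup S"
| composition: "g \<in> generated_semigroup S \<Longrightarrow> h \<in> generated_semigroup S
    \<Longrightarrow> g \<circ> h \<in> generated_semigroup S"

definition semigroup_of :: "poly_map measure \<Rightarrow> (riemann_sphere \<Rightarrow> riemann_sphere) set" where
  "semigroup_of \<tau> = generated_semigroup (topological_support \<tau>)"

section \<open>Random sequences of polynomial maps\<close>

text \<open>Sequences are indexed from \<open>0\<close>: the map \<open>\<gamma>\<^sub>j\<close> of the mathematical text, \<open>j \<ge> 1\<close>, is
  \<open>\<gamma> (j - 1)\<close>. Thus \<open>seq_comp \<gamma> n\<close> is \<open>\<gamma>\<^sub>n \<circ> \<dots> \<circ> \<gamma>\<^sub>1\<close>.\<close>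

fun seq_comp :: "(nat \<Rightarrow> poly_map) \<Rightarrow> nat \<Rightarrow> riemann_sphere \<Rightarrow> riemann_sphere" where
  "seq_comp \<gamma> 0 = id"
| "seq_comp \<gamma> (Suc n) = app_map (\<gamma> n) \<circ> seq_comp \<gamma> n"

definition seq_filled_julia_set :: "(nat \<Rightarrow> poly_map) \<Rightarrow> complex set" where
  "seq_filled_julia_set \<gamma> = {z. bounded_in_plane {seq_comp \<gamma> n (Fin z) | n. n \<ge> 1}}"

definition seq_julia_set :: "(nat \<Rightarrow> poly_map) \<Rightarrow> riemann_sphere set" where
  "seq_julia_set \<gamma> = julia_set {seq_comp \<gamma> n | n. n \<ge> 1}"

definition product_law :: "poly_map measure \<Rightarrow> (nat \<Rightarrow> poly_map) measure" where
  "product_law \<tau> = PiM UNIV (\<lambda>_. \<tau>)"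

definition escape_prob :: "poly_map measure \<Rightarrow> riemann_sphere \<Rightarrow> real" where
  "escape_prob \<tau> z =
     measure (product_law \<tau>) {\<gamma>. (\<lambda>n. seq_comp \<gamma> n z) \<longlonglongrightarrow> Infty}"

section \<open>The transition operator and its dual\<close>

definition transition_op ::
  "poly_map measure \<Rightarrow> (riemann_sphere \<Rightarrow> real) \<Rightarrow> riemann_sphere \<Rightarrow> real" where
  "transition_op \<tau> \<phi> z = (\<integral>g. \<phi> (app_map g z) \<partial>\<tau>)"

text \<open>By the Riesz representation theorem, the dual operator maps a probability measure \<open>\<mu>\<close> to
  the unique probability measure representing the functional \<open>\<phi> \<mapsto> \<integral>M\<^sub>\<tau>\<phi> d\<mu>\<close>.\<close>

definition dual_transition_op ::
  "poly_map measure \<Rightarrow> riemann_sphere measure \<Rightarrow> riemann_sphere measure" where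
  "dual_transition_op \<tau> \<mu> = (THE \<nu>. \<nu> \<in> prob_measures \<and>
     (\<forall>\<phi>. continuous_on UNIV \<phi> \<longrightarrow> integral\<^sup>L \<nu> \<phi> = integral\<^sup>L \<mu> (transition_op \<tau> \<phi>)))"

text \<open>The parameter \<open>d\<close> is a metric inducing the weak topology.\<close>

definition fatou_meas ::
  "(riemann_sphere measure \<Rightarrow> riemann_sphere measure \<Rightarrow> real) \<Rightarrow> poly_map measure
     \<Rightarrow> riemann_sphere measure set" where
  "fatou_meas d \<tau> = {\<mu> \<in> prob_measures. \<exists>B. openin weak_topology B \<and> \<mu> \<in> B \<and>
     equicontinuous_on d d B {dual_transition_op \<tau> ^^ n | n. n \<ge> 1}}"

end

theory Submission
  imports Defs "HOL-Complex_Analysis.Complex_Analysis"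
    "HOL-Computational_Algebra.Fundamental_Theorem_Algebra" "HOL-Real_Asymp.Real_Asymp"
begin

text \<open>
Beyond a common radius \<open>R\<close> all maps of the compact support \<open>\<Gamma>\<close> double the modulus, so everything
reduces to reaching \<open>|z| > R\<close>. Let \<open>\<phi>\<close> be a bump function that is \<open>1\<close> on \<open>|z| \<le> R\<close> and \<open>0\<close> on
\<open>|z| \<ge> 2 R\<close>. Its iterates under the transition operator decrease, and they tend to \<open>0\<close> uniformly:
otherwise the points where all iterates stay above the limit of the maxima form a nonempty
\<open>\<Gamma>\<close>-invariant set, contradicting the emptiness of the smallest filled-in Julia set. This gives the
uniform convergence to the point mass at infinity and the almost sure escape of every point; by
Fubini almost every \<open>K\<^sub>\<gamma>\<close> is a null set, and since it then has no interior it equals \<open>J\<^sub>\<gamma>\<close>.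

For the components, choose \<open>f \<in> \<Gamma>\<close> and a word \<open>h\<close> sending all critical values of \<open>f\<close> far away. Then
\<open>f\<close> is a covering of degree at least two over a sublevel set of \<open>h\<close>, hence the corresponding
sublevel set of \<open>h \<circ> f\<close> is disconnected. Words close to \<open>h \<circ> f\<close> behave alike and occur infinitely
often in almost every \<open>\<gamma>\<close>; each occurrence splits \<open>K\<^sub>\<gamma>\<close>, and all binary itineraries are realised.
\<close>

section \<open>Polynomial maps of the plane\<close>

text \<open>Disconnectedness of a sublevel set is not by itself stable under perturbation of the
  word, hence the margins \<open>R\<close>, \<open>2 R\<close>, \<open>3 R\<close>. The exact word
  splits at level \<open>3 R\<close>, every nearby word at level \<open>2 R\<close>. Each half of
  such a splitting is mapped onto the disc of radius \<open>2 R\<close>, so it contains preimages of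
  every point of the closed disc of radius \<open>R\<close>, where all orbits of the filled Julia
  set live. This is what allows a half to be prescribed independently at each splitting block. The
  sublevel set of \<open>h \<circ> f\<close> is disconnected because, by the maximum principle, a
  connected sublevel set of \<open>h\<close> is simply connected, and over such a set a connected
  covering has only one sheet.

  Doubling of the modulus cannot be inherited pointwise by nearby maps, since spherical closeness
  says nothing about ratios of moduli near infinity. It is recovered from a bound near a circle by
  the maximum principle in the coordinate \<open>1/z\<close>.

  Fubini needs the iterates to be jointly measurable in sequence and point. This rests on second
  countability of the sphere and of the space of maps, which both come from compactness of the
  sphere.\<close>

lemma ex_norm_poly_ge:
  fixes p :: "complex poly"
  assumes "degree p > 0"
  shows "\<exists>s. \<forall>z. cmod z \<ge> s \<longrightarrow> cmod (poly p z) \<ge> d"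
  using filterlim_poly_at_infinity[OF assms, THEN filterlim_at_infinity_imp_norm_at_top]
  by (auto simp: filterlim_at_top eventually_at_infinity)

lemma poly_holomorphic_on: "poly p holomorphic_on S"
  by (intro holomorphic_intros)

lemma poly_not_constant_on_UNIV:
  fixes p :: "complex poly"
  assumes "degree p > 0"
  shows "\<not> poly p constant_on UNIV"
proof
  assume "poly p constant_on UNIV"
  then obtain c where c: "\<And>z. poly p z = c" by (auto simp: constant_on_def)
  obtain s where "\<forall>z. cmod z \<ge> s \<longrightarrow> cmod (poly p z) \<ge> cmod c + 1"
    using ex_norm_poly_ge[OF assms] by blast
  from this[rule_format, of "of_real \<bar>s\<bar>"] abs_ge_self[of s] c show False by auto
qed

lemma open_poly_image:
  fixes p :: "complex poly"
  assumes "degree p > 0" "open U"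
  shows "open (poly p ` U)"
  by (rule open_mapping_thm[where S = UNIV])
     (use assms poly_not_constant_on_UNIV in \<open>auto intro!: holomorphic_intros\<close>)

lemma continuous_on_poly_fun: "continuous_on S (poly (p :: complex poly))"
  by (intro continuous_intros)

lemma degree_diff_const: "degree (p - [:c:]) = degree p"
  for p :: "'a::comm_ring_1 poly"
proof (cases "degree p = 0")
  case True
  then show ?thesis by (metis degree_pCons_0 degree_eq_zeroE diff_pCons diff_self)
next
  case False
  then show ?thesis
    by (metis degree_add_eq_left degree_minus degree_pCons_0 diff_conv_add_uminus gr0I)
qed

lemma poly_surj:
  fixes p :: "complex poly"
  assumes "degree p > 0"
  obtains z where "poly p z = w"
proof -
  have "\<not> constant (poly (p - [:w:]))"
    using assms by (simp add: constant_degree degree_diff_const)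
  then obtain z where "poly (p - [:w:]) z = 0"
    using Fundamental_Theorem_Algebra.fundamental_theorem_of_algebra by blast
  then show ?thesis by (intro that[of z]) auto
qed

text \<open>By the maximum principle, \<open>|h|\<close> inside a loop is bounded by its maximum on
  the loop. A loop in the sublevel set therefore encloses no point of the complement, and all
  winding numbers about such points vanish.\<close>

lemma simply_connected_poly_sublevel:
  fixes h :: "complex poly"
  assumes "connected {z. cmod (poly h z) < r}"
  shows "simply_connected {z. cmod (poly h z) < r}"
proof -
  let ?S = "{z. cmod (poly h z) < r}"
  have op: "open ?S"
    by (intro open_Collect_less continuous_intros)
  have "winding_number g z = 0"
    if g: "path g" "path_image g \<subseteq> ?S" "pathfinish g = pathstart g" "z \<notin> ?S" for g z
  proof (rule winding_number_zero_in_outside)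
    have "z \<notin> inside (path_image g)"
    proof
      assume z: "z \<in> inside (path_image g)"
      obtain w where w: "w \<in> path_image g"
        "\<And>y. y \<in> path_image g \<Longrightarrow> cmod (poly h y) \<le> cmod (poly h w)"
        using continuous_attains_sup[of "path_image g" "\<lambda>y. cmod (poly h y)"]
          compact_path_image[OF g(1)] path_image_nonempty[of g]
        by (metis continuous_on_norm continuous_on_poly_fun)
      have "cmod (poly h z) \<le> cmod (poly h w)"
      proof (rule maximum_modulus_frontier[where S = "inside (path_image g)" and f = "poly h"])
        show "bounded (inside (path_image g))"
          using bounded_inside compact_imp_bounded[OF compact_path_image[OF g(1)]] by blast
        show "cmod (poly h y) \<le> cmod (poly h w)" if "y \<in> frontier (inside (path_image g))" for y
          using w(2) that frontier_inside_subset[OF compact_imp_closed[OF compact_path_image[OF g(1)]]]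
          by blast
      qed (auto intro!: holomorphic_intros continuous_intros z)
      also have "\<dots> < r" using w(1) g(2) by auto
      finally show False using g(4) by auto
    qed
    moreover have "z \<notin> path_image g" using g by auto
    ultimately show "z \<in> outside (path_image g)"
      using inside_Un_outside[of "path_image g"] by blast
  qed (use g in auto)
  with assms show ?thesis
    by (subst simply_connected_eq_winding_number_zero[OF op]) blast
qed

text \<open>Around the finitely many points of a fibre there are disjoint discs on which
  \<open>f\<close> is injective. Since \<open>f\<close> is proper, values close to \<open>x\<close>
  have no preimages outside these discs, so a small \<open>T\<close> around \<open>x\<close> is
  evenly covered.\<close>

lemma poly_covering_space:
  fixes f :: "complex poly"
  assumes deg: "degree f > 0" and U: "open U"
    and noncrit: "\<And>z. poly f z \<in> U \<Longrightarrow> poly (pderiv f) z \<noteq> 0"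
  shows "covering_space (poly f -` U) (poly f) U"
proof
  show "continuous_on (poly f -` U) (poly f)" by (rule continuous_on_poly_fun)
  show "poly f ` (poly f -` U) = U"
    using poly_surj[OF deg] by (auto simp: image_iff) metis
next
  fix x assume x: "x \<in> U"
  have opX: "open (poly f -` U)"
    using continuous_on_open_vimage[of UNIV "poly f"] U continuous_on_poly_fun by auto
  define F where "F = {z. poly f z = x}"
  have finF: "finite F"
  proof -
    have "f - [:x:] \<noteq> 0" using deg by auto
    from poly_roots_finite[OF this] show ?thesis by (simp add: F_def)
  qed
  have "\<exists>r>0. inj_on (poly f) (ball y r)" if "y \<in> F" for y
  proof -
    have "deriv (poly f) y = poly (pderiv f) y"
      by (intro DERIV_imp_deriv poly_DERIV)
    with noncrit[of y] x that have "deriv (poly f) y \<noteq> 0" by (simp add: F_def)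
    then show ?thesis
      using has_complex_derivative_locally_injective[of "poly f" UNIV y]
      by (metis UNIV_I poly_holomorphic_on open_UNIV)
  qed
  then obtain r where r: "\<And>y. y \<in> F \<Longrightarrow> r y > 0 \<and> inj_on (poly f) (ball y (r y))"
    by metis
  obtain e where e: "e > 0" "\<And>y. y \<in> F \<Longrightarrow> e \<le> r y"
    "\<And>y z. y \<in> F \<Longrightarrow> z \<in> F \<Longrightarrow> y \<noteq> z \<Longrightarrow> 2 * e \<le> dist y z"
  proof -
    \<comment> \<open>Injectivity radii and half the mutual distances: their minimum gives discs
      that are at once injective and disjoint. The entry \<open>1\<close> makes the set nonempty
      without inspecting \<open>F\<close>.\<close>
    define D where "D = insert 1 (r ` F \<union> (\<lambda>(y, z). dist y z / 2) ` (F \<times> F \<inter> {(y, z). y \<noteq> z}))"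
    have "finite D" "D \<noteq> {}" using finF by (auto simp: D_def)
    moreover have "\<forall>d\<in>D. d > 0" using r by (auto simp: D_def)
    ultimately have "Min D > 0" by simp
    moreover have "Min D \<le> d" if "d \<in> D" for d using \<open>finite D\<close> that by simp
    moreover have "r y \<in> D" if "y \<in> F" for y using that by (auto simp: D_def)
    moreover have "dist y z / 2 \<in> D" if "y \<in> F" "z \<in> F" "y \<noteq> z" for y z
      using that by (auto simp: D_def intro!: image_eqI[of _ _ "(y, z)"])
    ultimately show ?thesis
      by (intro that[of "Min D"]) (fastforce simp: field_simps)+
  qed
  have inj: "inj_on (poly f) (ball y e)" if "y \<in> F" for y
    using r[OF that] e(2)[OF that] by (meson inj_on_subset subset_ball)
  obtain s where s: "\<And>z. cmod z \<ge> s \<Longrightarrow> cmod (poly f z) \<ge> cmod x + 1"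
    using ex_norm_poly_ge[OF deg] by blast
  \<comment> \<open>Stray preimages, those outside all the discs, can only lie in this compact set
    once the values have modulus below \<open>|x| + 1\<close>. Its image is closed and misses
    \<open>x\<close>, so it can be removed from \<open>T\<close>.\<close>
  define K where "K = cball 0 s - (\<Union>y\<in>F. ball y e)"
  have K: "compact K" unfolding K_def by (intro compact_diff compact_cball open_UN) auto
  define T where "T = (U \<inter> ball 0 (cmod x + 1) \<inter> (\<Inter>y\<in>F. poly f ` ball y e)) - poly f ` K"
  have "closed (poly f ` K)"
    by (intro compact_imp_closed compact_continuous_image continuous_on_poly_fun K)
  then have opT: "open T"
    unfolding T_def using finF U
    by (intro open_Diff open_Int open_INT ballI open_poly_image deg) auto
  have xT: "x \<in> T"
    using x e(1) by (auto simp: T_def K_def F_def)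
  have pre: "z \<in> (\<Union>y\<in>F. ball y e)" if "poly f z \<in> T" for z
  proof -
    have "cmod (poly f z) < cmod x + 1" using that by (auto simp: T_def)
    then have "cmod z < s" using s[of z] by force
    with that show ?thesis by (auto simp: T_def K_def)
  qed
  define v where "v = (\<lambda>y. ball y e \<inter> poly f -` T) ` F"
  have opv: "open u" if "u \<in> v" for u
    using that opT continuous_on_open_vimage[of UNIV "poly f"] continuous_on_poly_fun
    by (auto simp: v_def intro!: open_Int)
  show "\<exists>T. x \<in> T \<and> openin (top_of_set U) T \<and>
           (\<exists>v. \<Union> v = poly f -` U \<inter> poly f -` T \<and>
                (\<forall>u\<in>v. openin (top_of_set (poly f -` U)) u) \<and>
                pairwise disjnt v \<and> (\<forall>u\<in>v. \<exists>q. homeomorphism u T (poly f) q))"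
  proof (intro exI[of _ T] conjI exI[of _ v] ballI)
    show "openin (top_of_set U) T" using opT U by (auto simp: openin_open_eq T_def)
    show "\<Union> v = poly f -` U \<inter> poly f -` T"
      using pre by (auto simp: v_def T_def)
    show "openin (top_of_set (poly f -` U)) u" if "u \<in> v" for u
      using opv[OF that] that by (auto simp: openin_open_eq[OF opX] v_def T_def)
    have "ball y e \<inter> ball z e = {}" if "y \<in> F" "z \<in> F" "y \<noteq> z" for y z
      using e(3)[OF that] by (auto simp: disjoint_ballI)
    then show "pairwise disjnt v"
      unfolding v_def pairwise_image disjnt_def
      by (intro pairwiseI) blast
    show "\<exists>q. homeomorphism u T (poly f) q" if u: "u \<in> v" for u
    proof -
      obtain y where y: "y \<in> F" "u = ball y e \<inter> poly f -` T"
        using u by (auto simp: v_def)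
      have "T \<subseteq> poly f ` ball y e" using y(1) by (auto simp: T_def)
      then have "poly f ` u = T" unfolding y(2) by blast
      moreover have "inj_on (poly f) u"
        using inj[OF y(1)] y(2) by (auto intro: inj_on_subset)
      ultimately show ?thesis
        using invariance_of_domain_homeomorphism[of u "poly f"] opv[OF u] continuous_on_poly_fun
        by (metis order_refl)
    qed
  qed (use xT in auto)
qed

text \<open>After the linear factor of one preimage \<open>a\<close> is divided out, a quotient
  \<open>q\<close> of positive degree remains. Its value at \<open>a\<close> is the derivative of
  \<open>f\<close> there, which is nonzero, so a root of \<open>q\<close> is a second
  preimage.\<close>

lemma poly_two_preimages:
  fixes f :: "complex poly"
  assumes deg: "degree f \<ge> 2" and nc: "\<And>z. poly f z = x \<Longrightarrow> poly (pderiv f) z \<noteq> 0"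
  obtains a b where "a \<noteq> b" "poly f a = x" "poly f b = x"
proof -
  obtain a where a: "poly f a = x" using poly_surj[of f] deg by auto
  then have "[:-a, 1:] dvd f - [:x:]" by (simp add: poly_eq_0_iff_dvd[symmetric])
  then obtain q where q: "f - [:x:] = [:-a, 1:] * q" by blast
  have "degree (f - [:x:]) = degree f" by (rule degree_diff_const)
  moreover have q0: "q \<noteq> 0" using q deg by auto
  moreover have "degree ([:-a, 1:] * q) = 1 + degree q"
    using degree_mult_eq[OF _ q0, of "[:-a, 1:]"] by simp
  ultimately have "degree q > 0"
    using deg q by simp
  then obtain b where b: "poly q b = 0" using poly_surj by blast
  have fb: "poly f b = x"
    using arg_cong[OF q, of "\<lambda>p. poly p b"] b by simp
  have "pderiv f = pderiv ([:-a, 1:] * q)" unfolding q[symmetric] by (simp add: pderiv_diff pderiv_pCons)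
  then have "poly (pderiv f) a = poly q a" by (simp add: pderiv_mult pderiv_pCons del: mult_pCons_left)
  with nc[OF a] b have "a \<noteq> b" by auto
  with a fb that show ?thesis by blast
qed

text \<open>A section of the covering \<open>f\<close> over the simply connected \<open>U\<close> would have clopen image,
  so a connected preimage would make \<open>f\<close> injective on it.\<close>

lemma not_connected_poly_vimage_sublevel:
  fixes f h :: "complex poly"
  assumes deg: "degree f \<ge> 2" "degree h > 0" and r: "r > 0"
    and crit: "\<And>c. poly (pderiv f) c = 0 \<Longrightarrow> cmod (poly h (poly f c)) \<ge> r"
  shows "\<not> connected {z. cmod (poly h (poly f z)) < r}"
proof
  define U where "U = {w. cmod (poly h w) < r}"
  define X where "X = poly f -` U"
  assume "connected {z. cmod (poly h (poly f z)) < r}"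
  then have X: "connected X" by (simp add: X_def U_def vimage_def)
  have degf: "degree f > 0" using deg by simp
  have opU: "open U" unfolding U_def by (intro open_Collect_less continuous_intros)
  have opX: "open X"
    using continuous_on_open_vimage[of UNIV "poly f"] opU continuous_on_poly_fun by (auto simp: X_def)
  have fX: "poly f ` X = U"
    using poly_surj[OF degf] by (auto simp: image_iff X_def) metis
  have "connected U"
    using connected_continuous_image[OF continuous_on_poly_fun X] fX by metis
  then have sc: "simply_connected U"
    unfolding U_def by (rule simply_connected_poly_sublevel)
  have nc: "poly (pderiv f) z \<noteq> 0" if "poly f z \<in> U" for z
    using crit[of z] that by (auto simp: U_def)
  have cov: "covering_space X (poly f) U"
    unfolding X_def using poly_covering_space[OF degf opU] nc by blast
  obtain w where w: "poly h w = 0" using poly_surj[OF deg(2)] by blast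
  then have wU: "w \<in> U" using r by (simp add: U_def)
  obtain a b where ab: "a \<noteq> b" "poly f a = w" "poly f b = w"
    using poly_two_preimages[OF deg(1), of w] nc wU by metis
  obtain s where s: "continuous_on U s" "s \<in> U \<rightarrow> X" "\<And>y. y \<in> U \<Longrightarrow> poly f (s y) = y"
    using covering_space_lift[OF cov sc open_imp_locally_path_connected[OF opU], of "\<lambda>x. x"]
    by (auto simp: continuous_on_id)
  have inj: "inj_on s U" by (metis inj_onI s(3))
  have "open (s ` U)" by (rule invariance_of_domain[OF s(1) opU inj])
  then have 1: "openin (top_of_set X) (s ` U)"
    using s(2) by (auto simp: openin_open_eq[OF opX])
  have "s ` U = {x \<in> X. s (poly f x) = x}"
  proof (intro equalityI subsetI)
    fix x assume "x \<in> {x \<in> X. s (poly f x) = x}"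
    moreover from this have "poly f x \<in> U" using fX by auto
    ultimately show "x \<in> s ` U" by force
  qed (use s in auto)
  moreover have "closedin (top_of_set X) {x \<in> X. s (poly f x) - x \<in> {0}}"
    by (intro continuous_closedin_preimage[unfolded vimage_def Int_def mem_Collect_eq] continuous_intros
        continuous_on_compose2[OF s(1)] continuous_on_poly_fun) (use fX in auto)
  ultimately have "closedin (top_of_set X) (s ` U)" by simp
  with 1 X have "s ` U = {} \<or> s ` U = X" unfolding connected_clopen by blast
  with wU have sU: "s ` U = X" by auto
  have "a \<in> X" "b \<in> X" using ab wU by (auto simp: X_def)
  with sU s(3) ab show False by (metis imageE)
qed

text \<open>A polynomial restricts to a proper open map from its sublevel set to the disc, and so
  does its restriction to a relatively clopen part. The image of that part is open and closed in the
  connected disc.\<close>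

lemma clopen_sublevel_part_onto_ball:
  fixes g :: "complex poly"
  assumes deg: "degree g > 0"
    and AB: "open A" "open B" "A \<inter> B = {}" "A \<noteq> {}" "A \<union> B = {z. cmod (poly g z) < r}"
  shows "poly g ` A = ball 0 r"
proof -
  have sub: "poly g ` A \<subseteq> ball 0 r" using AB by auto
  have "openin (top_of_set (ball 0 r)) (poly g ` A)"
    using open_poly_image[OF deg AB(1)] sub by (simp add: openin_open_eq)
  moreover have "open (ball 0 r - poly g ` A)"
    unfolding open_contains_ball
  proof (intro ballI)
    fix y assume y: "y \<in> ball 0 r - poly g ` A"
    then obtain t where t: "cmod y < t" "t < r" using dense[of "cmod y" r] by auto
    obtain s where s: "\<And>z. cmod z \<ge> s \<Longrightarrow> cmod (poly g z) \<ge> t + 1"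
      using ex_norm_poly_ge[OF deg] by blast
    \<comment> \<open>As \<open>t < r\<close>, this compact set lies in the sublevel set; missing
      \<open>B\<close>, it lies in \<open>A\<close>. It contains every point of \<open>A\<close>
      with value in the disc of radius \<open>t\<close>, so near \<open>y\<close> its closed image
      is all that must be avoided.\<close>
    define K where "K = cball 0 s \<inter> {z. cmod (poly g z) \<le> t} - B"
    have "closed {z. cmod (poly g z) \<le> t}" by (intro closed_Collect_le continuous_intros)
    then have "compact K"
      unfolding K_def using AB(2) by (intro compact_diff compact_Int_closed) auto
    then have cl: "closed (poly g ` K)"
      by (intro compact_imp_closed compact_continuous_image continuous_on_poly_fun)
    have KA: "K \<subseteq> A"
    proof
      fix z assume z: "z \<in> K"
      then have "z \<in> A \<union> B" using t unfolding AB(5) K_def by simp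
      then show "z \<in> A" using z by (auto simp: K_def)
    qed
    have "open (ball 0 t - poly g ` K)" "y \<in> ball 0 t - poly g ` K"
      using cl y t KA by auto
    moreover have "ball 0 t - poly g ` K \<subseteq> ball 0 r - poly g ` A"
    proof
      fix w assume w: "w \<in> ball 0 t - poly g ` K"
      have "w \<notin> poly g ` A"
      proof
        assume "w \<in> poly g ` A"
        then obtain z where z: "z \<in> A" "w = poly g z" by auto
        have "cmod (poly g z) < t" using w z by simp
        moreover from this have "cmod z < s" using s[of z] by force
        ultimately have "z \<in> K" using z(1) AB(3) by (auto simp: K_def)
        with w z show False by auto
      qed
      with w t show "w \<in> ball 0 r - poly g ` A" by auto
    qed
    ultimately show "\<exists>e>0. ball y e \<subseteq> ball 0 r - poly g ` A"
      by (meson open_contains_ball subset_trans)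
  qed
  then have "closedin (top_of_set (ball 0 r)) (poly g ` A)"
    using sub by (simp add: closedin_def openin_open_eq)
  ultimately show ?thesis
    using connected_ball[of "0::complex" r] AB(4) by (metis connected_clopen image_is_empty)
qed

text \<open>In the coordinate \<open>w = 1/z\<close> the quotient \<open>z / p(z)\<close> becomes
  \<open>F\<close>, which is holomorphic also at \<open>w = 0\<close>, where the reflected
  polynomial takes the leading coefficient of \<open>p\<close>. The maximum principle spreads the
  bound \<open>1/2\<close> from the circle \<open>|z| = R\<close> over the whole exterior.\<close>

lemma poly_escape:
  fixes p :: "complex poly"
  assumes deg: "degree p \<ge> 2" and R: "R > 0"
    and nz: "\<And>z. cmod z \<ge> R \<Longrightarrow> poly p z \<noteq> 0"
    and bd: "\<And>z. cmod z = R \<Longrightarrow> cmod (poly p z) \<ge> 2 * R"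
    and z: "cmod z \<ge> R"
  shows "cmod (poly p z) \<ge> 2 * cmod z"
proof -
  define d where "d = degree p"
  define F where "F = (\<lambda>w. w ^ (d - 1) / poly (reflect_poly p) w)"
  have p0: "p \<noteq> 0" using deg by auto
  have refl: "poly (reflect_poly p) w = w ^ d * poly p (inverse w)" if "w \<noteq> 0" for w
    using that by (simp add: poly_reflect_poly_nz d_def)
  have nz': "poly (reflect_poly p) w \<noteq> 0" if "w \<in> cball 0 (1/R)" for w
  proof (cases "w = 0")
    case True
    then show ?thesis using p0 by (simp add: poly_0_coeff_0)
  next
    case False
    then have "cmod (inverse w) \<ge> R"
      using that R by (simp add: norm_inverse norm_divide field_simps)
    with False nz show ?thesis by (simp add: refl)
  qed
  have Fw: "F w = inverse w / poly p (inverse w)" if "w \<noteq> 0" for w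
    using that deg by (simp add: F_def refl d_def field_simps power_diff)
  define w where "w = inverse z"
  have z0: "z \<noteq> 0" using z R by auto
  have hol: "F holomorphic_on cball 0 (1/R)"
    unfolding F_def using nz' by (intro holomorphic_intros) auto
  have "cmod (F w) \<le> 1/2"
  proof (rule maximum_modulus_frontier[where S = "cball 0 (1/R)" and f = F])
    show "F holomorphic_on interior (cball 0 (1/R))"
      using hol by (rule holomorphic_on_subset) auto
    show "continuous_on (closure (cball 0 (1/R))) F"
      using holomorphic_on_imp_continuous_on[OF hol] by simp
    show "w \<in> cball 0 (1/R)"
      using z R z0 by (simp add: w_def norm_inverse norm_divide field_simps)
    fix u assume "u \<in> frontier (cball (0::complex) (1/R))"
    then have u: "cmod u = 1/R" using R by (simp add: frontier_cball)
    then have "u \<noteq> 0" using R by auto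
    then have "cmod (F u) = R / cmod (poly p (inverse u))"
      using u by (simp add: Fw norm_divide norm_inverse)
    also have "\<dots> \<le> 1/2"
      by (subst divide_le_eq) (use bd[of "inverse u"] u R in \<open>auto simp: norm_inverse\<close>)
    finally show "cmod (F u) \<le> 1/2" .
  qed simp
  moreover have "F w = z / poly p z" using Fw[of w] z0 by (simp add: w_def)
  ultimately show ?thesis
    using nz[OF z] by (simp add: norm_divide field_simps)
qed

lemma not_connected_open_split:
  assumes "open S" "\<not> connected S"
  obtains A B where "open A" "open B" "A \<inter> B = {}" "A \<noteq> {}" "B \<noteq> {}" "A \<union> B = S"
proof -
  obtain e1 e2 where "open e1" "open e2" "S \<subseteq> e1 \<union> e2" "e1 \<inter> e2 \<inter> S = {}" "e1 \<inter> S \<noteq> {}" "e2 \<inter> S \<noteq> {}"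
    using assms(2) unfolding connected_def by blast
  then show ?thesis using assms(1) by (intro that[of "e1 \<inter> S" "e2 \<inter> S"]) auto
qed

section \<open>The sphere and the space of polynomial maps\<close>

lemma abs_inner_stereo_le: "\<bar>stereo p \<bullet> stereo q\<bar> \<le> 1"
  using Cauchy_Schwarz_ineq2[of "stereo p" "stereo q"] by (simp add: norm_stereo)

text \<open>The half-angle formula gives \<open>4 (sin (t/2))\<^sup>2\<close> for the squared chord
  over an arc of length \<open>t\<close>. Continuity of \<open>stereo\<close> follows.\<close>

lemma norm_stereo_diff_le_dist: "norm (stereo p - stereo q) \<le> dist p q"
proof -
  define t where "t = dist p q"
  have c: "cos t = stereo p \<bullet> stereo q"
    using abs_inner_stereo_le[of p q] by (simp add: t_def dist_riemann_sphere_def cos_arccos_abs)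
  have "(norm (stereo p - stereo q))\<^sup>2 = 2 - 2 * cos t"
    by (simp add: power2_norm_eq_inner inner_diff c inner_commute)
       (simp add: dot_square_norm norm_stereo)
  also have "cos t = 1 - 2 * (sin (t / 2))\<^sup>2"
    using cos_double_sin[of "t / 2"] by simp
  also have "2 - 2 * (1 - 2 * (sin (t / 2))\<^sup>2) \<le> t\<^sup>2"
    using power_mono[OF abs_sin_x_le_abs_x[of "t/2"], of 2] by (simp add: power2_eq_square)
  finally show ?thesis
    unfolding t_def by (rule power2_le_imp_le) simp
qed

lemma continuous_on_stereo: "continuous_on S stereo"
  unfolding continuous_on_iff dist_norm[of "stereo _"]
  using norm_stereo_diff_le_dist by (meson le_less_trans)

text \<open>Continuity of \<open>arccos\<close> at \<open>1\<close> turns convergence of the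
  embedded points into convergence for the great-circle distance. Limits on the sphere can thus be
  computed in coordinates.\<close>

lemma tendsto_stereoD:
  assumes "((\<lambda>x. stereo (f x)) \<longlongrightarrow> stereo p) F"
  shows "(f \<longlongrightarrow> p) F"
proof -
  have "((\<lambda>x. stereo (f x) \<bullet> stereo p) \<longlongrightarrow> stereo p \<bullet> stereo p) F"
    by (intro tendsto_inner assms tendsto_const)
  moreover have "stereo p \<bullet> stereo p = 1" by (simp add: dot_square_norm norm_stereo)
  ultimately have "((\<lambda>x. arccos (stereo (f x) \<bullet> stereo p)) \<longlongrightarrow> arccos 1) F"
    using abs_inner_stereo_le
    by (intro continuous_on_tendsto_compose[OF continuous_on_arccos', of _ 1])
       (auto intro!: always_eventually simp: abs_le_iff minus_le_iff)
  then show ?thesis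
    by (subst tendsto_dist_iff) (simp add: dist_riemann_sphere_def)
qed

lemma continuous_on_Fin: "continuous_on S Fin"
proof -
  have pos: "1 + (cmod z)\<^sup>2 \<noteq> 0" for z
    using add_pos_nonneg[of 1 "(cmod z)\<^sup>2"] by simp
  have "(Fin \<longlongrightarrow> Fin z) (at z)" for z
    by (rule tendsto_stereoD) (auto intro!: tendsto_intros simp: pos)
  then show ?thesis by (simp add: continuous_at_imp_continuous_on isCont_def)
qed

fun unfin :: "riemann_sphere \<Rightarrow> complex" where
  "unfin (Fin z) = z"
| "unfin Infty = 0"

lemma continuous_on_unfin: "continuous_on (- {Infty}) unfin"
proof -
  have eq: "unfin p = fst (stereo p) /\<^sub>R (1 - snd (stereo p))" and ne: "1 - snd (stereo p) \<noteq> 0"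
    if ne: "p \<in> - {Infty}" for p
  proof -
    obtain z where p: "p = Fin z" using ne by (cases p) auto
    have 1: "1 + (cmod z)\<^sup>2 \<noteq> 0" using add_pos_nonneg[of 1 "(cmod z)\<^sup>2"] by simp
    have sn: "1 - snd (stereo p) = 2 / (1 + (cmod z)\<^sup>2)"
      using 1 by (simp add: p field_simps)
    then show "1 - snd (stereo p) \<noteq> 0" using 1 by simp
    have "inverse (2 / (1 + (cmod z)\<^sup>2)) * (2 / (1 + (cmod z)\<^sup>2)) = 1"
      using 1 by (intro left_inverse) simp
    moreover have "fst (stereo p) = (2 / (1 + (cmod z)\<^sup>2)) *\<^sub>R z" by (simp add: p)
    ultimately show "unfin p = fst (stereo p) /\<^sub>R (1 - snd (stereo p))"
      unfolding sn by (simp only: scaleR_scaleR p unfin.simps scaleR_one)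
  qed
  have "continuous_on (- {Infty}) (\<lambda>p. fst (stereo p) /\<^sub>R (1 - snd (stereo p)))"
    using ne by (intro continuous_intros continuous_on_stereo) auto
  then show ?thesis
    by (rule continuous_on_eq) (simp add: eq)
qed

lemma open_Fin_image: "open A \<Longrightarrow> open (Fin ` A)"
proof -
  assume "open A"
  then have "open (unfin -` A \<inter> - {Infty})"
    using continuous_on_unfin continuous_on_open_vimage[of "- {Infty}" unfin] by blast
  moreover have "Fin ` A = unfin -` A \<inter> - {Infty}"
  proof (intro set_eqI)
    fix p show "p \<in> Fin ` A \<longleftrightarrow> p \<in> unfin -` A \<inter> - {Infty}" by (cases p) auto
  qed
  ultimately show ?thesis by simp
qed

text \<open>These sets form a neighbourhood base at \<open>Infty\<close>, so convergence to infinity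
  becomes a statement about moduli.\<close>

definition outer :: "real \<Rightarrow> riemann_sphere set" where
  "outer R = insert Infty (Fin ` {z. cmod z > R})"

lemma Infty_in_outer [simp]: "Infty \<in> outer R"
  and Fin_in_outer [simp]: "Fin z \<in> outer R \<longleftrightarrow> cmod z > R"
  by (auto simp: outer_def)

lemma Compl_outer: "- outer R = Fin ` cball 0 R"
proof (intro set_eqI)
  fix p show "p \<in> - outer R \<longleftrightarrow> p \<in> Fin ` cball 0 R" by (cases p) auto
qed

lemma compact_Compl_outer: "compact (- outer R)"
  unfolding Compl_outer by (intro compact_continuous_image continuous_on_Fin compact_cball)

lemma open_outer: "open (outer R)"
  using compact_imp_closed[OF compact_Compl_outer] by (simp add: closed_def)

lemma tendsto_Fin_Infty: "(Fin \<longlongrightarrow> Infty) at_infinity"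
proof (rule tendsto_stereoD)
  have n: "filterlim cmod at_top at_infinity" by (rule filterlim_norm_at_top)
  have "((\<lambda>t::real. 2 / (1 + t\<^sup>2) * t) \<longlongrightarrow> 0) at_top"
    by real_asymp
  then have "((\<lambda>z. 2 / (1 + (cmod z)\<^sup>2) * cmod z) \<longlongrightarrow> 0) at_infinity"
    using filterlim_compose[OF _ n] by auto
  then have "((\<lambda>z. norm ((2 / (1 + (cmod z)\<^sup>2)) *\<^sub>R z)) \<longlongrightarrow> 0) at_infinity"
    by simp
  then have "((\<lambda>z. (2 / (1 + (cmod z)\<^sup>2)) *\<^sub>R z) \<longlongrightarrow> 0) at_infinity"
    by (rule tendsto_norm_zero_cancel)
  moreover have "((\<lambda>t::real. (t\<^sup>2 - 1) / (1 + t\<^sup>2)) \<longlongrightarrow> 1) at_top"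
    by real_asymp
  then have "((\<lambda>z. ((cmod z)\<^sup>2 - 1) / (1 + (cmod z)\<^sup>2)) \<longlongrightarrow> 1) at_infinity"
    using filterlim_compose[OF _ n] by auto
  ultimately show "((\<lambda>x. stereo (Fin x)) \<longlongrightarrow> stereo Infty) at_infinity"
    by (auto intro: tendsto_Pair)
qed

lemma ex_outer_subset:
  assumes "open U" "Infty \<in> U"
  obtains R where "R > 0" "outer R \<subseteq> U"
proof -
  have "eventually (\<lambda>z. Fin z \<in> U) at_infinity"
    using tendsto_Fin_Infty assms by (auto simp: tendsto_def)
  then obtain b where b: "\<And>z. cmod z \<ge> b \<Longrightarrow> Fin z \<in> U"
    by (auto simp: eventually_at_infinity)
  show ?thesis
    by (rule that[of "max b 1"]) (use assms b in \<open>auto simp: outer_def\<close>)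
qed

lemma ex_outer_dist_less:
  assumes "\<epsilon> > 0"
  obtains R where "R > 0" "\<And>p. p \<in> outer R \<Longrightarrow> dist p Infty < \<epsilon>"
proof -
  obtain R where "R > 0" "outer R \<subseteq> ball Infty \<epsilon>"
    using ex_outer_subset[of "ball Infty \<epsilon>"] assms by auto
  then show ?thesis by (intro that[of R]) (auto simp: dist_commute)
qed

text \<open>The member of a cover that contains \<open>Infty\<close> contains some
  \<open>outer R\<close>, and the rest is the continuous image of a closed disc.\<close>

lemma compact_sphere: "compact (UNIV :: riemann_sphere set)"
  unfolding compact_eq_Heine_Borel
proof (intro allI impI, elim conjE)
  fix \<C> :: "riemann_sphere set set" assume C: "\<forall>U\<in>\<C>. open U" "UNIV \<subseteq> \<Union>\<C>"
  then obtain U where U: "U \<in> \<C>" "Infty \<in> U" by blast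
  then obtain R where R: "outer R \<subseteq> U" using ex_outer_subset C(1) by metis
  have "- outer R \<subseteq> \<Union>\<C>" using C(2) by blast
  then obtain D where D: "D \<subseteq> \<C>" "finite D" "- outer R \<subseteq> \<Union>D"
    using compactE[OF compact_Compl_outer[of R], of \<C>] C(1) by metis
  have "UNIV \<subseteq> \<Union>(insert U D)" using R D(3) by blast
  with D U show "\<exists>C'\<subseteq>\<C>. finite C' \<and> UNIV \<subseteq> \<Union>C'"
    by (intro exI[of _ "insert U D"]) blast
qed

section \<open>Second countability of the sphere\<close>

lemma countable_dense_imp_countable_basis:
  fixes D :: "'a::metric_space set"
  assumes "countable D" and dense: "\<And>x e. e > 0 \<Longrightarrow> \<exists>d\<in>D. dist x d < e"
  shows "\<exists>B::'a set set. countable B \<and> open = generate_topology B"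
proof -
  define B where "B = (\<lambda>(d, n). ball d (1 / real (Suc n))) ` (D \<times> (UNIV :: nat set))"
  have "countable B" unfolding B_def using assms(1) by auto
  moreover have "topological_basis B"
  proof (rule topological_basisI)
    show "open b" if "b \<in> B" for b using that by (auto simp: B_def)
    fix U :: "'a set" and x assume U: "open U" "x \<in> U"
    then obtain e where e: "e > 0" "ball x e \<subseteq> U" by (auto simp: open_contains_ball)
    obtain n where n: "1 / real (Suc n) < e / 2"
      using nat_approx_posE[of "e/2"] e by auto
    obtain d where d: "d \<in> D" "dist x d < 1 / real (Suc n)"
      using dense[of "1 / real (Suc n)" x] by auto
    show "\<exists>b\<in>B. x \<in> b \<and> b \<subseteq> U"
    proof (intro bexI conjI)
      show "ball d (1 / real (Suc n)) \<in> B" using d by (auto simp: B_def)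
      show "x \<in> ball d (1 / real (Suc n))" using d by (simp add: dist_commute)
      show "ball d (1 / real (Suc n)) \<subseteq> U"
      proof
        fix y assume "y \<in> ball d (1 / real (Suc n))"
        then have "dist x y < e" using d n dist_triangle[of x y d] by auto
        with e show "y \<in> U" by auto
      qed
    qed
  qed
  ultimately show ?thesis using topological_basis_imp_subbasis by blast
qed

lemma compact_ball_cover:
  fixes S :: "'a::metric_space set"
  assumes "compact S" "\<And>x. \<delta> x > 0"
  obtains C where "finite C" "C \<subseteq> S" "S \<subseteq> (\<Union>x\<in>C. ball x (\<delta> x))"
  by (rule compactE_image[OF assms(1), of S "\<lambda>x. ball x (\<delta> x)"]) (use assms(2) in auto)

lemma ex_finite_net:
  assumes "e > 0"
  shows "\<exists>N :: riemann_sphere set. finite N \<and> (\<forall>x. \<exists>y\<in>N. dist x y < e)"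
proof -
  obtain N where "finite N" and N: "(UNIV :: riemann_sphere set) \<subseteq> (\<Union>x\<in>N. ball x e)"
    by (rule compact_ball_cover[OF compact_sphere, of "\<lambda>_. e"]) (use assms in auto)
  then have "\<exists>y\<in>N. dist x y < e" for x
  proof -
    have "x \<in> (\<Union>x\<in>N. ball x e)" using N by blast
    then show ?thesis by (auto simp: dist_commute)
  qed
  with \<open>finite N\<close> show ?thesis by blast
qed

instance riemann_sphere :: second_countable_topology
proof
  have "\<exists>N :: riemann_sphere set. finite N \<and> (\<forall>x. \<exists>y\<in>N. dist x y < 1 / real (Suc n))" for n
    by (rule ex_finite_net) simp
  then have "\<exists>N. \<forall>n. finite (N n) \<and> (\<forall>x :: riemann_sphere. \<exists>y\<in>N n. dist x y < 1 / real (Suc n))"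
    by (intro choice allI)
  then obtain N where N: "\<And>n. finite (N n)"
    "\<And>n (x :: riemann_sphere). \<exists>y\<in>N n. dist x y < 1 / real (Suc n)" by blast
  show "\<exists>B::riemann_sphere set set. countable B \<and> open = generate_topology B"
  proof (rule countable_dense_imp_countable_basis)
    show "countable (\<Union>n. N n)" using N by (auto intro: countable_finite)
    fix x and e :: real assume "e > 0"
    then obtain n where n: "1 / real (Suc n) < e" using nat_approx_posE by blast
    from N(2)[of n x] obtain y where "y \<in> N n" "dist x y < 1 / real (Suc n)" by blast
    with n show "\<exists>d\<in>(\<Union>n. N n). dist x d < e" by (intro bexI[of _ y]) auto
  qed
qed

section \<open>Polynomial maps on the sphere and the space they form\<close>

lemma continuous_on_sphere_map:
  assumes "degree p > 0"
  shows "continuous_on UNIV (sphere_map p)"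
  unfolding continuous_on_open_vimage[OF open_UNIV]
proof (intro allI impI)
  fix B :: "riemann_sphere set" assume B: "open B"
  have "open (Fin -` B)" using B continuous_on_Fin continuous_on_open_vimage[of UNIV Fin] by auto
  then have "open (poly p -` (Fin -` B))"
    using continuous_on_poly_fun continuous_on_open_vimage[of UNIV "poly p"] by auto
  then have 1: "open (Fin ` (poly p -` (Fin -` B)))" by (rule open_Fin_image)
  have *: "sphere_map p -` B \<inter> UNIV =
     Fin ` (poly p -` (Fin -` B)) \<union> (if Infty \<in> B then {Infty} else {})"
  proof (intro set_eqI)
    fix q show "q \<in> sphere_map p -` B \<inter> UNIV \<longleftrightarrow>
      q \<in> Fin ` (poly p -` (Fin -` B)) \<union> (if Infty \<in> B then {Infty} else {})"
      by (cases q) auto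
  qed
  show "open (sphere_map p -` B \<inter> UNIV)"
  proof (cases "Infty \<in> B")
    case True
    then obtain R where R: "outer R \<subseteq> B" using ex_outer_subset B by metis
    obtain s where s: "\<And>z. cmod z \<ge> s \<Longrightarrow> cmod (poly p z) \<ge> R + 1"
      using ex_norm_poly_ge[OF assms] by blast
    have "Fin (poly p z) \<in> B" if "cmod z > s" for z
      using s[of z] that R by (force simp: outer_def)
    then have "sphere_map p -` B \<inter> UNIV = Fin ` (poly p -` (Fin -` B)) \<union> outer s"
      unfolding * using True by (auto simp: outer_def)
    then show ?thesis using 1 open_outer by auto
  next
    case False
    then show ?thesis using 1 unfolding * by simp
  qed
qed

definition poly_of :: "poly_map \<Rightarrow> complex poly" where
  "poly_of f = (SOME p. app_map f = sphere_map p \<and> degree p \<ge> 2)"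

lemma app_map_eq: "app_map f = sphere_map (poly_of f)" and degree_poly_of: "degree (poly_of f) \<ge> 2"
proof -
  have "\<exists>p. app_map f = sphere_map p \<and> degree p \<ge> 2"
    using app_map[of f] by auto
  from someI_ex[OF this] show "app_map f = sphere_map (poly_of f)" "degree (poly_of f) \<ge> 2"
    by (auto simp: poly_of_def)
qed

lemma continuous_on_app_map: "continuous_on S (app_map f)"
  using continuous_on_sphere_map[of "poly_of f"] degree_poly_of[of f]
  by (auto simp: app_map_eq intro: continuous_on_subset)

lemma dist_app_map_le: "dist (app_map f z) (app_map g z) \<le> dist f g"
  unfolding dist_poly_map_def
  by (rule cSUP_upper) (auto intro!: bdd_aboveI[of _ pi] simp: dist_riemann_sphere_le_pi)

lemma dist_poly_map_leI: "(\<And>z. dist (app_map f z) (app_map g z) \<le> c) \<Longrightarrow> dist f g \<le> c"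
  unfolding dist_poly_map_def by (rule cSUP_least) auto

lemma app_map_unif_cont:
  assumes "e > 0"
  obtains d where "d > 0" "\<And>x y. dist x y < d \<Longrightarrow> dist (app_map f x) (app_map f y) < e"
proof -
  obtain d where "d > 0" "\<And>x y. dist y x < d \<Longrightarrow> dist (app_map f y) (app_map f x) < e"
    using compact_uniformly_continuous[OF continuous_on_app_map compact_sphere, of f] assms
    unfolding uniformly_continuous_on_def by auto
  then show ?thesis by (intro that[of d]) auto
qed

text \<open>Up to \<open>4 / k\<close>, a map is determined by its modulus of continuity at scale \<open>1 / k\<close> and by
  rounded values on a finite net; there are countably many such data.\<close>

instance poly_map :: second_countable_topology
proof
  define \<eta> where "\<eta> n = 1 / real (Suc n)" for n
  have \<eta>: "\<eta> n > 0" for n by (simp add: \<eta>_def)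
  have "\<exists>N :: riemann_sphere set. finite N \<and> (\<forall>x. \<exists>y\<in>N. dist x y < \<eta> n)" for n
    by (rule ex_finite_net[OF \<eta>])
  then have "\<exists>N. \<forall>n. finite (N n) \<and> (\<forall>x :: riemann_sphere. \<exists>y\<in>N n. dist x y < \<eta> n)"
    by (intro choice allI)
  then obtain N where N: "\<And>n. finite (N n)"
    "\<And>n (x :: riemann_sphere). \<exists>y\<in>N n. dist x y < \<eta> n" by blast
  define P where "P k m s f \<longleftrightarrow> (\<forall>x\<in>N m. dist (s x) (app_map f x) < \<eta> k) \<and>
     (\<forall>x y. dist x y < \<eta> m \<longrightarrow> dist (app_map f x) (app_map f y) < \<eta> k)" for k m s f
  define D where "D = (\<Union>k m. (\<lambda>s. SOME f. P k m s f) ` (PiE (N m) (\<lambda>_. N k)))"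
  have ex: "\<exists>m. \<exists>s\<in>PiE (N m) (\<lambda>_. N k). P k m s f" for k f
  proof -
    obtain d where d: "d > 0" "\<And>x y. dist x y < d \<Longrightarrow> dist (app_map f x) (app_map f y) < \<eta> k"
      using app_map_unif_cont[OF \<eta>] by metis
    obtain m where m: "\<eta> m < d" using nat_approx_posE[OF d(1)] unfolding \<eta>_def by blast
    obtain t where t: "\<And>x. t x \<in> N k \<and> dist (app_map f x) (t x) < \<eta> k"
      using N(2)[of k "app_map f _"] by metis
    have "P k m (restrict t (N m)) f"
      using t d(2) m unfolding P_def by (fastforce simp: dist_commute)
    then show ?thesis using t by (intro exI[of _ m] bexI[of _ "restrict t (N m)"]) auto
  qed
  show "\<exists>B::poly_map set set. countable B \<and> open = generate_topology B"
  proof (rule countable_dense_imp_countable_basis)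
    have "countable (PiE (N m) (\<lambda>_. N k))" for m k
      by (intro countable_finite finite_PiE N(1))
    then show "countable D"
      unfolding D_def by (intro countable_UN countableI_type countable_image)
    fix f :: poly_map and e :: real assume "e > 0"
    then obtain k where k: "\<eta> k < e / 4" using nat_approx_posE[of "e/4"] by (auto simp: \<eta>_def)
    obtain m s where s: "s \<in> PiE (N m) (\<lambda>_. N k)" "P k m s f" using ex by blast
    define g where "g = (SOME g. P k m s g)"
    have g: "P k m s g" using s(2) unfolding g_def by (rule someI)
    have "g \<in> D" using s(1) by (auto simp: D_def g_def)
    moreover have "dist f g \<le> 4 * \<eta> k"
    proof (rule dist_poly_map_leI)
      fix x
      obtain y where y: "y \<in> N m" "dist x y < \<eta> m" using N(2) by metis
      have "dist (app_map f x) (app_map g x) \<le>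
        dist (app_map f x) (app_map f y) + dist (app_map f y) (s y) +
        (dist (s y) (app_map g y) + dist (app_map g y) (app_map g x))"
        using dist_triangle[of "app_map f x" "app_map g x" "s y"]
          dist_triangle[of "app_map f x" "s y" "app_map f y"]
          dist_triangle[of "s y" "app_map g x" "app_map g y"]
        by linarith
      also have "\<dots> \<le> (\<eta> k + \<eta> k) + (\<eta> k + \<eta> k)"
        using s(2) g y unfolding P_def
        by (intro add_mono) (auto simp: dist_commute intro: less_imp_le)
      finally show "dist (app_map f x) (app_map g x) \<le> 4 * \<eta> k" by simp
    qed
    ultimately show "\<exists>d\<in>D. dist f d < e" using k by force
  qed
qed

lemma continuous_on_eval: "continuous_on UNIV (\<lambda>(f, z). app_map f z)"
  unfolding continuous_on_iff
proof clarsimp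
  fix f x and e :: real assume e: "e > 0"
  obtain d where d: "d > 0" "\<And>y z. dist y z < d \<Longrightarrow> dist (app_map f y) (app_map f z) < e / 2"
    using app_map_unif_cont[of "e/2"] e by auto
  show "\<exists>d>0. \<forall>g y. dist (g, y) (f, x) < d \<longrightarrow> dist (app_map g y) (app_map f x) < e"
  proof (intro exI[of _ "min d (e/2)"] conjI allI impI)
    fix g y assume *: "dist (g, y) (f, x) < min d (e / 2)"
    have "dist g f < e / 2" "dist y x < d"
      using * dist_fst_le[of "(g, y)" "(f, x)"] dist_snd_le[of "(g, y)" "(f, x)"] by auto
    then have "dist (app_map g y) (app_map f y) < e / 2" "dist (app_map f y) (app_map f x) < e / 2"
      using dist_app_map_le[of g y f] d(2) by auto
    then show "dist (app_map g y) (app_map f x) < e"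
      using dist_triangle[of "app_map g y" "app_map f x" "app_map f y"] by linarith
  qed (use d e in auto)
qed

text \<open>Second countability of both factors enters through \<open>borel_prod\<close>: the Borel
  sets of the product are those of the product sigma-algebra, so joint continuity suffices.\<close>

lemma measurable_eval [measurable]:
  "(\<lambda>(f, z). app_map f z) \<in> borel_measurable (borel \<Otimes>\<^sub>M borel)"
  unfolding borel_prod using continuous_on_eval by (rule borel_measurable_continuous_onI)

text \<open>The complement of the support is covered by the null members of a countable
  basis.\<close>

lemma AE_topological_support:
  fixes \<mu> :: "'a::second_countable_topology measure"
  assumes "sets \<mu> = sets borel"
  shows "AE x in \<mu>. x \<in> topological_support \<mu>"
proof -
  obtain B :: "'a set set" where B: "countable B" "topological_basis B"
    using ex_countable_basis by blast
  define N where "N = \<Union>{b\<in>B. emeasure \<mu> b = 0}"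
  have "N \<in> null_sets \<mu>"
    unfolding N_def
  proof (rule null_sets_UN'[where N = "\<lambda>x. x" and I = "{b\<in>B. emeasure \<mu> b = 0}", simplified])
    show "countable {b\<in>B. emeasure \<mu> b = 0}" using B by (auto intro: countable_subset)
    show "\<And>b. b \<in> B \<and> emeasure \<mu> b = 0 \<Longrightarrow> b \<in> null_sets \<mu>"
      using B assms by (auto simp: null_sets_def topological_basis_open)
  qed
  moreover have "x \<in> N" if x: "x \<notin> topological_support \<mu>" for x
  proof -
    obtain U where U: "open U" "x \<in> U" "emeasure \<mu> U = 0"
      using x by (auto simp: topological_support_def not_gr_zero)
    obtain b where b: "b \<in> B" "x \<in> b" "b \<subseteq> U" using topological_basisE[OF B(2) U(1,2)] by metis
    have "emeasure \<mu> b \<le> emeasure \<mu> U"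
      using b U assms by (intro emeasure_mono) auto
    with U b show ?thesis by (auto simp: N_def)
  qed
  ultimately show ?thesis by (intro AE_I'[of N]) auto
qed

text \<open>A closed disc is compact and disjoint from the closed complement of a larger open disc,
  hence at positive distance from it. Spherical closeness is thereby converted into bounds on
  moduli, at the price of a larger radius.\<close>

lemma sphere_gap:
  assumes "a < b"
  obtains \<delta> where "\<delta> > 0" "\<And>z p. cmod z \<le> a \<Longrightarrow> dist (Fin z) p < \<delta> \<Longrightarrow> \<exists>w. p = Fin w \<and> cmod w < b"
proof (cases "a \<ge> 0")
  case True
  define K where "K = Fin ` cball 0 a"
  define C where "C = - Fin ` ball 0 b"
  have K: "compact K" "K \<noteq> {}"
    using True by (auto simp: K_def intro!: compact_continuous_image continuous_on_Fin)
  have C: "closed C" unfolding C_def using open_Fin_image[of "ball 0 b"] by (simp add: closed_def)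
  have InC: "Infty \<in> C" by (auto simp: C_def)
  obtain x where x: "x \<in> K" "\<And>y. y \<in> K \<Longrightarrow> infdist x C \<le> infdist y C"
  proof -
    have "continuous_on K (\<lambda>p. infdist p C)" by (intro continuous_intros)
    from continuous_attains_inf[OF K this] that show ?thesis by blast
  qed
  have "x \<notin> C" using x(1) assms by (auto simp: K_def C_def)
  then have pos: "infdist x C > 0"
    using C InC by (metis infdist_pos_not_in_closed empty_iff)
  show ?thesis
  proof (rule that[OF pos])
    fix z p assume z: "cmod z \<le> a" "dist (Fin z) p < infdist x C"
    have "p \<notin> C"
      using x(2)[of "Fin z"] z infdist_le[of p C "Fin z"] by (auto simp: K_def)
    then show "\<exists>w. p = Fin w \<and> cmod w < b" by (auto simp: C_def)
  qed
next
  case False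
  then have "\<not> cmod z \<le> a" for z using norm_ge_zero[of z] by linarith
  then show ?thesis by (intro that[of 1]) auto
qed

section \<open>A doubling radius common to a compact family\<close>

lemma norm_poly_ge_linear:
  fixes p :: "complex poly"
  assumes "degree p \<ge> 2"
  obtains r where "r > 0" "\<And>z. cmod z \<ge> r \<Longrightarrow> cmod (poly p z) \<ge> c * cmod z"
proof -
  obtain a q where p: "p = pCons a q" by (cases p)
  have "degree q > 0" using assms p by (cases "q = 0") auto
  then obtain s where s: "\<And>z. cmod z \<ge> s \<Longrightarrow> cmod (poly q z) \<ge> \<bar>c\<bar> + 1"
    using ex_norm_poly_ge by blast
  show ?thesis
  proof (rule that[of "max 1 (max s (cmod a))"])
    fix z assume z: "max 1 (max s (cmod a)) \<le> cmod z"
    have "cmod (z * poly q z) \<ge> cmod z * (\<bar>c\<bar> + 1)"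
      unfolding norm_mult using s[of z] z by (intro mult_left_mono) auto
    moreover have "cmod (poly p z) \<ge> cmod (z * poly q z) - cmod a"
      using norm_diff_ineq[of "z * poly q z" a] by (simp add: p add.commute)
    moreover have "c * cmod z \<le> \<bar>c\<bar> * cmod z" by (intro mult_right_mono) auto
    ultimately show "c * cmod z \<le> cmod (poly p z)" using z by (simp add: algebra_simps)
  qed auto
qed

definition doubles_beyond :: "real \<Rightarrow> poly_map \<Rightarrow> bool" where
  "doubles_beyond R f \<longleftrightarrow> (\<forall>z. cmod z \<ge> R \<longrightarrow> cmod (poly (poly_of f) z) \<ge> 2 * cmod z)"

lemma doubles_beyond_mono: "doubles_beyond R f \<Longrightarrow> R \<le> R' \<Longrightarrow> doubles_beyond R' f"
  by (auto simp: doubles_beyond_def)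

text \<open>The factor \<open>4\<close> for \<open>f\<close> leaves room to spare: a nearby
  \<open>g\<close> still takes values beyond \<open>2 r\<close> wherever \<open>|z| \<ge> r\<close>.
  This weaker information is what \<open>poly_escape\<close> upgrades to doubling.\<close>

lemma doubles_beyond_nhd:
  obtains r \<delta> where "r > 0" "\<delta> > 0" "\<And>g. dist f g < \<delta> \<Longrightarrow> doubles_beyond r g"
proof -
  obtain r where r: "r > 0" "\<And>z. cmod z \<ge> r \<Longrightarrow> cmod (poly (poly_of f) z) \<ge> 4 * cmod z"
    using norm_poly_ge_linear[OF degree_poly_of] by metis
  obtain \<delta> where \<delta>: "\<delta> > 0"
    "\<And>z p. cmod z \<le> 2 * r \<Longrightarrow> dist (Fin z) p < \<delta> \<Longrightarrow> \<exists>w. p = Fin w \<and> cmod w < 4 * r"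
    using sphere_gap[of "2 * r" "4 * r"] r(1) by auto
  show ?thesis
  proof (rule that[OF r(1) \<delta>(1)])
    fix g assume g: "dist f g < \<delta>"
    have big: "cmod (poly (poly_of g) z) > 2 * r" if z: "cmod z \<ge> r" for z
    proof (rule ccontr)
      assume "\<not> ?thesis"
      moreover have "dist (Fin (poly (poly_of g) z)) (Fin (poly (poly_of f) z)) < \<delta>"
        using dist_app_map_le[of f "Fin z" g] g by (simp add: app_map_eq dist_commute)
      ultimately have "cmod (poly (poly_of f) z) < 4 * r" using \<delta>(2) by force
      with r(2)[OF z] z show False by simp
    qed
    show "doubles_beyond r g"
      unfolding doubles_beyond_def
    proof (intro allI impI)
      fix z assume "cmod z \<ge> r"
      then show "2 * cmod z \<le> cmod (poly (poly_of g) z)"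
        using poly_escape[OF degree_poly_of r(1)] big r(1) by (smt (verit) norm_zero)
    qed
  qed
qed

lemma ex_doubles_beyond:
  assumes "compact \<Gamma>"
  obtains R where "R > 0" "\<And>f. f \<in> \<Gamma> \<Longrightarrow> doubles_beyond R f"
proof -
  obtain r \<delta> where r: "\<And>f. r f > 0" "\<And>f. \<delta> f > 0" "\<And>f g. dist f g < \<delta> f \<Longrightarrow> doubles_beyond (r f) g"
  proof -
    have "\<exists>r \<delta>. r > 0 \<and> \<delta> > 0 \<and> (\<forall>g. dist f g < \<delta> \<longrightarrow> doubles_beyond r g)" for f
      by (rule doubles_beyond_nhd[of f]) blast
    then show ?thesis using that by metis
  qed
  obtain C where C: "finite C" "C \<subseteq> \<Gamma>" "\<Gamma> \<subseteq> (\<Union>f\<in>C. ball f (\<delta> f))"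
    by (rule compact_ball_cover[OF assms, of \<delta>]) (use r(2) in auto)
  define R where "R = Max (insert 1 (r ` C))"
  have "R \<ge> 1" "\<And>f. f \<in> C \<Longrightarrow> r f \<le> R" using C(1) by (auto simp: R_def)
  then show ?thesis
    using C r(3) doubles_beyond_mono by (intro that[of R]) (auto simp: subset_eq, metis)
qed

lemma compact_imp_unif_equicont:
  assumes "compact \<Gamma>" "e > 0"
  obtains d where "d > 0" "\<And>f x y. f \<in> \<Gamma> \<Longrightarrow> dist x y < d \<Longrightarrow> dist (app_map f x) (app_map f y) < e"
proof -
  obtain C where C: "finite C" "C \<subseteq> \<Gamma>" "\<Gamma> \<subseteq> (\<Union>f\<in>C. ball f (e/3))"
    by (rule compact_ball_cover[OF assms(1), of "\<lambda>_. e/3"]) (use assms(2) in auto)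
  have "\<exists>d>0. \<forall>x y. dist x y < d \<longrightarrow> dist (app_map f x) (app_map f y) < e/3" for f
    using app_map_unif_cont[of "e/3"] assms(2) by (metis divide_pos_pos zero_less_numeral)
  then obtain d where d: "\<And>f. d f > 0"
    "\<And>f x y. dist x y < d f \<Longrightarrow> dist (app_map f x) (app_map f y) < e/3" by metis
  define D where "D = Min (insert 1 (d ` C))"
  have D: "D > 0" "\<And>f. f \<in> C \<Longrightarrow> D \<le> d f" using C(1) d(1) by (auto simp: D_def)
  show ?thesis
  proof (rule that[OF D(1)])
    fix f and x y :: riemann_sphere assume f: "f \<in> \<Gamma>" and xy: "dist x y < D"
    obtain g where g: "g \<in> C" "dist g f < e/3" using C f by auto
    have "dist (app_map g x) (app_map g y) < e/3" using d(2) D(2)[OF g(1)] xy by force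
    moreover have "dist (app_map g x) (app_map f x) < e/3" "dist (app_map g y) (app_map f y) < e/3"
      using dist_app_map_le g(2) by (meson le_less_trans)+
    ultimately show "dist (app_map f x) (app_map f y) < e"
      using dist_triangle[of "app_map f x" "app_map f y" "app_map g x"]
        dist_triangle[of "app_map g x" "app_map f y" "app_map g y"]
        dist_commute[of "app_map f x" "app_map g x"]
      by linarith
  qed
qed

section \<open>Words\<close>

text \<open>The polynomial counterpart of \<open>seq_comp\<close>, with the identity as empty word.
  Degrees, preimages and sublevel sets are treated at this level.\<close>

fun word :: "(nat \<Rightarrow> poly_map) \<Rightarrow> nat \<Rightarrow> complex poly" where
  "word \<gamma> 0 = [:0, 1:]"
| "word \<gamma> (Suc n) = pcompose (poly_of (\<gamma> n)) (word \<gamma> n)"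

lemma degree_word: "degree (word \<gamma> n) > 0"
proof (induction n)
  case (Suc n)
  then show ?case using degree_poly_of[of "\<gamma> n"] by (simp add: degree_pcompose)
qed simp

lemma seq_comp_eq_sphere_map: "seq_comp \<gamma> n = sphere_map (word \<gamma> n)"
proof (induction n)
  case 0
  show ?case
  proof
    fix p show "seq_comp \<gamma> 0 p = sphere_map (word \<gamma> 0) p" by (cases p) auto
  qed
next
  case (Suc n)
  show ?case
  proof
    fix p show "seq_comp \<gamma> (Suc n) p = sphere_map (word \<gamma> (Suc n)) p"
      by (cases p) (auto simp: Suc app_map_eq poly_pcompose)
  qed
qed

lemma continuous_on_seq_comp: "continuous_on S (seq_comp \<gamma> n)"
  unfolding seq_comp_eq_sphere_map
  using continuous_on_sphere_map[OF degree_word] by (rule continuous_on_subset) auto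

lemma seq_comp_cong: "(\<And>i. i < n \<Longrightarrow> \<gamma> i = \<delta> i) \<Longrightarrow> seq_comp \<gamma> n = seq_comp \<delta> n"
  by (induction n) auto

lemma seq_comp_add: "seq_comp \<gamma> (m + n) = seq_comp (\<lambda>i. \<gamma> (i + m)) n \<circ> seq_comp \<gamma> m"
  by (induction n) (auto simp: add.commute)

lemma poly_word_add:
  "poly (word \<gamma> (m + n)) z = poly (word (\<lambda>i. \<gamma> (i + m)) n) (poly (word \<gamma> m) z)"
  using fun_cong[OF seq_comp_add[of \<gamma> m n], of "Fin z"] by (simp add: seq_comp_eq_sphere_map)

text \<open>A finite word is written as an initial segment of an infinite sequence in
  \<open>S\<close>, so that words can be shifted and concatenated by \<open>comb_seq\<close>. The
  condition \<open>n \<ge> 1\<close> is there because the identity need not belong to the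
  semigroup.\<close>

lemma generated_semigroup_iff:
  "g \<in> generated_semigroup S \<longleftrightarrow> (\<exists>\<gamma> n. range \<gamma> \<subseteq> S \<and> n \<ge> 1 \<and> g = seq_comp \<gamma> n)"
proof
  assume "g \<in> generated_semigroup S"
  then show "\<exists>\<gamma> n. range \<gamma> \<subseteq> S \<and> n \<ge> 1 \<and> g = seq_comp \<gamma> n"
  proof induction
    case (generator f)
    then show ?case by (intro exI[of _ "\<lambda>_. f"] exI[of _ 1]) auto
  next
    case (composition g h)
    then obtain \<gamma> n \<delta> m where gh: "range \<gamma> \<subseteq> S" "n \<ge> 1" "g = seq_comp \<gamma> n"
      "range \<delta> \<subseteq> S" "m \<ge> 1" "h = seq_comp \<delta> m" by blast
    have "seq_comp (comb_seq m \<delta> \<gamma>) (m + n) = g \<circ> h"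
      unfolding seq_comp_add gh
      by (intro arg_cong2[where f = "(\<circ>)"] seq_comp_cong) (auto simp: comb_seq_add comb_seq_less)
    moreover have "range (comb_seq m \<delta> \<gamma>) \<subseteq> S" using gh by (auto simp: comb_seq_def)
    ultimately show ?case using gh by (intro exI[of _ "comb_seq m \<delta> \<gamma>"] exI[of _ "m + n"]) auto
  qed
next
  assume "\<exists>\<gamma> n. range \<gamma> \<subseteq> S \<and> n \<ge> 1 \<and> g = seq_comp \<gamma> n"
  then obtain \<gamma> n where *: "range \<gamma> \<subseteq> S" "n \<ge> 1" "g = seq_comp \<gamma> n" by blast
  from *(2) have "seq_comp \<gamma> n \<in> generated_semigroup S"
  proof (induction n rule: dec_induct)
    case base
    then show ?case using *(1) by (auto intro: generated_semigroup.generator)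
  next
    case (step n)
    have "app_map (\<gamma> n) \<in> generated_semigroup S"
      using *(1) by (intro generated_semigroup.generator) auto
    from generated_semigroup.composition[OF this step.IH] show ?case by (simp only: seq_comp.simps)
  qed
  with * show "g \<in> generated_semigroup S" by simp
qed

lemma word_doubles:
  assumes "\<And>i. doubles_beyond R (\<gamma> i)" "R > 0" "cmod z \<ge> R"
  shows "cmod (poly (word \<gamma> n) z) \<ge> 2 ^ n * cmod z"
proof (induction n)
  case (Suc n)
  have "(1::real) * cmod z \<le> 2 ^ n * cmod z" by (intro mult_right_mono) auto
  with Suc assms(3) have "R \<le> cmod (poly (word \<gamma> n) z)" by linarith
  then have "2 * cmod (poly (word \<gamma> n) z) \<le> cmod (poly (word \<gamma> (Suc n)) z)"
    using assms(1)[of n] by (simp add: doubles_beyond_def poly_pcompose)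
  with Suc show ?case by simp
qed simp

lemma seq_comp_outer:
  assumes "\<And>i. doubles_beyond R (\<gamma> i)" "R > 0" "p \<in> outer R"
  shows "seq_comp \<gamma> n p \<in> outer (2 ^ n * R)"
proof (cases p)
  case (Fin z)
  then have z: "cmod z > R" using assms by simp
  then have "2 ^ n * R < 2 ^ n * cmod z" by simp
  also have "\<dots> \<le> cmod (poly (word \<gamma> n) z)" using word_doubles assms z by force
  finally show ?thesis by (simp add: Fin seq_comp_eq_sphere_map)
qed (simp add: seq_comp_eq_sphere_map)

lemma ex_pow2_ge:
  fixes R M :: real
  assumes "R > 0"
  obtains n where "\<And>k. k \<ge> n \<Longrightarrow> 2 ^ k * R \<ge> M"
proof -
  obtain n where n: "2 ^ n > M / R" using real_arch_pow[of 2] by auto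
  show ?thesis
  proof (rule that[of n])
    fix k assume "k \<ge> n"
    then have "(2::real) ^ n \<le> 2 ^ k" by (intro power_increasing) auto
    with n have "M / R \<le> 2 ^ k" by linarith
    then show "M \<le> 2 ^ k * R" using assms by (simp add: pos_divide_le_eq)
  qed
qed

lemma outer_antimono: "R \<le> R' \<Longrightarrow> outer R' \<subseteq> outer R"
  by (auto simp: outer_def)

section \<open>Continuous functions and measures on the sphere\<close>

lemma continuous_sphere_bounded:
  fixes \<phi> :: "riemann_sphere \<Rightarrow> real"
  assumes "continuous_on UNIV \<phi>"
  obtains B where "B > 0" "\<And>p. \<bar>\<phi> p\<bar> \<le> B"
  using compact_imp_bounded[OF compact_continuous_image[OF assms compact_sphere]]
  unfolding bounded_pos by auto

text \<open>The functions \<open>min 1 (k dist(p, -U))\<close> increase to the indicator of an open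
  \<open>U\<close>, so the integrals determine the measure of every open set, and open sets form an
  intersection-stable generator. This gives the uniqueness behind the definite description of the
  dual operator.\<close>

lemma prob_measures_eqI:
  fixes \<mu> \<nu> :: "riemann_sphere measure"
  assumes mn: "\<mu> \<in> prob_measures" "\<nu> \<in> prob_measures"
    and eq: "\<And>\<phi> :: riemann_sphere \<Rightarrow> real. continuous_on UNIV \<phi> \<Longrightarrow> integral\<^sup>L \<mu> \<phi> = integral\<^sup>L \<nu> \<phi>"
  shows "\<mu> = \<nu>"
proof -
  define F where "F U k p = min 1 (real k * infdist p (- U))" for U k and p :: riemann_sphere
  have cont: "continuous_on UNIV (F U k)" for U k
    unfolding F_def by (intro continuous_intros)
  have lim: "(\<lambda>k. integral\<^sup>L \<rho> (F U k)) \<longlonglongrightarrow> measure \<rho> U"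
    if \<rho>: "\<rho> \<in> prob_measures" and U: "open U" "U \<noteq> UNIV" for \<rho> U
  proof -
    interpret prob_space \<rho> using \<rho> by (simp add: prob_measures_def)
    have [measurable_cong]: "sets \<rho> = sets borel" using \<rho> by (simp add: prob_measures_def)
    have [measurable]: "U \<in> sets borel" using U by simp
    have "(\<lambda>k. integral\<^sup>L \<rho> (F U k)) \<longlonglongrightarrow> integral\<^sup>L \<rho> (indicat_real U)"
    proof (rule integral_dominated_convergence[where w = "\<lambda>_. 1"])
      show "F U k \<in> borel_measurable \<rho>" for k
        using borel_measurable_continuous_onI[OF cont] by measurable
      show "AE p in \<rho>. (\<lambda>k. F U k p) \<longlonglongrightarrow> indicat_real U p"
      proof (intro always_eventually allI)
        fix p
        show "(\<lambda>k. F U k p) \<longlonglongrightarrow> indicat_real U p"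
        proof (cases "p \<in> U")
          case True
          then have pos: "infdist p (- U) > 0"
            using U by (intro infdist_pos_not_in_closed) (auto simp: closed_def)
          obtain n where n: "real n * infdist p (- U) > 1"
            using ex_less_of_nat_mult[OF pos, of 1] by auto
          have "F U k p = 1" if "k \<ge> n" for k
          proof -
            have "real n * infdist p (- U) \<le> real k * infdist p (- U)"
              using that pos by (intro mult_right_mono) auto
            with n show ?thesis by (simp add: F_def)
          qed
          then have "eventually (\<lambda>k. F U k p = 1) sequentially"
            by (auto simp: eventually_sequentially)
          then show ?thesis using True by (simp add: tendsto_eventually)
        qed (simp add: F_def)
      qed
      show "AE p in \<rho>. norm (F U k p) \<le> 1" for k
        by (auto simp: F_def infdist_nonneg intro!: always_eventually)
    qed auto
    then show ?thesis by simp
  qed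
  interpret m: prob_space \<mu> using mn by (simp add: prob_measures_def)
  interpret n: prob_space \<nu> using mn by (simp add: prob_measures_def)
  have sp: "space \<mu> = UNIV" "space \<nu> = UNIV" and st: "sets \<mu> = sets borel" "sets \<nu> = sets borel"
    using mn sets_eq_imp_space_eq[of \<mu> borel] sets_eq_imp_space_eq[of \<nu> borel]
    by (auto simp: prob_measures_def)
  have meq: "emeasure \<mu> U = emeasure \<nu> U" if U: "open U" for U
  \<comment> \<open>\<open>infdist\<close> to the empty set is \<open>0\<close>, so the
    approximating functions do not reach the indicator of the whole space. There both measures are
    \<open>1\<close>.\<close>
  proof (cases "U = UNIV")
    case True
    then show ?thesis using m.emeasure_space_1 n.emeasure_space_1 sp by simp
  next
    case False
    have "measure \<mu> U = measure \<nu> U"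
      using lim[OF mn(1) U False] lim[OF mn(2) U False] eq[OF cont]
      by (intro LIMSEQ_unique[of "\<lambda>k. integral\<^sup>L \<mu> (F U k)"]) auto
    then show ?thesis by (simp add: m.emeasure_eq_measure n.emeasure_eq_measure)
  qed
  show ?thesis
  proof (rule measure_eqI_generator_eq[where E = "{S. open S}" and \<Omega> = UNIV and A = "\<lambda>_. UNIV"])
    show "Int_stable {S :: riemann_sphere set. open S}" by (auto simp: Int_stable_def)
    show "sets \<mu> = sigma_sets UNIV {S. open S}" "sets \<nu> = sigma_sets UNIV {S. open S}"
      using st by (simp_all add: borel_def)
    show "emeasure \<mu> UNIV \<noteq> \<infinity>" using m.emeasure_finite by simp
  qed (use meq in auto)
qed

section \<open>The transition operator\<close>

definition bump :: "real \<Rightarrow> riemann_sphere \<Rightarrow> real" where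
  "bump R p = (case p of Fin z \<Rightarrow> max 0 (min 1 (2 - cmod z / R)) | Infty \<Rightarrow> 0)"

lemma bump_bounds: "0 \<le> bump R p" "bump R p \<le> 1"
  by (auto simp: bump_def split: riemann_sphere.split)

lemma bump_outer: "R > 0 \<Longrightarrow> p \<in> outer (2 * R) \<Longrightarrow> bump R p = 0"
  by (cases p) (auto simp: bump_def max_def min_def field_simps)

lemma bump_inner: "R > 0 \<Longrightarrow> cmod z \<le> R \<Longrightarrow> bump R (Fin z) = 1"
  by (auto simp: bump_def max_def min_def field_simps)

lemma continuous_on_bump:
  assumes "R > 0"
  shows "continuous_on UNIV (bump R)"
proof -
  have "continuous_on (- {Infty}) (\<lambda>p. max 0 (min 1 (2 - cmod (unfin p) / R)))"
    using assms by (intro continuous_intros continuous_on_unfin) auto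
  then have 1: "continuous_on (- {Infty}) (bump R)"
  proof (rule continuous_on_eq)
    fix p assume "p \<in> - {Infty}"
    then show "max 0 (min 1 (2 - cmod (unfin p) / R)) = bump R p"
      by (cases p) (auto simp: bump_def)
  qed
  have "continuous_on (outer (2 * R)) (bump R)"
    by (rule continuous_on_eq[OF continuous_on_const[of _ 0]]) (use assms in \<open>simp add: bump_outer\<close>)
  then have "continuous_on (- {Infty} \<union> outer (2 * R)) (bump R)"
    using 1 by (intro continuous_on_open_Un open_outer) auto
  moreover have "- {Infty} \<union> outer (2 * R) = UNIV" by (auto simp: outer_def)
  ultimately show ?thesis by simp
qed

locale compact_law =
  fixes \<tau> :: "poly_map measure"
  assumes law: "\<tau> \<in> compactly_supported_prob_measures"
begin

abbreviation "\<Gamma> \<equiv> topological_support \<tau>"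
abbreviation "M \<equiv> transition_op \<tau>"
abbreviation "D \<equiv> dual_transition_op \<tau>"

lemma sets_law [simp, measurable_cong]: "sets \<tau> = sets borel"
  and compact_support: "compact \<Gamma>"
  using law by (auto simp: compactly_supported_prob_measures_def prob_measures_def)

lemma space_law [simp]: "space \<tau> = UNIV"
  using sets_eq_imp_space_eq[OF sets_law] by simp

sublocale prob_space \<tau>
  using law by (auto simp: compactly_supported_prob_measures_def prob_measures_def)

lemma prob_UNIV [simp]: "prob UNIV = 1"
  using prob_space by simp

lemma AE_support: "AE f in \<tau>. f \<in> \<Gamma>"
  by (rule AE_topological_support) simp

lemma support_nonempty: "\<Gamma> \<noteq> {}"
  using AE_support AE_False by (metis (mono_tags, lifting) AE_cong empty_iff)

lemma continuous_on_app: "continuous_on S (\<lambda>f. app_map f z)"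
  unfolding continuous_on_iff using dist_app_map_le by (meson le_less_trans)

lemma continuous_on_comp_app:
  "continuous_on UNIV \<phi> \<Longrightarrow> continuous_on UNIV (\<lambda>f. \<phi> (app_map f z))"
  by (rule continuous_on_compose2[OF _ continuous_on_app]) auto

lemma integrable_comp_app:
  fixes \<phi> :: "riemann_sphere \<Rightarrow> real"
  assumes "continuous_on UNIV \<phi>"
  shows "integrable \<tau> (\<lambda>f. \<phi> (app_map f z))"
proof -
  obtain B where "\<And>p. \<bar>\<phi> p\<bar> \<le> B" using continuous_sphere_bounded[OF assms] by metis
  moreover have "(\<lambda>f. \<phi> (app_map f z)) \<in> borel_measurable \<tau>"
    using borel_measurable_continuous_onI[OF continuous_on_comp_app[OF assms]] by simp
  ultimately show ?thesis by (intro integrable_const_bound[where B = B]) auto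
qed

lemma continuous_on_transition:
  assumes "continuous_on UNIV \<phi>"
  shows "continuous_on UNIV (M \<phi>)"
proof -
  obtain B where B: "\<And>p. \<bar>\<phi> p\<bar> \<le> B" using continuous_sphere_bounded[OF assms] by metis
  have "(\<lambda>n. M \<phi> (x n)) \<longlonglongrightarrow> M \<phi> a" if x: "x \<longlonglongrightarrow> a" for x a
    unfolding transition_op_def
  proof (rule integral_dominated_convergence[where w = "\<lambda>_. B"])
    show "(\<lambda>f. \<phi> (app_map f a)) \<in> borel_measurable \<tau>" "(\<lambda>f. \<phi> (app_map f (x i))) \<in> borel_measurable \<tau>" for i
      using integrable_comp_app[OF assms] by auto
    show "AE f in \<tau>. (\<lambda>i. \<phi> (app_map f (x i))) \<longlonglongrightarrow> \<phi> (app_map f a)"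
    proof (intro always_eventually allI)
      fix f
      have "continuous_on UNIV (\<lambda>p. \<phi> (app_map f p))"
        by (rule continuous_on_compose2[OF assms continuous_on_app_map]) auto
      then show "(\<lambda>i. \<phi> (app_map f (x i))) \<longlonglongrightarrow> \<phi> (app_map f a)"
        using x by (rule continuous_on_tendsto_compose) auto
    qed
  qed (use B in auto)
  then show ?thesis
    unfolding continuous_on_sequentially by (auto simp: comp_def)
qed

lemma continuous_on_iterates: "continuous_on UNIV \<phi> \<Longrightarrow> continuous_on UNIV ((M ^^ n) \<phi>)"
  by (induction n) (auto intro: continuous_on_transition)

lemma transition_mono:
  assumes "continuous_on UNIV \<phi>" "continuous_on UNIV \<psi>" "\<And>p. \<phi> p \<le> \<psi> p"
  shows "M \<phi> p \<le> M \<psi> p"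
  unfolding transition_op_def using assms by (intro integral_mono integrable_comp_app) auto

lemma iterates_mono:
  assumes "continuous_on UNIV \<phi>" "continuous_on UNIV \<psi>" "\<And>p. \<phi> p \<le> \<psi> p"
  shows "(M ^^ n) \<phi> p \<le> (M ^^ n) \<psi> p"
  by (induction n arbitrary: p) (auto intro!: transition_mono continuous_on_iterates assms)

lemma transition_affine:
  assumes "continuous_on UNIV \<phi>"
  shows "M (\<lambda>p. c + a * \<phi> p) p = c + a * M \<phi> p"
  unfolding transition_op_def using integrable_comp_app[OF assms] by simp

lemma iterates_affine:
  assumes "continuous_on UNIV \<phi>"
  shows "(M ^^ n) (\<lambda>p. c + a * \<phi> p) = (\<lambda>p. c + a * (M ^^ n) \<phi> p)"
  by (induction n) (auto simp: transition_affine continuous_on_iterates assms)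

subsection \<open>The dual operator\<close>

text \<open>The dual measure is the law of \<open>f(z)\<close> for independent \<open>f\<close> and
  \<open>z\<close> with laws \<open>\<tau>\<close> and \<open>\<mu>\<close>; Fubini gives the
  identity of integrals.\<close>

lemma dual_exists:
  assumes "\<mu> \<in> prob_measures"
  shows "\<exists>\<nu>\<in>prob_measures. \<forall>\<phi>. continuous_on UNIV \<phi> \<longrightarrow> integral\<^sup>L \<nu> \<phi> = integral\<^sup>L \<mu> (M \<phi>)"
proof -
  have [measurable_cong]: "sets \<mu> = sets borel" using assms by (simp add: prob_measures_def)
  interpret m: prob_space \<mu> using assms by (simp add: prob_measures_def)
  interpret pp: pair_prob_space \<tau> \<mu> ..
  define ev where "ev = (\<lambda>(f, z). app_map f z)"
  define \<nu> where "\<nu> = distr (\<tau> \<Otimes>\<^sub>M \<mu>) borel ev"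
  have ev [measurable]: "ev \<in> borel_measurable (\<tau> \<Otimes>\<^sub>M \<mu>)"
    unfolding ev_def by measurable
  have "\<nu> \<in> prob_measures"
    unfolding \<nu>_def prob_measures_def by (auto intro!: pp.prob_space_distr)
  moreover have "integral\<^sup>L \<nu> \<phi> = integral\<^sup>L \<mu> (M \<phi>)" if \<phi>: "continuous_on UNIV \<phi>" for \<phi>
  proof -
    have [measurable]: "\<phi> \<in> borel_measurable borel"
      by (rule borel_measurable_continuous_onI[OF \<phi>])
    obtain B where B: "\<And>p. \<bar>\<phi> p\<bar> \<le> B" using continuous_sphere_bounded[OF \<phi>] by metis
    have "integral\<^sup>L \<nu> \<phi> = (\<integral>x. \<phi> (ev x) \<partial>(\<tau> \<Otimes>\<^sub>M \<mu>))"
      unfolding \<nu>_def by (rule integral_distr) auto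
    also have "\<dots> = (\<integral>x. (\<lambda>(f, z). \<phi> (app_map f z)) x \<partial>(\<tau> \<Otimes>\<^sub>M \<mu>))"
      by (simp add: ev_def case_prod_beta')
    also have "\<dots> = (\<integral>z. (\<integral>f. \<phi> (app_map f z) \<partial>\<tau>) \<partial>\<mu>)"
    proof (rule pp.integral_snd[symmetric])
      have "(\<lambda>x. \<phi> (ev x)) \<in> borel_measurable (\<tau> \<Otimes>\<^sub>M \<mu>)" by measurable
      then have "integrable (\<tau> \<Otimes>\<^sub>M \<mu>) (\<lambda>x. \<phi> (ev x))"
        using B by (intro pp.integrable_const_bound[where B = B]) auto
      then show "integrable (\<tau> \<Otimes>\<^sub>M \<mu>) (\<lambda>(f, z). \<phi> (app_map f z))"
        by (simp add: ev_def case_prod_beta')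
    qed
    finally show ?thesis by (simp add: transition_op_def[abs_def])
  qed
  ultimately show ?thesis by blast
qed

lemma dual_props:
  assumes "\<mu> \<in> prob_measures"
  shows dual_in: "D \<mu> \<in> prob_measures"
    and integral_dual: "continuous_on UNIV \<phi> \<Longrightarrow> integral\<^sup>L (D \<mu>) \<phi> = integral\<^sup>L \<mu> (M \<phi>)"
proof -
  have "\<exists>!\<nu>. \<nu> \<in> prob_measures \<and> (\<forall>\<phi>. continuous_on UNIV \<phi> \<longrightarrow> integral\<^sup>L \<nu> \<phi> = integral\<^sup>L \<mu> (M \<phi>))"
    using dual_exists[OF assms] by (auto intro!: prob_measures_eqI)
  from theI'[OF this] show "D \<mu> \<in> prob_measures"
    "continuous_on UNIV \<phi> \<Longrightarrow> integral\<^sup>L (D \<mu>) \<phi> = integral\<^sup>L \<mu> (M \<phi>)"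
    by (auto simp: dual_transition_op_def)
qed

lemma dual_iterates_in: "\<mu> \<in> prob_measures \<Longrightarrow> (D ^^ n) \<mu> \<in> prob_measures"
  by (induction n) (auto intro: dual_in)

lemma integral_dual_iterates:
  assumes "\<mu> \<in> prob_measures" "continuous_on UNIV \<phi>"
  shows "integral\<^sup>L ((D ^^ n) \<mu>) \<phi> = integral\<^sup>L \<mu> ((M ^^ n) \<phi>)"
  using assms(2)
proof (induction n arbitrary: \<phi>)
  case (Suc n)
  then have "integral\<^sup>L ((D ^^ Suc n) \<mu>) \<phi> = integral\<^sup>L \<mu> ((M ^^ n) (M \<phi>))"
    by (simp add: integral_dual dual_iterates_in assms(1) continuous_on_transition)
  then show ?case by (simp add: funpow_swap1)
qed simp

end

subsection \<open>Uniform convergence of the iterates\<close>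

locale escaping_law = compact_law +
  assumes filled_empty: "smallest_filled_julia_set (semigroup_of \<tau>) = {}"
begin

text \<open>This is the only place where emptiness of the smallest filled-in Julia set enters. All
  later arguments use it in this form: every point is thrown arbitrarily far by some word.\<close>

lemma unbounded_orbit:
  obtains \<gamma> n where "range \<gamma> \<subseteq> \<Gamma>" "n \<ge> 1" "cmod (poly (word \<gamma> n) z) > C"
proof (rule ccontr)
  assume *: "\<not> thesis"
  have "{g (Fin z) |g. g \<in> semigroup_of \<tau>} \<subseteq> Fin ` cball 0 C"
  proof clarify
    fix g assume "g \<in> semigroup_of \<tau>"
    then obtain \<gamma> n where g: "range \<gamma> \<subseteq> \<Gamma>" "n \<ge> 1" "g = seq_comp \<gamma> n"
      by (auto simp: semigroup_of_def generated_semigroup_iff)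
    with * that have "\<not> cmod (poly (word \<gamma> n) z) > C" by blast
    then show "g (Fin z) \<in> Fin ` cball 0 C" by (auto simp: g seq_comp_eq_sphere_map)
  qed
  then have "z \<in> smallest_filled_julia_set (semigroup_of \<tau>)"
    unfolding smallest_filled_julia_set_def bounded_in_plane_def
    using bounded_cball by blast
  with filled_empty show False by auto
qed

text \<open>For \<open>|z| \<le> R\<close> the bump already has its largest value \<open>1\<close>.
  From anywhere else almost every map leads beyond \<open>2 R\<close>, where the bump vanishes; its
  ramp is placed between \<open>R\<close> and \<open>2 R\<close> for this reason.\<close>

lemma transition_bump_le:
  assumes "R > 0" "\<And>f. f \<in> \<Gamma> \<Longrightarrow> doubles_beyond R f"
  shows "M (bump R) p \<le> bump R p"
proof -
  note cont = continuous_on_bump[OF assms(1)]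
  consider z where "p = Fin z" "cmod z \<le> R" | "p = Infty \<or> (\<exists>z. p = Fin z \<and> cmod z > R)"
    by (cases p) force+
  then show ?thesis
  proof cases
    case 1
    have "M (bump R) p \<le> 1"
      unfolding transition_op_def using bump_bounds
      by (intro integral_le_const integrable_comp_app cont) auto
    then show ?thesis using 1 bump_inner[OF assms(1)] by simp
  next
    case 2
    have "AE f in \<tau>. bump R (app_map f p) = 0"
      using AE_support
    proof eventually_elim
      case (elim f)
      have "app_map f p \<in> outer (2 * R)"
        using 2
      proof
        assume "\<exists>z. p = Fin z \<and> cmod z > R"
        then obtain z where z: "p = Fin z" "cmod z > R" by blast
        then have "2 * cmod z \<le> cmod (poly (poly_of f) z)"
          using assms(2)[OF elim] by (simp add: doubles_beyond_def)
        then show ?thesis using z by (simp add: app_map_eq)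
      qed (simp add: app_map_eq)
      then show ?case using bump_outer[OF assms(1)] by simp
    qed
    then have "M (bump R) p = 0"
      unfolding transition_op_def by (subst integral_cong_AE[where g = "\<lambda>_. 0"])
        (use integrable_comp_app[OF cont] in auto)
    then show ?thesis using bump_bounds by simp
  qed
qed

text \<open>Let \<open>s\<close> be the limit of the maxima and \<open>p\<close> a point where all
  iterates are at least \<open>s\<close>. The value at \<open>p\<close> is an average over the
  images of \<open>p\<close>, and no image exceeds the maxima, which approach \<open>s\<close>. A
  set of maps of positive measure with values clearly below \<open>s\<close> would push the average
  under \<open>s\<close>, so all images under the support share the property of
  \<open>p\<close>.\<close>

lemma iterates_bump_small:
  assumes R: "R > 0" "\<And>f. f \<in> \<Gamma> \<Longrightarrow> doubles_beyond R f" and "\<epsilon> > 0"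
  shows "\<exists>N. \<forall>n\<ge>N. \<forall>p. (M ^^ n) (bump R) p < \<epsilon>"
proof (rule ccontr)
  assume contra: "\<not> ?thesis"
  define u where "u n = (M ^^ n) (bump R)" for n
  note cb = continuous_on_bump[OF R(1)]
  have cont: "continuous_on UNIV (u n)" for n
    unfolding u_def by (intro continuous_on_iterates cb)
  have dec1: "u (Suc n) p \<le> u n p" for n p
    using iterates_mono[OF continuous_on_transition[OF cb] cb transition_bump_le[OF R], of n p]
    by (simp add: u_def funpow_swap1)
  then have dec: "u n p \<le> u m p" if "m \<le> n" for m n p
    using lift_Suc_antimono_le[of "\<lambda>n. u n p", OF dec1 that] by simp
  have step: "u (Suc n) p = (\<integral>f. u n (app_map f p) \<partial>\<tau>)" for n p
    by (simp add: u_def transition_op_def)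
  obtain q where q: "\<And>n p. u n p \<le> u n (q n)"
    using continuous_attains_sup[OF compact_sphere _ cont] by (metis UNIV_I empty_iff)
  define S where "S n = u n (q n)" for n
  have S\<epsilon>: "S n \<ge> \<epsilon>" for n
  proof (rule ccontr)
    assume "\<not> S n \<ge> \<epsilon>"
    then have "\<forall>m\<ge>n. \<forall>p. u m p < \<epsilon>"
      using q[of n] dec[of n] unfolding S_def by (meson le_less_trans not_le)
    with contra show False by (auto simp: u_def)
  qed
  have bdd: "bdd_below (range S)" using S\<epsilon> by (intro bdd_belowI[of _ \<epsilon>]) auto
  define s where "s = (INF n. S n)"
  have s: "s \<ge> \<epsilon>" unfolding s_def using S\<epsilon> by (intro cINF_greatest) auto
  have sS: "s \<le> S n" for n unfolding s_def using bdd by (intro cINF_lower) auto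
  define Z where "Z = {p. \<forall>n. u n p \<ge> s}"
  \<comment> \<open>Otherwise the open sets where some iterate is below \<open>s\<close> cover the
    sphere. A finite subcover and monotonicity then give one \<open>N\<close> whose iterate is below
    \<open>s\<close> everywhere, including at its maximum point.\<close>
  have "Z \<noteq> {}"
  proof
    assume "Z = {}"
    then have cover: "UNIV \<subseteq> (\<Union>n. {p. u n p < s})" by (auto simp: Z_def not_le set_eq_iff)
    have "open {p. u n p < s}" for n
      by (intro open_Collect_less cont continuous_intros)
    then obtain C where C: "finite C" "UNIV \<subseteq> (\<Union>n\<in>C. {p. u n p < s})"
      using compactE_image[OF compact_sphere, of UNIV "\<lambda>n. {p. u n p < s}"] cover by auto
    define N where "N = Max (insert 0 C)"
    obtain n where n: "n \<in> C" "u n (q N) < s" using C(2) by auto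
    have "S N \<le> u n (q N)" unfolding S_def using dec[of n N] n(1) C(1) by (auto simp: N_def)
    with n sS[of N] show False by simp
  qed
  have inv: "app_map f p \<in> Z" if p: "p \<in> Z" and f: "f \<in> \<Gamma>" for f p
  proof (rule ccontr)
    assume "app_map f p \<notin> Z"
    then obtain k where k: "u k (app_map f p) < s" by (auto simp: Z_def not_le)
    obtain t where t: "u k (app_map f p) < t" "t < s" using dense[OF k] by auto
    define N where "N = {g. u k (app_map g p) < t}"
    have "open N"
      unfolding N_def by (intro open_Collect_less continuous_on_comp_app cont continuous_intros)
    then have "emeasure \<tau> N > 0" and N: "N \<in> sets \<tau>"
      using f t by (auto simp: topological_support_def N_def)
    then have pos: "measure \<tau> N > 0" by (simp add: emeasure_eq_measure)
    \<comment> \<open>The excess of the maximum over \<open>s\<close> is made smaller than the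
      deficit \<open>(s - t)\<close> times the mass of \<open>N\<close> that the maps in
      \<open>N\<close> cause in the average. Taking \<open>n\<close> above both \<open>m\<close> and
      \<open>k\<close> keeps this bound and the bound \<open>t\<close> on \<open>N\<close>.\<close>
    obtain m where m: "S m < s + (s - t) * measure \<tau> N"
      using cINF_less_iff[OF _ bdd, of "s + (s - t) * measure \<tau> N"] pos t
      by (auto simp: s_def[symmetric])
    define n where "n = max m k"
    have Sn: "S n \<le> S m"
      unfolding S_def using dec[of m n "q n"] q[of m "q n"] by (auto simp: n_def)
    have "s \<le> u (Suc n) p" using p by (simp add: Z_def)
    also have "\<dots> \<le> (\<integral>g. S n - (S n - t) * indicator N g \<partial>\<tau>)"
      unfolding step
    proof (intro integral_mono integrable_comp_app cont)
      show "integrable \<tau> (\<lambda>g. S n - (S n - t) * indicator N g)"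
        using N by (intro Bochner_Integration.integrable_diff integrable_mult_right integrable_const)
          (auto simp: emeasure_eq_measure)
      show "u n (app_map g p) \<le> S n - (S n - t) * indicator N g" for g
        using q[of n "app_map g p"] dec[of k n "app_map g p"]
        by (auto simp: indicator_def N_def S_def n_def)
    qed
    also have "\<dots> = S n - (S n - t) * measure \<tau> N"
      using N by (subst Bochner_Integration.integral_diff) (auto simp: emeasure_eq_measure)
    also have "\<dots> \<le> S n - (s - t) * measure \<tau> N"
      using sS[of n] by (intro diff_left_mono mult_right_mono) auto
    finally show False using m Sn by linarith
  qed
  obtain p where p: "p \<in> Z" using \<open>Z \<noteq> {}\<close> by auto
  \<comment> \<open>The iterate of order \<open>0\<close> is the bump itself, so points of
    \<open>Z\<close> never lie beyond \<open>2 R\<close>. Invariance then traps a whole orbit,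
    against \<open>unbounded_orbit\<close>.\<close>
  have b: "bump R p' > 0" if "p' \<in> Z" for p'
    using that s assms(3) by (auto simp: Z_def u_def dest!: spec[of _ 0])
  show False
  proof (cases p)
    case (Fin z)
    obtain \<gamma> n where \<gamma>: "range \<gamma> \<subseteq> \<Gamma>" "cmod (poly (word \<gamma> n) z) > 2 * R"
      using unbounded_orbit by metis
    have "seq_comp \<gamma> k p \<in> Z" for k
      by (induction k) (use p inv \<gamma>(1) in \<open>auto simp: image_subset_iff\<close>)
    from b[OF this[of n]] show False
      using bump_outer[OF R(1), of "seq_comp \<gamma> n p"] \<gamma>(2) Fin
      by (simp add: seq_comp_eq_sphere_map)
  qed (use b[OF p] in \<open>simp add: bump_def\<close>)
qed

text \<open>Near infinity \<open>\<phi>\<close> is almost constant, and elsewhere a multiple of the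
  bump dominates its deviation from \<open>\<phi> Infty\<close>. The operator is monotone and
  respects affine combinations, so the decay of the bump carries over to every
  \<open>\<phi>\<close>.\<close>

lemma iterates_tendsto:
  assumes \<phi>: "continuous_on UNIV \<phi>" and \<epsilon>: "\<epsilon> > 0"
  shows "\<exists>N. \<forall>n\<ge>N. \<forall>p. \<bar>(M ^^ n) \<phi> p - \<phi> Infty\<bar> < \<epsilon>"
proof -
  obtain R0 where R0: "R0 > 0" "\<And>f. f \<in> \<Gamma> \<Longrightarrow> doubles_beyond R0 f"
    using ex_doubles_beyond[OF compact_support] by metis
  have "open (\<phi> -` ball (\<phi> Infty) (\<epsilon> / 2))"
    using \<phi> continuous_on_open_vimage[of UNIV \<phi>] by auto
  then obtain R1 where R1: "outer R1 \<subseteq> \<phi> -` ball (\<phi> Infty) (\<epsilon> / 2)"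
    by (rule ex_outer_subset) (use \<epsilon> in auto)
  define R where "R = max R0 R1"
  have R: "R > 0" "\<And>f. f \<in> \<Gamma> \<Longrightarrow> doubles_beyond R f"
    using R0 doubles_beyond_mono[of R0 _ R] by (auto simp: R_def)
  have near: "\<bar>\<phi> p - \<phi> Infty\<bar> < \<epsilon> / 2" if "p \<in> outer R" for p
  proof -
    have "p \<in> outer R1" using that outer_antimono[of R1 R] by (auto simp: R_def)
    with R1 show ?thesis by (auto simp: dist_real_def abs_minus_commute)
  qed
  obtain B where B: "B > 0" "\<And>p. \<bar>\<phi> p\<bar> \<le> B" using continuous_sphere_bounded[OF \<phi>] by metis
  note cb = continuous_on_bump[OF R(1)]
  have bd: "\<bar>\<phi> p - \<phi> Infty\<bar> \<le> \<epsilon> / 2 + 2 * B * bump R p" for p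
  proof (cases "p \<in> outer R")
    case True
    have "0 \<le> 2 * B * bump R p" using B(1) bump_bounds by simp
    with near[OF True] show ?thesis by linarith
  next
    case False
    then have "bump R p = 1" using bump_inner[OF R(1)] by (cases p) auto
    then show ?thesis using B(2)[of p] B(2)[of Infty] \<epsilon> by simp
  qed
  obtain N where N: "\<And>n p. n \<ge> N \<Longrightarrow> (M ^^ n) (bump R) p < \<epsilon> / (4 * B)"
    using iterates_bump_small[OF R, of "\<epsilon> / (4 * B)"] \<epsilon> B(1) by auto
  show ?thesis
  proof (intro exI[of _ N] allI impI)
    fix n p assume "n \<ge> N"
    then have small: "2 * B * (M ^^ n) (bump R) p < \<epsilon> / 2"
      using N[of n p] B(1) by (simp add: field_simps)
    have "\<phi> p \<le> (\<phi> Infty + \<epsilon> / 2) + 2 * B * bump R p" for p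
      using bd[of p] by linarith
    then have "(M ^^ n) \<phi> p \<le> (M ^^ n) (\<lambda>p. (\<phi> Infty + \<epsilon> / 2) + 2 * B * bump R p) p"
      by (intro iterates_mono[OF \<phi>] continuous_intros cb; simp)
    moreover have "(\<phi> Infty - \<epsilon> / 2) + (- 2 * B) * bump R p \<le> \<phi> p" for p
      using bd[of p] by (simp only: mult_minus_left)
    then have "(M ^^ n) (\<lambda>p. (\<phi> Infty - \<epsilon> / 2) + (- 2 * B) * bump R p) p \<le> (M ^^ n) \<phi> p"
      by (intro iterates_mono[OF _ \<phi>] continuous_intros cb; simp)
    ultimately show "\<bar>(M ^^ n) \<phi> p - \<phi> Infty\<bar> < \<epsilon>"
      unfolding iterates_affine[OF cb] using small by (auto simp: abs_less_iff)
  qed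
qed

lemma return_Infty_in: "return borel Infty \<in> prob_measures"
  by (auto simp: prob_measures_def prob_space_return)

text \<open>Induction over the generation of the weak topology. For a basic set the integral of
  \<open>\<phi>\<close> against the iterated measure is that of \<open>(M ^^ n) \<phi>\<close>
  against \<open>\<nu>\<close>, and the uniform bound on this function is blind to
  \<open>\<nu>\<close>. Phrasing this with open sets makes it available for every metric that
  induces the topology.\<close>

lemma dual_iterates_eventually_in:
  assumes "openin weak_topology U" "return borel Infty \<in> U"
  shows "\<exists>N. \<forall>n\<ge>N. \<forall>\<nu>\<in>prob_measures. (D ^^ n) \<nu> \<in> U"
proof -
  let ?S = "{{\<mu> \<in> prob_measures. integral\<^sup>L \<mu> \<phi> \<in> U} | (\<phi> :: riemann_sphere \<Rightarrow> real) U.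
        continuous_on UNIV \<phi> \<and> bounded (range \<phi>) \<and> open U}"
  have "generate_topology_on ?S U"
    using assms(1) by (simp add: weak_topology_def openin_topology_generated_by_iff)
  then show ?thesis using assms(2)
  proof induction
    case (Int a b)
    then obtain N1 N2 where "\<forall>n\<ge>N1. \<forall>\<nu>\<in>prob_measures. (D ^^ n) \<nu> \<in> a"
      "\<forall>n\<ge>N2. \<forall>\<nu>\<in>prob_measures. (D ^^ n) \<nu> \<in> b" by blast
    then show ?case by (intro exI[of _ "max N1 N2"]) auto
  next
    case (UN K)
    then show ?case by blast
  next
    case (Basis s)
    then obtain \<phi> :: "riemann_sphere \<Rightarrow> real" and V where s: "s = {\<mu> \<in> prob_measures. integral\<^sup>L \<mu> \<phi> \<in> V}"
      "continuous_on UNIV \<phi>" "open V" by blast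
    have "\<phi> Infty \<in> V"
      using Basis(2) borel_measurable_continuous_onI[OF s(2)] by (auto simp: s(1) integral_return)
    then obtain e where e: "e > 0" "ball (\<phi> Infty) e \<subseteq> V"
      using s(3) by (auto simp: open_contains_ball)
    \<comment> \<open>Integration yields only weak inequalities; half of \<open>e\<close> keeps the
      integral strictly inside the ball.\<close>
    obtain N where N: "\<And>n p. n \<ge> N \<Longrightarrow> \<bar>(M ^^ n) \<phi> p - \<phi> Infty\<bar> < e / 2"
      using iterates_tendsto[OF s(2), of "e / 2"] e(1) by auto
    show ?case
    proof (intro exI[of _ N] allI impI ballI)
      fix n and \<nu> :: "riemann_sphere measure" assume n: "n \<ge> N" and \<nu>: "\<nu> \<in> prob_measures"
      interpret n: prob_space \<nu> using \<nu> by (simp add: prob_measures_def)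
      have st: "sets \<nu> = sets borel" using \<nu> by (simp add: prob_measures_def)
      note ci = continuous_on_iterates[OF s(2), of n]
      obtain B where "\<And>p. \<bar>(M ^^ n) \<phi> p\<bar> \<le> B" using continuous_sphere_bounded[OF ci] by metis
      then have int: "integrable \<nu> ((M ^^ n) \<phi>)"
        using borel_measurable_continuous_onI[OF ci] measurable_cong_sets[OF st refl]
        by (intro n.integrable_const_bound[where B = B]) auto
      have bd: "(M ^^ n) \<phi> p \<le> \<phi> Infty + e / 2" "\<phi> Infty - e / 2 \<le> (M ^^ n) \<phi> p" for p
        using N[OF n, of p] by linarith+
      have "integral\<^sup>L \<nu> ((M ^^ n) \<phi>) \<le> \<phi> Infty + e / 2"
        using bd by (intro n.integral_le_const int) auto
      moreover have "integral\<^sup>L \<nu> ((M ^^ n) \<phi>) \<ge> \<phi> Infty - e / 2"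
        using bd by (intro n.integral_ge_const int) auto
      ultimately have "integral\<^sup>L ((D ^^ n) \<nu>) \<phi> \<in> ball (\<phi> Infty) e"
        using e(1) by (simp add: integral_dual_iterates[OF \<nu> s(2)] dist_real_def abs_less_iff)
      then show "(D ^^ n) \<nu> \<in> s"
        using e(2) dual_iterates_in[OF \<nu>] by (auto simp: s(1))
    qed
  qed auto
qed

end

section \<open>Equicontinuity near infinity\<close>

text \<open>The late families send all of \<open>U\<close> close to infinity, so any two late values
  are close together. Only finitely many families remain, and for these a smallest
  \<open>\<delta>\<close> exists. The index is the word length, both for the semigroup and for a
  single sequence.\<close>

lemma equicontinuous_on_UN_escaping:
  fixes F :: "nat \<Rightarrow> (riemann_sphere \<Rightarrow> riemann_sphere) set"
  assumes equi: "\<And>k x \<epsilon>. \<epsilon> > 0 \<Longrightarrow> \<exists>\<delta>>0. \<forall>f\<in>F k. \<forall>y. dist x y < \<delta> \<longrightarrow> dist (f x) (f y) < \<epsilon>"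
    and esc: "\<And>\<epsilon>. \<epsilon> > 0 \<Longrightarrow> \<exists>N. \<forall>k\<ge>N. \<forall>f\<in>F k. \<forall>y\<in>U. dist (f y) Infty < \<epsilon>"
  shows "equicontinuous_on dist dist U (\<Union>k. F k)"
  unfolding equicontinuous_on_def
proof (intro ballI allI impI)
  fix x and \<epsilon> :: real assume x: "x \<in> U" and \<epsilon>: "\<epsilon> > 0"
  obtain N where N: "\<And>k f y. k \<ge> N \<Longrightarrow> f \<in> F k \<Longrightarrow> y \<in> U \<Longrightarrow> dist (f y) Infty < \<epsilon> / 2"
    using esc[of "\<epsilon> / 2"] \<epsilon> by auto
  obtain \<delta> where \<delta>: "\<And>k. \<delta> k > 0"
    "\<And>k f y. f \<in> F k \<Longrightarrow> dist x y < \<delta> k \<Longrightarrow> dist (f x) (f y) < \<epsilon>"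
    using equi[OF \<epsilon>, of _ x] by metis
  define \<eta> where "\<eta> = Min (insert 1 (\<delta> ` {..<N}))"
  have \<eta>: "\<eta> > 0" "\<And>k. k < N \<Longrightarrow> \<eta> \<le> \<delta> k" using \<delta>(1) by (auto simp: \<eta>_def)
  show "\<exists>\<delta>>0. \<forall>f\<in>\<Union>k. F k. \<forall>y\<in>U. dist x y < \<delta> \<longrightarrow> dist (f x) (f y) < \<epsilon>"
  proof (intro exI[of _ \<eta>] conjI ballI impI \<eta>(1))
    fix f y assume f: "f \<in> (\<Union>k. F k)" and y: "y \<in> U" "dist x y < \<eta>"
    then obtain k where k: "f \<in> F k" by auto
    show "dist (f x) (f y) < \<epsilon>"
    proof (cases "k < N")
      case True
      then show ?thesis using \<delta>(2)[OF k] \<eta>(2) y(2) by force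
    next
      case False
      then have "dist (f x) Infty < \<epsilon> / 2" "dist (f y) Infty < \<epsilon> / 2"
        using N[of k f x] N[of k f y] k x y(1) by auto
      then show ?thesis using dist_triangle2[of "f x" "f y" Infty] by linarith
    qed
  qed
qed

lemma equicontinuous_on_subset:
  "equicontinuous_on d d' B F \<Longrightarrow> F' \<subseteq> F \<Longrightarrow> equicontinuous_on d d' B F'"
  unfolding equicontinuous_on_def by (meson subsetD)

context compact_law
begin

text \<open>Fixed once by choice, so that all statements about sequences refer to the same
  disc.\<close>

definition escape_radius :: real where
  "escape_radius = (SOME R. R > 0 \<and> (\<forall>f\<in>\<Gamma>. doubles_beyond R f))"

lemma escape_radius: "escape_radius > 0" "f \<in> \<Gamma> \<Longrightarrow> doubles_beyond escape_radius f"
proof -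
  have "\<exists>R. R > 0 \<and> (\<forall>f\<in>\<Gamma>. doubles_beyond R f)"
    using ex_doubles_beyond[OF compact_support] by metis
  from someI_ex[OF this] show "escape_radius > 0" "f \<in> \<Gamma> \<Longrightarrow> doubles_beyond escape_radius f"
    by (auto simp: escape_radius_def)
qed

lemma doubles_beyond_range: "range \<gamma> \<subseteq> \<Gamma> \<Longrightarrow> doubles_beyond escape_radius (\<gamma> i)"
  by (intro escape_radius) auto

lemma ex_escape_time:
  assumes "\<epsilon> > 0"
  obtains N where "\<And>\<gamma> k p. range \<gamma> \<subseteq> \<Gamma> \<Longrightarrow> k \<ge> N \<Longrightarrow> p \<in> outer escape_radius \<Longrightarrow> dist (seq_comp \<gamma> k p) Infty < \<epsilon>"
proof -
  obtain R where R: "\<And>p. p \<in> outer R \<Longrightarrow> dist p Infty < \<epsilon>"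
    using ex_outer_dist_less[OF assms] by metis
  obtain N where N: "\<And>k. k \<ge> N \<Longrightarrow> R \<le> 2 ^ k * escape_radius"
    using ex_pow2_ge[OF escape_radius(1)] by metis
  show ?thesis
  proof (rule that[of N])
    fix \<gamma> :: "nat \<Rightarrow> poly_map" and k p assume *: "range \<gamma> \<subseteq> \<Gamma>" "k \<ge> N" "p \<in> outer escape_radius"
    have "seq_comp \<gamma> k p \<in> outer (2 ^ k * escape_radius)"
      using * by (intro seq_comp_outer doubles_beyond_range escape_radius(1))
    then show "dist (seq_comp \<gamma> k p) Infty < \<epsilon>"
      using outer_antimono[OF N[OF *(2)]] R by auto
  qed
qed

lemma shift_range: "range \<gamma> \<subseteq> \<Gamma> \<Longrightarrow> range (\<lambda>i. \<gamma> (i + n)) \<subseteq> \<Gamma>"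
  by auto

text \<open>Compactness of the support gives all letters a common modulus of continuity. Hence
  \<open>\<delta>\<close> depends on the length of the word but not on the word.\<close>

lemma seq_comp_unif_equicont:
  assumes "\<epsilon> > 0"
  shows "\<exists>\<delta>>0. \<forall>\<gamma>. range \<gamma> \<subseteq> \<Gamma> \<longrightarrow> (\<forall>x y. dist x y < \<delta> \<longrightarrow> dist (seq_comp \<gamma> k x) (seq_comp \<gamma> k y) < \<epsilon>)"
  using assms
proof (induction k arbitrary: \<epsilon>)
  case 0
  then show ?case by (intro exI[of _ \<epsilon>]) auto
next
  case (Suc k)
  obtain d where d: "d > 0" "\<And>f x y. f \<in> \<Gamma> \<Longrightarrow> dist x y < d \<Longrightarrow> dist (app_map f x) (app_map f y) < \<epsilon>"
    using compact_imp_unif_equicont[OF compact_support Suc.prems] by metis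
  obtain \<delta> where \<delta>: "\<delta> > 0"
    "\<And>\<gamma> x y. range \<gamma> \<subseteq> \<Gamma> \<Longrightarrow> dist x y < \<delta> \<Longrightarrow> dist (seq_comp \<gamma> k x) (seq_comp \<gamma> k y) < d"
    using Suc.IH[OF d(1)] by blast
  show ?case
    using \<delta> d(2) by (intro exI[of _ \<delta>]) (auto simp: image_subset_iff)
qed

lemma outer_subset_fatou: "outer escape_radius \<subseteq> fatou_set (semigroup_of \<tau>)"
proof -
  define W where "W k = {seq_comp \<gamma> k |\<gamma>. range \<gamma> \<subseteq> \<Gamma>}" for k
  have "equicontinuous_on dist dist (outer escape_radius) (\<Union>k. W k)"
  proof (rule equicontinuous_on_UN_escaping)
    fix k x and \<epsilon> :: real assume "\<epsilon> > 0"
    from seq_comp_unif_equicont[OF this, of k]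
    show "\<exists>\<delta>>0. \<forall>f\<in>W k. \<forall>y. dist x y < \<delta> \<longrightarrow> dist (f x) (f y) < \<epsilon>"
      unfolding W_def by blast
  next
    fix \<epsilon> :: real assume "\<epsilon> > 0"
    from ex_escape_time[OF this]
    obtain N where "\<And>\<gamma> k p. range \<gamma> \<subseteq> \<Gamma> \<Longrightarrow> k \<ge> N \<Longrightarrow> p \<in> outer escape_radius \<Longrightarrow> dist (seq_comp \<gamma> k p) Infty < \<epsilon>"
      by metis
    then show "\<exists>N. \<forall>k\<ge>N. \<forall>f\<in>W k. \<forall>y\<in>outer escape_radius. dist (f y) Infty < \<epsilon>"
      unfolding W_def by blast
  qed
  moreover have "semigroup_of \<tau> \<subseteq> (\<Union>k. W k)"
  proof
    fix g assume "g \<in> semigroup_of \<tau>"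
    then obtain \<gamma> n where "range \<gamma> \<subseteq> \<Gamma>" "g = seq_comp \<gamma> n"
      unfolding semigroup_of_def generated_semigroup_iff by blast
    then have "g \<in> W n" unfolding W_def by blast
    then show "g \<in> (\<Union>k. W k)" by blast
  qed
  ultimately have "equicontinuous_on dist dist (outer escape_radius) (semigroup_of \<tau>)"
    by (rule equicontinuous_on_subset)
  then show ?thesis unfolding fatou_set_def using open_outer by blast
qed

end

context escaping_law
begin

text \<open>Some element of the semigroup carries the given point into
  \<open>outer escape_radius\<close>, which is part of the Fatou set.\<close>

lemma kernel_julia_set_empty: "kernel_julia_set (semigroup_of \<tau>) = {}"
proof -
  have "\<exists>g\<in>semigroup_of \<tau>. g p \<in> outer escape_radius" for p
  proof -
    \<comment> \<open>For \<open>p = Infty\<close> the default value \<open>0\<close> of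
      \<open>unfin\<close> merely supplies some word; every word fixes \<open>Infty\<close>.\<close>
    obtain \<gamma> n where \<gamma>: "range \<gamma> \<subseteq> \<Gamma>" "n \<ge> 1" "cmod (poly (word \<gamma> n) (unfin p)) > escape_radius"
      using unbounded_orbit by metis
    have "seq_comp \<gamma> n p \<in> outer escape_radius"
      using \<gamma>(3) by (cases p) (auto simp: seq_comp_eq_sphere_map)
    with \<gamma> show ?thesis
      unfolding semigroup_of_def Bex_def generated_semigroup_iff by blast
  qed
  then have "p \<notin> kernel_julia_set (semigroup_of \<tau>)" for p
    using outer_subset_fatou unfolding kernel_julia_set_def julia_set_def by (meson ComplD INT_D subsetD vimageD)
  then show ?thesis by auto
qed

end

subsection \<open>Equicontinuity of the dual operator\<close>

lemma topspace_weak_topology: "topspace weak_topology = prob_measures"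
proof -
  have "prob_measures = {\<mu> \<in> prob_measures. integral\<^sup>L \<mu> (\<lambda>x::'a. 0::real) \<in> UNIV}" by simp
  then show ?thesis
    unfolding weak_topology_def topology_generated_by_topspace
    by (intro equalityI Union_least Union_upper) (auto simp del: UNIV_I intro!: exI[of _ "\<lambda>x::'a. 0::real"] exI[of _ UNIV])
qed

context escaping_law
begin

text \<open>Weak continuity of the iterates: the preimage of the basic set belonging to
  \<open>\<phi>\<close> is the basic set belonging to \<open>(M ^^ n) \<phi>\<close>.\<close>

lemma openin_dual_vimage:
  assumes "openin weak_topology U"
  shows "openin weak_topology {\<mu> \<in> prob_measures. (D ^^ n) \<mu> \<in> U}"
proof -
  let ?S = "{{\<mu> \<in> prob_measures. integral\<^sup>L \<mu> \<phi> \<in> U} | (\<phi> :: riemann_sphere \<Rightarrow> real) U.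
        continuous_on UNIV \<phi> \<and> bounded (range \<phi>) \<and> open U}"
  have "generate_topology_on ?S U"
    using assms by (simp add: weak_topology_def openin_topology_generated_by_iff)
  then show ?thesis
  proof induction
    case (Int a b)
    have "{\<mu> \<in> prob_measures. (D ^^ n) \<mu> \<in> a \<inter> b} =
      {\<mu> \<in> prob_measures. (D ^^ n) \<mu> \<in> a} \<inter> {\<mu> \<in> prob_measures. (D ^^ n) \<mu> \<in> b}" by auto
    then show ?case using Int by auto
  next
    case (UN K)
    have "{\<mu> \<in> prob_measures. (D ^^ n) \<mu> \<in> \<Union>K} = (\<Union>k\<in>K. {\<mu> \<in> prob_measures. (D ^^ n) \<mu> \<in> k})" by auto
    then show ?case using UN by auto
  next
    case (Basis s)
    then obtain \<phi> :: "riemann_sphere \<Rightarrow> real" and V where s: "s = {\<mu> \<in> prob_measures. integral\<^sup>L \<mu> \<phi> \<in> V}"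
      "continuous_on UNIV \<phi>" "open V" by blast
    note ci = continuous_on_iterates[OF s(2), of n]
    have "bounded (range ((M ^^ n) \<phi>))"
      using compact_imp_bounded[OF compact_continuous_image[OF ci compact_sphere]] .
    then have "{\<mu> \<in> prob_measures. integral\<^sup>L \<mu> ((M ^^ n) \<phi>) \<in> V} \<in> ?S"
      using ci s(3) by blast
    moreover have "{\<mu> \<in> prob_measures. (D ^^ n) \<mu> \<in> s} = {\<mu> \<in> prob_measures. integral\<^sup>L \<mu> ((M ^^ n) \<phi>) \<in> V}"
      using dual_iterates_in integral_dual_iterates[OF _ s(2)] by (auto simp: s(1))
    ultimately show ?case
      unfolding weak_topology_def by (auto intro: topology_generated_by_Basis)
  qed auto
qed

lemma dual_uniform_convergence:
  assumes d: "metrizes_weak_topology d" and "\<epsilon> > 0"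
  shows "\<exists>N. \<forall>n\<ge>N. \<forall>\<nu>\<in>prob_measures. d ((D ^^ n) \<nu>) (return borel Infty) < \<epsilon>"
proof -
  interpret Metric_space prob_measures d using d by (simp add: metrizes_weak_topology_def)
  have top: "mtopology = weak_topology" using d by (simp add: metrizes_weak_topology_def)
  have "openin weak_topology (mball (return borel Infty) \<epsilon>)"
    using openin_mball by (simp add: top)
  from dual_iterates_eventually_in[OF this] obtain N where
    "\<And>n \<nu>. n \<ge> N \<Longrightarrow> \<nu> \<in> prob_measures \<Longrightarrow> (D ^^ n) \<nu> \<in> mball (return borel Infty) \<epsilon>"
    using return_Infty_in assms(2) by auto
  then show ?thesis by (intro exI[of _ N]) (auto simp: commute)
qed

text \<open>The whole space serves as neighbourhood. Late iterates map everything close to the point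
  mass at infinity, and the finitely many early ones are continuous.\<close>

lemma fatou_meas_eq:
  assumes d: "metrizes_weak_topology d"
  shows "fatou_meas d \<tau> = prob_measures"
proof -
  interpret Metric_space prob_measures d using d by (simp add: metrizes_weak_topology_def)
  have top: "mtopology = weak_topology" using d by (simp add: metrizes_weak_topology_def)
  have "equicontinuous_on d d prob_measures {D ^^ n |n. n \<ge> 1}"
    unfolding equicontinuous_on_def
  proof (intro ballI allI impI)
    fix \<mu> :: "riemann_sphere measure" and \<epsilon> :: real assume \<mu>: "\<mu> \<in> prob_measures" and \<epsilon>: "\<epsilon> > 0"
    obtain N where N: "\<And>n \<nu>. n \<ge> N \<Longrightarrow> \<nu> \<in> prob_measures \<Longrightarrow> d ((D ^^ n) \<nu>) (return borel Infty) < \<epsilon> / 2"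
      using dual_uniform_convergence[OF d, of "\<epsilon> / 2"] \<epsilon> by auto
    have "\<exists>\<delta>>0. \<forall>\<nu>\<in>prob_measures. d \<mu> \<nu> < \<delta> \<longrightarrow> d ((D ^^ n) \<mu>) ((D ^^ n) \<nu>) < \<epsilon>" for n
    proof -
      have "openin mtopology {\<nu> \<in> prob_measures. (D ^^ n) \<nu> \<in> mball ((D ^^ n) \<mu>) \<epsilon>}"
        unfolding top using openin_mball by (intro openin_dual_vimage) (simp add: top)
      moreover have "\<mu> \<in> {\<nu> \<in> prob_measures. (D ^^ n) \<nu> \<in> mball ((D ^^ n) \<mu>) \<epsilon>}"
        using \<mu> \<epsilon> dual_iterates_in[OF \<mu>] by simp
      ultimately obtain r where "r > 0" "mball \<mu> r \<subseteq> {\<nu> \<in> prob_measures. (D ^^ n) \<nu> \<in> mball ((D ^^ n) \<mu>) \<epsilon>}"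
        unfolding openin_mtopology by meson
      then show ?thesis using \<mu> by (intro exI[of _ r]) (auto simp: subset_eq)
    qed
    then obtain \<delta> where \<delta>: "\<And>n. \<delta> n > 0"
      "\<And>n \<nu>. \<nu> \<in> prob_measures \<Longrightarrow> d \<mu> \<nu> < \<delta> n \<Longrightarrow> d ((D ^^ n) \<mu>) ((D ^^ n) \<nu>) < \<epsilon>"
      by metis
    define \<eta> where "\<eta> = Min (insert 1 (\<delta> ` {..<N}))"
    have \<eta>: "\<eta> > 0" "\<And>k. k < N \<Longrightarrow> \<eta> \<le> \<delta> k" using \<delta>(1) by (auto simp: \<eta>_def)
    show "\<exists>\<delta>>0. \<forall>f\<in>{D ^^ n |n. n \<ge> 1}. \<forall>\<nu>\<in>prob_measures. d \<mu> \<nu> < \<delta> \<longrightarrow> d (f \<mu>) (f \<nu>) < \<epsilon>"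
    proof (intro exI[of _ \<eta>] conjI ballI impI \<eta>(1))
      fix f and \<nu> :: "riemann_sphere measure"
      assume f: "f \<in> {D ^^ n |n. n \<ge> 1}" and \<nu>: "\<nu> \<in> prob_measures" "d \<mu> \<nu> < \<eta>"
      then obtain n where n: "f = D ^^ n" by auto
      show "d (f \<mu>) (f \<nu>) < \<epsilon>"
      proof (cases "n < N")
        case True
        then show ?thesis using \<delta>(2)[OF \<nu>(1)] \<eta>(2) \<nu>(2) n by force
      next
        case False
        then have "d (f \<mu>) (return borel Infty) < \<epsilon> / 2" "d (f \<nu>) (return borel Infty) < \<epsilon> / 2"
          using N n \<mu> \<nu>(1) by auto
        then show ?thesis
          using triangle[of "f \<mu>" "return borel Infty" "f \<nu>"] commute[of "f \<nu>"]
            dual_iterates_in[OF \<mu>] dual_iterates_in[OF \<nu>(1)] return_Infty_in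
          by (simp add: n)
      qed
    qed
  qed
  moreover have "openin weak_topology (prob_measures :: riemann_sphere measure set)"
    by (metis openin_topspace topspace_weak_topology)
  ultimately show ?thesis unfolding fatou_meas_def by blast
qed

end

section \<open>Random sequences\<close>

lemma seq_comp_case_nat: "seq_comp (case_nat f \<gamma>) (Suc n) z = seq_comp \<gamma> n (app_map f z)"
  using seq_comp_add[of "case_nat f \<gamma>" 1 n] by simp

context compact_law
begin

abbreviation "L \<equiv> product_law \<tau>"

sublocale seqs: sequence_space \<tau> ..

lemma L_eq: "L = PiM UNIV (\<lambda>_. \<tau>)"
  by (simp add: product_law_def)

lemma space_L [simp]: "space L = UNIV"
  by (simp add: L_eq space_PiM)

sublocale L: prob_space L
  unfolding L_eq by (rule seqs.prob_space_axioms)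

lemma measurable_coordinate [measurable]: "(\<lambda>\<gamma>. \<gamma> n) \<in> measurable L borel"
proof -
  have "(\<lambda>\<gamma>. \<gamma> n) \<in> measurable L \<tau>"
    unfolding L_eq by (rule measurable_component_singleton) simp
  then show ?thesis by (simp add: measurable_cong_sets[OF refl sets_law])
qed

lemma measurable_eval_comp [measurable]:
  assumes "f \<in> measurable N borel" "g \<in> measurable N borel"
  shows "(\<lambda>x. app_map (f x) (g x)) \<in> measurable N borel"
  using measurable_compose[OF measurable_Pair[OF assms] measurable_eval] by simp

lemma measurable_seq_comp [measurable]:
  "(\<lambda>(\<gamma>, z). seq_comp \<gamma> n z) \<in> borel_measurable (L \<Otimes>\<^sub>M borel)"
proof (induction n)
  case 0
  then show ?case by (simp add: case_prod_beta')
next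
  case (Suc n)
  then have [measurable]: "(\<lambda>x. seq_comp (fst x) n (snd x)) \<in> borel_measurable (L \<Otimes>\<^sub>M borel)"
    by (simp add: case_prod_beta')
  have "(\<lambda>x. app_map (fst x n) (seq_comp (fst x) n (snd x))) \<in> borel_measurable (L \<Otimes>\<^sub>M borel)"
    by (intro measurable_eval_comp measurable_compose[OF measurable_fst measurable_coordinate]) measurable
  then show ?case by (simp add: case_prod_beta')
qed

lemma measurable_seq_comp_at [measurable]: "(\<lambda>\<gamma>. seq_comp \<gamma> n z) \<in> borel_measurable L"
proof -
  have "(\<lambda>\<gamma>. (\<gamma>, z)) \<in> measurable L (L \<Otimes>\<^sub>M borel)" by measurable
  from measurable_compose[OF this measurable_seq_comp] show ?thesis by simp
qed

lemma AE_L_support: "AE \<gamma> in L. range \<gamma> \<subseteq> \<Gamma>"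
proof -
  have "AE \<gamma> in L. \<gamma> i \<in> \<Gamma>" for i
    unfolding L_eq by (rule AE_PiM_component) (use AE_support in \<open>auto intro: prob_space_axioms\<close>)
  then have "AE \<gamma> in L. \<forall>i. \<gamma> i \<in> \<Gamma>" by (simp add: AE_all_countable)
  then show ?thesis by eventually_elim auto
qed

text \<open>The product law is the law of an independent first letter put in front of a sequence.
  The first letter acts first, so the remaining \<open>n\<close> letters start from its image; this
  is why \<open>z\<close> is arbitrary in the induction.\<close>

lemma integral_seq_comp:
  assumes \<phi>: "continuous_on UNIV \<phi>"
  shows "(\<integral>\<gamma>. \<phi> (seq_comp \<gamma> n z) \<partial>L) = (M ^^ n) \<phi> z"
proof (induction n arbitrary: z)
  case 0
  then show ?case using L.prob_space by simp
next
  case (Suc n)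
  have [measurable]: "\<phi> \<in> borel_measurable borel"
    by (rule borel_measurable_continuous_onI[OF \<phi>])
  obtain B where B: "\<And>p. \<bar>\<phi> p\<bar> \<le> B" using continuous_sphere_bounded[OF \<phi>] by metis
  interpret pp: pair_prob_space \<tau> L ..
  have cn: "(\<lambda>(f, \<gamma>). case_nat f \<gamma>) \<in> measurable (\<tau> \<Otimes>\<^sub>M L) L"
    unfolding L_eq by measurable
  have "(\<integral>\<gamma>. \<phi> (seq_comp \<gamma> (Suc n) z) \<partial>L) =
    (\<integral>\<gamma>. \<phi> (seq_comp \<gamma> (Suc n) z) \<partial>(distr (\<tau> \<Otimes>\<^sub>M L) L (\<lambda>(f, \<gamma>). case_nat f \<gamma>)))"
    using seqs.PiM_iter by (simp add: L_eq)
  also have "\<dots> = (\<integral>x. \<phi> (seq_comp (case x of (f, \<gamma>) \<Rightarrow> case_nat f \<gamma>) (Suc n) z) \<partial>(\<tau> \<Otimes>\<^sub>M L))"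
    by (rule integral_distr[OF cn]) measurable
  also have "\<dots> = (\<integral>x. (\<lambda>(f, \<gamma>). \<phi> (seq_comp \<gamma> n (app_map f z))) x \<partial>(\<tau> \<Otimes>\<^sub>M L))"
    by (intro Bochner_Integration.integral_cong) (auto simp: seq_comp_case_nat simp del: seq_comp.simps)
  also have "\<dots> = (\<integral>f. (\<integral>\<gamma>. \<phi> (seq_comp \<gamma> n (app_map f z)) \<partial>L) \<partial>\<tau>)"
  proof (rule pp.integral_fst[symmetric])
    have "(\<lambda>x. (snd x, app_map (fst x) z)) \<in> measurable (\<tau> \<Otimes>\<^sub>M L) (L \<Otimes>\<^sub>M borel)"
      by (intro measurable_Pair measurable_eval_comp) (auto simp: measurable_cong_sets[OF refl sets_law[symmetric]])
    from measurable_compose[OF this measurable_seq_comp, of n]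
    have [measurable]: "(\<lambda>x. seq_comp (snd x) n (app_map (fst x) z)) \<in> borel_measurable (\<tau> \<Otimes>\<^sub>M L)"
      by simp
    show "integrable (\<tau> \<Otimes>\<^sub>M L) (\<lambda>(f, \<gamma>). \<phi> (seq_comp \<gamma> n (app_map f z)))"
      unfolding case_prod_beta' using B by (intro pp.integrable_const_bound[where B = B]) auto
  qed
  also have "\<dots> = (M ^^ Suc n) \<phi> z"
    by (simp add: Suc.IH transition_op_def[of \<tau> "(M ^^ n) \<phi>"])
  finally show ?case .
qed

text \<open>Beyond the escape radius each further letter doubles the modulus, so a single visit
  there already forces convergence. Escape is thus a countable union of measurable events.\<close>

lemma escapes_iff:
  assumes \<gamma>: "range \<gamma> \<subseteq> \<Gamma>"
  shows "(\<lambda>n. seq_comp \<gamma> n p) \<longlonglongrightarrow> Infty \<longleftrightarrow> (\<exists>n. seq_comp \<gamma> n p \<in> outer escape_radius)"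
proof
  assume "(\<lambda>n. seq_comp \<gamma> n p) \<longlonglongrightarrow> Infty"
  then have "eventually (\<lambda>n. seq_comp \<gamma> n p \<in> outer escape_radius) sequentially"
    by (rule topological_tendstoD) (auto intro: open_outer)
  then show "\<exists>n. seq_comp \<gamma> n p \<in> outer escape_radius"
    by (auto simp: eventually_sequentially)
next
  assume "\<exists>n. seq_comp \<gamma> n p \<in> outer escape_radius"
  then obtain n where n: "seq_comp \<gamma> n p \<in> outer escape_radius" by auto
  show "(\<lambda>n. seq_comp \<gamma> n p) \<longlonglongrightarrow> Infty"
  proof (rule metric_LIMSEQ_I)
    fix \<epsilon> :: real assume "\<epsilon> > 0"
    then obtain N where N: "\<And>\<gamma> k p. range \<gamma> \<subseteq> \<Gamma> \<Longrightarrow> k \<ge> N \<Longrightarrow> p \<in> outer escape_radius \<Longrightarrow> dist (seq_comp \<gamma> k p) Infty < \<epsilon>"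
      using ex_escape_time by metis
    show "\<exists>N. \<forall>k\<ge>N. dist (seq_comp \<gamma> k p) Infty < \<epsilon>"
    proof (intro exI[of _ "n + N"] allI impI)
      fix k assume "n + N \<le> k"
      then obtain j where j: "k = n + j" "j \<ge> N" by (metis add_leD1 le_Suc_ex nat_add_left_cancel_le)
      show "dist (seq_comp \<gamma> k p) Infty < \<epsilon>"
        using N[OF shift_range[OF \<gamma>] j(2) n] by (simp add: j(1) seq_comp_add)
    qed
  qed
qed

text \<open>An orbit that once leaves the disc of radius \<open>escape_radius\<close> escapes, so a
  bounded orbit never leaves it. Time \<open>0\<close> is included: a starting point outside the
  disc escapes as well.\<close>

lemma filled_julia_iff:
  assumes \<gamma>: "range \<gamma> \<subseteq> \<Gamma>"
  shows "z \<in> seq_filled_julia_set \<gamma> \<longleftrightarrow> (\<forall>n. cmod (poly (word \<gamma> n) z) \<le> escape_radius)"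
proof
  assume "z \<in> seq_filled_julia_set \<gamma>"
  then obtain B where B: "bounded B" "{seq_comp \<gamma> n (Fin z) |n. n \<ge> 1} \<subseteq> Fin ` B"
    by (auto simp: seq_filled_julia_set_def bounded_in_plane_def)
  then obtain b where b: "\<And>w. w \<in> B \<Longrightarrow> cmod w \<le> b" by (auto simp: bounded_iff)
  show "\<forall>n. cmod (poly (word \<gamma> n) z) \<le> escape_radius"
  proof (rule ccontr)
    assume "\<not> ?thesis"
    then have "\<exists>n. seq_comp \<gamma> n (Fin z) \<in> outer escape_radius"
      by (auto simp: seq_comp_eq_sphere_map not_le)
    then have "(\<lambda>n. seq_comp \<gamma> n (Fin z)) \<longlonglongrightarrow> Infty"
      unfolding escapes_iff[OF \<gamma>] .
    then have "eventually (\<lambda>n. seq_comp \<gamma> n (Fin z) \<in> outer b) sequentially"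
      by (rule topological_tendstoD) (auto intro: open_outer)
    then obtain N where "\<And>n. n \<ge> N \<Longrightarrow> seq_comp \<gamma> n (Fin z) \<in> outer b"
      by (auto simp: eventually_sequentially)
    \<comment> \<open>The definition of the filled Julia set only looks at times from
      \<open>1\<close> on.\<close>
    from this[of "max N 1"] have "cmod (poly (word \<gamma> (max N 1)) z) > b"
      by (simp add: seq_comp_eq_sphere_map)
    moreover have "seq_comp \<gamma> (max N 1) (Fin z) \<in> Fin ` B"
      by (rule subsetD[OF B(2)]) auto
    ultimately show False using b by (auto simp: seq_comp_eq_sphere_map not_less[symmetric])
  qed
next
  assume *: "\<forall>n. cmod (poly (word \<gamma> n) z) \<le> escape_radius"
  show "z \<in> seq_filled_julia_set \<gamma>"
    unfolding seq_filled_julia_set_def bounded_in_plane_def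
    by (intro CollectI exI[of _ "cball 0 escape_radius"])
       (use * in \<open>auto simp: seq_comp_eq_sphere_map\<close>)
qed

text \<open>Equicontinuity at a point of the filled Julia set would keep the orbits of a whole
  neighbourhood within radius \<open>escape_radius + 1\<close>, giving the set interior, against its
  measure zero. At any other point some iterate reaches \<open>outer escape_radius\<close>, and on
  the open preimage of this set the orbits escape uniformly.\<close>

lemma seq_julia_eq:
  assumes \<gamma>: "range \<gamma> \<subseteq> \<Gamma>" and null: "seq_filled_julia_set \<gamma> \<in> null_sets lebesgue"
  shows "Fin ` seq_filled_julia_set \<gamma> = seq_julia_set \<gamma>"
proof (intro equalityI subsetI)
  fix p assume "p \<in> Fin ` seq_filled_julia_set \<gamma>"
  then obtain z where p: "p = Fin z" and z: "z \<in> seq_filled_julia_set \<gamma>" by auto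
  show "p \<in> seq_julia_set \<gamma>"
  proof (rule ccontr)
    assume "p \<notin> seq_julia_set \<gamma>"
    then obtain U where U: "open U" "Fin z \<in> U" "equicontinuous_on dist dist U {seq_comp \<gamma> n |n. n \<ge> 1}"
      by (auto simp: seq_julia_set_def julia_set_def fatou_set_def p)
    obtain \<epsilon> where \<epsilon>: "\<epsilon> > 0"
      "\<And>z p. cmod z \<le> escape_radius \<Longrightarrow> dist (Fin z) p < \<epsilon> \<Longrightarrow> \<exists>w. p = Fin w \<and> cmod w < escape_radius + 1"
      using sphere_gap[of escape_radius "escape_radius + 1"] by auto
    obtain \<delta> where \<delta>: "\<delta> > 0" "\<And>n q. n \<ge> 1 \<Longrightarrow> q \<in> U \<Longrightarrow> dist (Fin z) q < \<delta> \<Longrightarrow>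
      dist (seq_comp \<gamma> n (Fin z)) (seq_comp \<gamma> n q) < \<epsilon>"
    proof -
      obtain \<delta> where \<delta>: "\<delta> > 0" "\<forall>f\<in>{seq_comp \<gamma> n |n. n \<ge> 1}. \<forall>q\<in>U. dist (Fin z) q < \<delta> \<longrightarrow>
          dist (f (Fin z)) (f q) < \<epsilon>"
        using U(3)[unfolded equicontinuous_on_def, rule_format, OF U(2) \<epsilon>(1)] by auto
      show ?thesis
      proof (rule that[OF \<delta>(1)])
        fix n :: nat and q assume *: "1 \<le> n" "q \<in> U" "dist (Fin z) q < \<delta>"
        have "seq_comp \<gamma> n \<in> {seq_comp \<gamma> n |n. n \<ge> 1}" using *(1) by auto
        from \<delta>(2)[rule_format, OF this *(2,3)]
        show "dist (seq_comp \<gamma> n (Fin z)) (seq_comp \<gamma> n q) < \<epsilon>" .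
      qed
    qed
    define O' where "O' = Fin -` (U \<inter> ball (Fin z) \<delta>)"
    have "open (Fin -` (U \<inter> ball (Fin z) \<delta>) \<inter> UNIV)"
      using continuous_on_open_vimage[of UNIV Fin] continuous_on_Fin U(1) by blast
    then have "open O'" "z \<in> O'" using U(2) \<delta>(1) by (auto simp: O'_def)
    then have "\<not> negligible O'" using open_not_negligible by blast
    then have "\<not> O' \<subseteq> seq_filled_julia_set \<gamma>"
      using null negligible_subset negligible_iff_null_sets by blast
    then obtain w where w: "w \<in> O'" "w \<notin> seq_filled_julia_set \<gamma>" by auto
    have "seq_comp \<gamma> n (Fin w) \<in> Fin ` ball 0 (escape_radius + 1)" if "n \<ge> 1" for n
    proof -
      have "cmod (poly (word \<gamma> n) z) \<le> escape_radius" using z filled_julia_iff[OF \<gamma>] by blast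
      moreover have "dist (seq_comp \<gamma> n (Fin z)) (seq_comp \<gamma> n (Fin w)) < \<epsilon>"
        using w(1) that by (intro \<delta>(2)) (auto simp: O'_def)
      ultimately show ?thesis
        using \<epsilon>(2)[of "poly (word \<gamma> n) z" "seq_comp \<gamma> n (Fin w)"]
        by (auto simp: seq_comp_eq_sphere_map)
    qed
    then have "w \<in> seq_filled_julia_set \<gamma>"
      unfolding seq_filled_julia_set_def bounded_in_plane_def using bounded_ball by blast
    with w(2) show False by simp
  qed
next
  fix p assume J: "p \<in> seq_julia_set \<gamma>"
  show "p \<in> Fin ` seq_filled_julia_set \<gamma>"
  proof (rule ccontr)
    assume np: "p \<notin> Fin ` seq_filled_julia_set \<gamma>"
    have "\<exists>n. seq_comp \<gamma> n p \<in> outer escape_radius"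
    proof (cases p)
      case (Fin z)
      with np have "z \<notin> seq_filled_julia_set \<gamma>" by auto
      then show ?thesis by (auto simp: filled_julia_iff[OF \<gamma>] Fin seq_comp_eq_sphere_map not_le)
    qed (simp add: seq_comp_eq_sphere_map)
    then obtain m where m: "seq_comp \<gamma> m p \<in> outer escape_radius" by auto
    define U where "U = seq_comp \<gamma> m -` outer escape_radius"
    have "open U"
      unfolding U_def using open_outer continuous_on_seq_comp[of UNIV \<gamma> m]
        continuous_on_open_vimage[of UNIV "seq_comp \<gamma> m"] by auto
    have "equicontinuous_on dist dist U (\<Union>k. {seq_comp \<gamma> k})"
    proof (rule equicontinuous_on_UN_escaping)
      fix k x and \<epsilon> :: real assume "\<epsilon> > 0"
      from seq_comp_unif_equicont[OF this, of k]
      show "\<exists>\<delta>>0. \<forall>f\<in>{seq_comp \<gamma> k}. \<forall>y. dist x y < \<delta> \<longrightarrow> dist (f x) (f y) < \<epsilon>"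
        using \<gamma> by auto
    next
      fix \<epsilon> :: real assume "\<epsilon> > 0"
      then obtain N where N: "\<And>\<gamma> k p. range \<gamma> \<subseteq> \<Gamma> \<Longrightarrow> k \<ge> N \<Longrightarrow> p \<in> outer escape_radius \<Longrightarrow> dist (seq_comp \<gamma> k p) Infty < \<epsilon>"
        using ex_escape_time by metis
      show "\<exists>N. \<forall>k\<ge>N. \<forall>f\<in>{seq_comp \<gamma> k}. \<forall>y\<in>U. dist (f y) Infty < \<epsilon>"
      proof (intro exI[of _ "m + N"] allI impI ballI)
        fix k f y assume *: "m + N \<le> k" "f \<in> {seq_comp \<gamma> k}" "y \<in> U"
        then obtain j where j: "k = m + j" "j \<ge> N" by (metis add_leD1 le_Suc_ex nat_add_left_cancel_le)
        show "dist (f y) Infty < \<epsilon>"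
          using N[OF shift_range[OF \<gamma>] j(2)] *(2,3) by (simp add: j(1) seq_comp_add U_def)
      qed
    qed
    then have "equicontinuous_on dist dist U {seq_comp \<gamma> n |n. n \<ge> 1}"
      by (rule equicontinuous_on_subset) auto
    then have "p \<in> fatou_set {seq_comp \<gamma> n |n. n \<ge> 1}"
      using \<open>open U\<close> m unfolding fatou_set_def U_def by blast
    with J show False by (simp add: seq_julia_set_def julia_set_def)
  qed
qed

end

section \<open>Almost sure escape\<close>

context escaping_law
begin

text \<open>The bump is \<open>1\<close> off \<open>outer escape_radius\<close>, so its iterate of
  order \<open>n\<close> bounds the probability of not being outside at time \<open>n\<close>. This
  bound tends to \<open>0\<close>.\<close>

lemma AE_escapes: "AE \<gamma> in L. (\<lambda>n. seq_comp \<gamma> n p) \<longlonglongrightarrow> Infty"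
proof -
  define A where "A n = {\<gamma>. seq_comp \<gamma> n p \<notin> outer escape_radius}" for n
  have oB [measurable]: "outer escape_radius \<in> sets borel" using open_outer by simp
  have A: "A n \<in> sets L" for n
  proof -
    have "A n = {\<gamma> \<in> space L. seq_comp \<gamma> n p \<notin> outer escape_radius}" by (simp add: A_def)
    also have "\<dots> \<in> sets L" by measurable
    finally show ?thesis .
  qed
  note cb = continuous_on_bump[OF escape_radius(1)]
  have bnd: "measure L (A n) \<le> (M ^^ n) (bump escape_radius) p" for n
  proof -
    have [measurable]: "bump escape_radius \<in> borel_measurable borel"
      by (rule borel_measurable_continuous_onI[OF cb])
    have "measure L (A n) = (\<integral>\<gamma>. indicator (A n) \<gamma> \<partial>L)" using A by simp
    also have "\<dots> \<le> (\<integral>\<gamma>. bump escape_radius (seq_comp \<gamma> n p) \<partial>L)"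
    proof (rule integral_mono)
      show "integrable L (\<lambda>\<gamma>. indicator (A n) \<gamma> :: real)" using A by (simp add: L.emeasure_eq_measure)
      show "integrable L (\<lambda>\<gamma>. bump escape_radius (seq_comp \<gamma> n p))"
        using bump_bounds by (intro L.integrable_const_bound[where B = 1]) auto
      show "indicator (A n) \<gamma> \<le> bump escape_radius (seq_comp \<gamma> n p)" for \<gamma>
        using bump_bounds bump_inner[OF escape_radius(1)]
        by (cases "seq_comp \<gamma> n p") (auto simp: A_def indicator_def)
    qed
    finally show ?thesis by (simp add: integral_seq_comp[OF cb])
  qed
  define B where "B = (\<Inter>n. A n)"
  have B: "B \<in> sets L" unfolding B_def using A by auto
  have "measure L B \<le> \<epsilon>" if \<epsilon>: "\<epsilon> > 0" for \<epsilon>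
  proof -
    obtain N where N: "\<And>p. (M ^^ N) (bump escape_radius) p < \<epsilon>"
      using iterates_bump_small[OF escape_radius \<epsilon>] by blast
    have "measure L B \<le> measure L (A N)"
      unfolding B_def using A by (intro L.finite_measure_mono) auto
    with bnd[of N] N[of p] show ?thesis by linarith
  qed
  then have "measure L B \<le> 0" using field_le_epsilon[of "measure L B" 0] by auto
  then have "emeasure L B = 0" by (simp add: L.emeasure_eq_measure measure_le_0_iff)
  then have "AE \<gamma> in L. \<gamma> \<notin> B" using B by (intro AE_not_in) auto
  with AE_L_support show ?thesis
    by eventually_elim (auto simp: B_def A_def escapes_iff)
qed

lemma escape_prob_eq_1: "escape_prob \<tau> p = 1"
proof -
  have "{\<gamma> \<in> space L. (\<lambda>n. seq_comp \<gamma> n p) \<longlonglongrightarrow> Infty} \<in> sets L" by measurable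
  then show ?thesis
    using L.prob_Collect_eq_1 AE_escapes unfolding escape_prob_def space_L by simp
qed

lemma AE_filled_julia_null: "AE \<gamma> in L. seq_filled_julia_set \<gamma> \<in> null_sets lebesgue"
proof -
  interpret pair_sigma_finite L "lborel :: complex measure" ..
  have "(\<lambda>x. (fst x, Fin (snd x))) \<in> measurable (L \<Otimes>\<^sub>M (lborel :: complex measure)) (L \<Otimes>\<^sub>M borel)"
    using borel_measurable_continuous_onI[OF continuous_on_Fin] by measurable
  from measurable_compose[OF this measurable_seq_comp]
  have [measurable]: "(\<lambda>x. seq_comp (fst x) n (Fin (snd x))) \<in> borel_measurable (L \<Otimes>\<^sub>M (lborel :: complex measure))" for n
    by simp
  have "AE \<gamma> in L. AE z in lborel. (\<lambda>n. seq_comp \<gamma> n (Fin z)) \<longlonglongrightarrow> Infty"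
  proof (subst AE_commute)
    show "{x \<in> space (L \<Otimes>\<^sub>M lborel). (\<lambda>n. seq_comp (fst x) n (Fin (snd x))) \<longlonglongrightarrow> Infty} \<in> sets (L \<Otimes>\<^sub>M lborel)"
      by measurable
    show "AE z in lborel. AE \<gamma> in L. (\<lambda>n. seq_comp \<gamma> n (Fin z)) \<longlonglongrightarrow> Infty"
      using AE_escapes by simp
  qed
  with AE_L_support show ?thesis
  proof eventually_elim
    case (elim \<gamma>)
    then obtain N where N: "N \<in> null_sets lborel" "{z. \<not> (\<lambda>n. seq_comp \<gamma> n (Fin z)) \<longlonglongrightarrow> Infty} \<subseteq> N"
      by (auto simp: eventually_ae_filter)
    have "seq_filled_julia_set \<gamma> \<subseteq> N"
    proof
      fix z assume "z \<in> seq_filled_julia_set \<gamma>"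
      then have "\<not> (\<exists>n. seq_comp \<gamma> n (Fin z) \<in> outer escape_radius)"
        by (auto simp: filled_julia_iff[OF elim(1)] seq_comp_eq_sphere_map not_less)
      then have "\<not> (\<lambda>n. seq_comp \<gamma> n (Fin z)) \<longlonglongrightarrow> Infty"
        unfolding escapes_iff[OF elim(1)] .
      with N(2) show "z \<in> N" by auto
    qed
    \<comment> \<open>Containment in a Borel null set is enough, because Lebesgue measure is
      complete.\<close>
    then show ?case using null_sets_completionI[OF N(1)] by (rule null_sets_completion_subset)
  qed
qed

end

section \<open>Connected components of the random Julia set\<close>

text \<open>An explicit open separation instead of a negated connectedness: its two parts are the
  symbols of the itineraries.\<close>

definition splits :: "complex poly \<Rightarrow> real \<Rightarrow> bool" where
  "splits g r \<longleftrightarrow> (\<exists>A B. open A \<and> open B \<and> A \<inter> B = {} \<and> A \<noteq> {} \<and> B \<noteq> {} \<and>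
     A \<union> B = {z. cmod (poly g z) < r})"

lemma poly_word_comb_seq:
  "poly (word (comb_seq n \<gamma> \<delta>) (n + m)) z = poly (word \<delta> m) (poly (word \<gamma> n) z)"
proof -
  have "seq_comp (comb_seq n \<gamma> \<delta>) n = seq_comp \<gamma> n"
    by (rule seq_comp_cong) (simp add: comb_seq_less)
  from fun_cong[OF this, of "Fin z"]
  have "poly (word (comb_seq n \<gamma> \<delta>) n) z = poly (word \<gamma> n) z" by (simp add: seq_comp_eq_sphere_map)
  then show ?thesis by (simp add: poly_word_add comb_seq_add)
qed

lemma poly_word_case_nat:
  "poly (word (case_nat f \<delta>) (Suc n)) z = poly (word \<delta> n) (poly (poly_of f) z)"
  using seq_comp_case_nat[of f \<delta> n "Fin z"]
  by (simp add: seq_comp_eq_sphere_map app_map_eq del: word.simps seq_comp.simps)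

lemma seq_comp_perturb:
  assumes "\<epsilon> > 0"
  shows "\<exists>\<eta>>0. \<forall>\<delta>. (\<forall>i<m. dist (\<gamma> i) (\<delta> i) < \<eta>) \<longrightarrow> (\<forall>p. dist (seq_comp \<gamma> m p) (seq_comp \<delta> m p) < \<epsilon>)"
  using assms
proof (induction m arbitrary: \<epsilon>)
  case 0
  then show ?case by (intro exI[of _ 1]) auto
next
  case (Suc m)
  obtain d where d: "d > 0" "\<And>x y. dist x y < d \<Longrightarrow> dist (app_map (\<gamma> m) x) (app_map (\<gamma> m) y) < \<epsilon> / 2"
    using app_map_unif_cont[of "\<epsilon> / 2"] Suc.prems by (metis half_gt_zero)
  obtain \<eta> where \<eta>: "\<eta> > 0" "\<And>\<delta> p. \<forall>i<m. dist (\<gamma> i) (\<delta> i) < \<eta> \<Longrightarrow> dist (seq_comp \<gamma> m p) (seq_comp \<delta> m p) < d"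
    using Suc.IH[OF d(1)] by blast
  show ?case
  proof (intro exI[of _ "min \<eta> (\<epsilon> / 2)"] conjI allI impI)
    fix \<delta> p assume *: "\<forall>i<Suc m. dist (\<gamma> i) (\<delta> i) < min \<eta> (\<epsilon> / 2)"
    have "dist (app_map (\<gamma> m) (seq_comp \<gamma> m p)) (app_map (\<gamma> m) (seq_comp \<delta> m p)) < \<epsilon> / 2"
      using * by (intro d(2) \<eta>(2)) auto
    moreover have "dist (app_map (\<gamma> m) (seq_comp \<delta> m p)) (app_map (\<delta> m) (seq_comp \<delta> m p)) < \<epsilon> / 2"
      using dist_app_map_le[of "\<gamma> m" "seq_comp \<delta> m p" "\<delta> m"] * by force
    ultimately show "dist (seq_comp \<gamma> (Suc m) p) (seq_comp \<delta> (Suc m) p) < \<epsilon>"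
      using dist_triangle[of "app_map (\<gamma> m) (seq_comp \<gamma> m p)" "app_map (\<delta> m) (seq_comp \<delta> m p)"
          "app_map (\<gamma> m) (seq_comp \<delta> m p)"] by simp
  qed (use \<eta>(1) Suc.prems in auto)
qed

text \<open>Each half of the separation is mapped onto the disc, hence contains a zero of the word.
  For a nearby word the \<open>2 R\<close> sublevel set is covered by the old halves and still
  contains both zeros, so it meets both halves.\<close>

lemma splits_perturb:
  assumes ncon: "\<not> connected {z. cmod (poly (word \<gamma> m) z) < 3 * R}" and R: "R > 0"
  shows "\<exists>\<eta>>0. \<forall>\<delta>. (\<forall>i<m. dist (\<gamma> i) (\<delta> i) < \<eta>) \<longrightarrow> splits (word \<delta> m) (2 * R)"
proof -
  have "open {z. cmod (poly (word \<gamma> m) z) < 3 * R}"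
    by (intro open_Collect_less continuous_intros)
  then obtain A B where AB: "open A" "open B" "A \<inter> B = {}" "A \<noteq> {}" "B \<noteq> {}"
    "A \<union> B = {z. cmod (poly (word \<gamma> m) z) < 3 * R}"
    using not_connected_open_split[OF _ ncon] by metis
  have "poly (word \<gamma> m) ` A = ball 0 (3 * R)"
    by (rule clopen_sublevel_part_onto_ball[OF degree_word AB(1,2,3,4,6)])
  then have "0 \<in> poly (word \<gamma> m) ` A" using R by simp
  then obtain a where a: "a \<in> A" "poly (word \<gamma> m) a = 0" by force
  have "poly (word \<gamma> m) ` B = ball 0 (3 * R)"
    by (rule clopen_sublevel_part_onto_ball[OF degree_word AB(2,1) _ AB(5)]) (use AB in auto)
  then have "0 \<in> poly (word \<gamma> m) ` B" using R by simp
  then obtain b where b: "b \<in> B" "poly (word \<gamma> m) b = 0" by force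
  \<comment> \<open>\<open>\<epsilon>1\<close> keeps the \<open>2 R\<close> sublevel set of the
    nearby word inside the \<open>3 R\<close> one of the given word; \<open>\<epsilon>2\<close>
    keeps the zeros of the given word inside the former.\<close>
  obtain \<epsilon>1 where \<epsilon>1: "\<epsilon>1 > 0"
    "\<And>z p. cmod z \<le> 2 * R \<Longrightarrow> dist (Fin z) p < \<epsilon>1 \<Longrightarrow> \<exists>w. p = Fin w \<and> cmod w < 3 * R"
    using sphere_gap[of "2 * R" "3 * R"] R by auto
  obtain \<epsilon>2 where \<epsilon>2: "\<epsilon>2 > 0"
    "\<And>z p. cmod z \<le> 0 \<Longrightarrow> dist (Fin z) p < \<epsilon>2 \<Longrightarrow> \<exists>w. p = Fin w \<and> cmod w < 2 * R"
    using sphere_gap[of 0 "2 * R"] R by auto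
  obtain \<eta> where \<eta>: "\<eta> > 0" "\<And>\<delta> p. \<forall>i<m. dist (\<gamma> i) (\<delta> i) < \<eta> \<Longrightarrow>
      dist (seq_comp \<gamma> m p) (seq_comp \<delta> m p) < min \<epsilon>1 \<epsilon>2"
    using seq_comp_perturb[of "min \<epsilon>1 \<epsilon>2" m \<gamma>] \<epsilon>1(1) \<epsilon>2(1) by auto
  have "splits (word \<delta> m) (2 * R)" if \<delta>: "\<forall>i<m. dist (\<gamma> i) (\<delta> i) < \<eta>" for \<delta>
  proof -
    define V where "V = {z. cmod (poly (word \<delta> m) z) < 2 * R}"
    have V: "open V" unfolding V_def by (intro open_Collect_less continuous_intros)
    have close: "dist (Fin (poly (word \<gamma> m) z)) (Fin (poly (word \<delta> m) z)) < min \<epsilon>1 \<epsilon>2" for z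
      using \<eta>(2)[OF \<delta>, of "Fin z"] by (simp add: seq_comp_eq_sphere_map)
    have "V \<subseteq> A \<union> B"
    proof
      fix z assume "z \<in> V"
      then have "cmod (poly (word \<delta> m) z) \<le> 2 * R" by (simp add: V_def)
      from \<epsilon>1(2)[OF this, of "Fin (poly (word \<gamma> m) z)"] close[of z]
      show "z \<in> A \<union> B" unfolding AB(6) by (auto simp: dist_commute)
    qed
    moreover have "z \<in> V" if "poly (word \<gamma> m) z = 0" for z
      using \<epsilon>2(2)[of "poly (word \<gamma> m) z" "Fin (poly (word \<delta> m) z)"] close[of z] that
      by (auto simp: V_def)
    then have "a \<in> V" "b \<in> V" using a b by auto
    ultimately show ?thesis
      unfolding splits_def V_def[symmetric] using V AB a b
      by (intro exI[of _ "A \<inter> V"] exI[of _ "B \<inter> V"]) auto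
  qed
  with \<eta>(1) show ?thesis by blast
qed

section \<open>Words with disconnected sublevel sets\<close>

context escaping_law
begin

text \<open>The points are treated one at a time. The word appended for a new point cannot spoil the
  others, as it only increases moduli beyond the escape radius.\<close>

lemma common_escape:
  assumes "finite V" and C: "C \<ge> escape_radius"
  shows "\<exists>\<gamma> n. range \<gamma> \<subseteq> \<Gamma> \<and> (\<forall>v\<in>V. cmod (poly (word \<gamma> n) v) \<ge> C)"
  using assms(1)
proof induction
  case empty
  obtain f where "f \<in> \<Gamma>" using support_nonempty by auto
  then show ?case by (intro exI[of _ "\<lambda>_. f"]) auto
next
  case (insert v V)
  from insert.IH obtain \<gamma> n where \<gamma>: "range \<gamma> \<subseteq> \<Gamma>" "\<And>v. v \<in> V \<Longrightarrow> cmod (poly (word \<gamma> n) v) \<ge> C"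
    by blast
  obtain \<delta> m where \<delta>: "range \<delta> \<subseteq> \<Gamma>" "cmod (poly (word \<delta> m) (poly (word \<gamma> n) v)) > C"
    using unbounded_orbit by metis
  have "range (comb_seq n \<gamma> \<delta>) \<subseteq> \<Gamma>" using \<gamma>(1) \<delta>(1) by (auto simp: comb_seq_def)
  moreover have "cmod (poly (word (comb_seq n \<gamma> \<delta>) (n + m)) u) \<ge> C" if u: "u \<in> insert v V" for u
  proof (cases "u = v")
    case True
    then show ?thesis using \<delta>(2) by (simp add: poly_word_comb_seq)
  next
    case False
    define y where "y = poly (word \<gamma> n) u"
    have y: "cmod y \<ge> C" using False u \<gamma>(2) by (auto simp: y_def)
    have "1 * cmod y \<le> 2 ^ m * cmod y" by (intro mult_right_mono) auto
    also have "\<dots> \<le> cmod (poly (word \<delta> m) y)"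
      using y C by (intro word_doubles[of escape_radius] doubles_beyond_range \<delta> escape_radius) auto
    finally show ?thesis using y by (simp add: poly_word_comb_seq y_def)
  qed
  ultimately show ?case by blast
qed

lemma ex_disconnected_word:
  assumes C: "C \<ge> escape_radius"
  obtains \<gamma> m where "range \<gamma> \<subseteq> \<Gamma>" "m \<ge> 1" "\<not> connected {z. cmod (poly (word \<gamma> m) z) < C}"
proof -
  obtain f where f: "f \<in> \<Gamma>" using support_nonempty by auto
  have "pderiv (poly_of f) \<noteq> 0" using degree_poly_of[of f] by (simp add: pderiv_eq_0_iff)
  then have "finite (poly (poly_of f) ` {c. poly (pderiv (poly_of f)) c = 0})"
    by (intro finite_imageI poly_roots_finite)
  from common_escape[OF this C] obtain \<delta> n where \<delta>: "range \<delta> \<subseteq> \<Gamma>"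
    "\<And>c. poly (pderiv (poly_of f)) c = 0 \<Longrightarrow> cmod (poly (word \<delta> n) (poly (poly_of f) c)) \<ge> C"
    by auto
  show ?thesis
  \<comment> \<open>The letter \<open>f\<close> acts first and the word of \<open>\<delta>\<close>
    after it, so this word is \<open>h \<circ> f\<close> with \<open>h\<close> the word of
    \<open>\<delta>\<close>.\<close>
  proof (rule that[of "case_nat f \<delta>" "Suc n"])
    show "range (case_nat f \<delta>) \<subseteq> \<Gamma>" using f \<delta>(1) by (auto simp: image_subset_iff split: nat.split)
    have "\<not> connected {z. cmod (poly (word \<delta> n) (poly (poly_of f) z)) < C}"
      by (rule not_connected_poly_vimage_sublevel)
        (use degree_poly_of degree_word \<delta>(2) C escape_radius(1) in auto)
    then show "\<not> connected {z. cmod (poly (word (case_nat f \<delta>) (Suc n)) z) < C}"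
      by (simp add: poly_word_case_nat del: word.simps)
  qed simp
qed

end

text \<open>An enumeration of the power set, composed with a bijection of \<open>I\<close> onto the
  natural numbers, would map \<open>I\<close> onto \<open>Pow I\<close>, against Cantor.\<close>

lemma uncountable_Pow_infinite:
  fixes I :: "nat set"
  assumes "infinite I"
  shows "uncountable (Pow I)"
proof
  assume c: "countable (Pow I)"
  have "bij_betw (to_nat_on I) I UNIV" using assms by (intro to_nat_on_infinite) auto
  then have "(\<lambda>i. from_nat_into (Pow I) (to_nat_on I i)) ` I = range (from_nat_into (Pow I))"
    by (auto simp: bij_betw_def image_image[symmetric])
  also have "\<dots> = Pow I" using c by (intro range_from_nat_into) auto
  finally show False using Cantors_theorem[of I] by blast
qed

section \<open>Itineraries and components\<close>

context compact_law
begin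

text \<open>Every subset of the set of splitting times is the itinerary of some point of the filled
  Julia set: prescribed preimages exist by surjectivity, and compactness gives infinite
  itineraries. Itineraries are constant on components.\<close>

lemma uncountable_components_filled_julia:
  assumes \<gamma>: "range \<gamma> \<subseteq> \<Gamma>" and m: "m \<ge> 1"
    and inf: "infinite {k. splits (word (\<lambda>i. \<gamma> (i + k * m)) m) (2 * escape_radius)}"
  shows "uncountable (components (Fin ` seq_filled_julia_set \<gamma>))"
proof -
  let ?R = escape_radius
  note R = escape_radius(1)
  define I where "I = {k. splits (word (\<lambda>i. \<gamma> (i + k * m)) m) (2 * ?R)}"
  define g where "g k = word (\<lambda>i. \<gamma> (i + k * m)) m" for k
  define w where "w k = word \<gamma> (k * m)" for k
  define K where "K = seq_filled_julia_set \<gamma>"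
  have w_Suc: "poly (w (Suc k)) z = poly (g k) (poly (w k) z)" for k z
    using poly_word_add[of \<gamma> "k * m" m z] by (simp add: w_def g_def add.commute)
  have w0: "poly (w 0) z = z" for z by (simp add: w_def)
  have "\<exists>A B. open A \<and> open B \<and> A \<inter> B = {} \<and> A \<noteq> {} \<and> B \<noteq> {} \<and>
     A \<union> B = {z. cmod (poly (g k) z) < 2 * ?R}" if "k \<in> I" for k
    using that by (simp add: I_def splits_def g_def)
  then obtain A B where AB: "\<And>k. k \<in> I \<Longrightarrow> open (A k) \<and> open (B k) \<and> A k \<inter> B k = {} \<and> A k \<noteq> {} \<and> B k \<noteq> {} \<and>
     A k \<union> B k = {z. cmod (poly (g k) z) < 2 * ?R}" by metis
  have g_large: "cmod (poly (g k) z) > ?R" if "cmod z > ?R" for k z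
  proof -
    have "1 * cmod z \<le> 2 ^ m * cmod z" by (intro mult_right_mono) auto
    also have "\<dots> \<le> cmod (poly (g k) z)"
      unfolding g_def using that
      by (intro word_doubles[of ?R] doubles_beyond_range shift_range \<gamma> R) auto
    finally show ?thesis using that by simp
  qed
  \<comment> \<open>Membership of \<open>k\<close> in \<open>S\<close> prescribes the half
    \<open>A k\<close>, otherwise \<open>B k\<close>. Removing the open other half, rather than
    intersecting with the wanted one, makes the set visibly closed.\<close>
  define P where "P k S = {z. cmod (poly (g k) z) \<le> ?R} -
     (if k \<notin> I then {} else if k \<in> S then B k else A k)" for k S
  have P_closed: "closed (P k S)" for k S
  proof -
    have "closed {z. cmod (poly (g k) z) \<le> ?R}" by (intro closed_Collect_le continuous_intros)
    then show ?thesis using AB[of k] unfolding P_def by (intro closed_Diff) auto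
  qed
  have P_sub: "P k S \<subseteq> cball 0 ?R" for k S
    using g_large unfolding P_def by (force simp: not_less[symmetric])
  have P_surj: "\<exists>x\<in>P k S. poly (g k) x = y" if y: "y \<in> cball 0 ?R" for k S y
  proof -
    have dg: "degree (g k) > 0" unfolding g_def by (rule degree_word)
    have yb: "y \<in> ball 0 (2 * ?R)" using y R by simp
    have "\<exists>x. poly (g k) x = y \<and> x \<notin> (if k \<notin> I then {} else if k \<in> S then B k else A k)"
    proof (cases "k \<in> I")
      case False
      then show ?thesis using poly_surj[OF dg, of y] by auto
    next
      case True
      note ab = AB[OF True]
      have "poly (g k) ` A k = ball 0 (2 * ?R)"
        using ab by (intro clopen_sublevel_part_onto_ball[OF dg, of "A k" "B k"]) auto
      moreover have "poly (g k) ` B k = ball 0 (2 * ?R)"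
        using ab by (intro clopen_sublevel_part_onto_ball[OF dg, of "B k" "A k"]) auto
      ultimately obtain a b where "a \<in> A k" "poly (g k) a = y" "b \<in> B k" "poly (g k) b = y"
        using yb by (metis imageE)
      then show ?thesis using ab True by (cases "k \<in> S") auto
    qed
    then show ?thesis using y by (auto simp: P_def)
  qed
  define C where "C N S = {z. \<forall>k<N. poly (w k) z \<in> P k S}" for N S
  have C_ne: "\<exists>z. poly (w N) z = y \<and> z \<in> C N S" if "y \<in> cball 0 ?R" for N S y
    using that
  proof (induction N arbitrary: y)
    case 0
    then show ?case by (simp add: w0 C_def)
  next
    case (Suc N)
    obtain x where x: "x \<in> P N S" "poly (g N) x = y" using P_surj[OF Suc.prems] by blast
    from Suc.IH[of x] x(1) P_sub obtain z where "poly (w N) z = x" "z \<in> C N S" by blast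
    with x show ?case by (intro exI[of _ z]) (auto simp: w_Suc C_def less_Suc_eq)
  qed
  \<comment> \<open>\<open>C 0 S\<close> is the whole plane; from \<open>Suc N\<close> on, the first
    condition confines the set to a disc.\<close>
  have C_compact: "compact (C (Suc N) S)" for N S
  proof -
    have "C (Suc N) S = P 0 S \<inter> (\<Inter>k\<in>{..<Suc N}. poly (w k) -` P k S)"
      by (auto simp: C_def w0 dest: spec[of _ 0])
    moreover have "closed (poly (w k) -` P k S)" for k
      by (intro closed_vimage P_closed continuous_intros)
    moreover have "compact (P 0 S)"
      using P_closed P_sub by (meson bounded_cball bounded_subset compact_eq_bounded_closed)
    ultimately show ?thesis by (auto intro!: compact_Int_closed)
  qed
  have "\<exists>z. \<forall>k. poly (w k) z \<in> P k S" for S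
  proof -
    have "\<Inter> (range (\<lambda>N. C (Suc N) S)) \<noteq> {}"
    proof (rule compact_nest)
      show "compact (C (Suc N) S)" for N by (rule C_compact)
      show "C (Suc N) S \<noteq> {}" for N using C_ne[of 0 "Suc N" S] R by auto
      show "C (Suc n) S \<subseteq> C (Suc k) S" if "k \<le> n" for k n :: nat
        using that by (auto simp: C_def)
    qed
    then obtain z where "\<And>N. z \<in> C (Suc N) S" by auto
    then show ?thesis by (auto simp: C_def)
  qed
  then obtain x where x: "\<And>S k. poly (w k) (x S) \<in> P k S" by metis
  have xK: "x S \<in> K" for S
    unfolding K_def filled_julia_iff[OF \<gamma>]
  proof (intro allI, rule ccontr)
    fix n assume n: "\<not> cmod (poly (word \<gamma> n) (x S)) \<le> ?R"
    \<comment> \<open>The itinerary controls only the block times. A point outside the disc at time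
      \<open>n\<close> would still be outside at the later block time \<open>n * m\<close>.\<close>
    have "n \<le> n * m" using m by simp
    then obtain j where j: "n * m = n + j" using le_Suc_ex by blast
    define y where "y = poly (word \<gamma> n) (x S)"
    have "1 * cmod y \<le> 2 ^ j * cmod y" by (intro mult_right_mono) auto
    also have "\<dots> \<le> cmod (poly (word (\<lambda>i. \<gamma> (i + n)) j) y)"
      using n unfolding y_def
      by (intro word_doubles[of ?R] doubles_beyond_range shift_range \<gamma> R) auto
    also have "\<dots> = cmod (poly (w n) (x S))"
      unfolding w_def j y_def by (simp add: poly_word_add)
    also have "\<dots> \<le> ?R" using x[of n S] P_sub by force
    finally show False using n by (simp add: y_def)
  qed
  have K_AB: "poly (w k) z \<in> A k \<union> B k" if "k \<in> I" "z \<in> K" for k z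
  proof -
    have "cmod (poly (w (Suc k)) z) \<le> ?R"
      using that(2) filled_julia_iff[OF \<gamma>] unfolding K_def w_def by blast
    then show ?thesis using AB[OF that(1)] R by (simp add: w_Suc)
  qed
  define c where "c S = connected_component_set (Fin ` K) (Fin (x S))" for S
  have self: "Fin (x S) \<in> c S" for S using xK[of S] by (simp add: c_def)
  \<comment> \<open>At time \<open>k\<close> the two halves pull back to disjoint open sets that
    cover the component, with \<open>x S\<close> in one and \<open>x S'\<close> in the
    other.\<close>
  have sep: False if k: "k \<in> I" "k \<in> S" "k \<notin> S'" and eq: "c S = c S'" for k S S'
  proof -
    define O1 where "O1 = Fin ` (poly (w k) -` A k)"
    define O2 where "O2 = Fin ` (poly (w k) -` B k)"
    have op: "open O1" "open O2"
      unfolding O1_def O2_def using AB[OF k(1)]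
      by (auto intro!: open_Fin_image open_vimage continuous_intros)
    have sub: "c S \<subseteq> Fin ` K" unfolding c_def by (rule connected_component_subset)
    have "connected (c S)" unfolding c_def by (rule connected_connected_component)
    moreover have "c S \<subseteq> O1 \<union> O2"
    proof
      fix p assume "p \<in> c S"
      then obtain z where z: "p = Fin z" "z \<in> K" using sub by auto
      then show "p \<in> O1 \<union> O2" using K_AB[OF k(1) z(2)] by (auto simp: O1_def O2_def)
    qed
    moreover have "O1 \<inter> O2 \<inter> c S = {}"
      using AB[OF k(1)] by (auto simp: O1_def O2_def)
    ultimately have "O1 \<inter> c S = {} \<or> O2 \<inter> c S = {}" using connectedD[OF _ op] by metis
    moreover have "Fin (x S) \<in> c S" "Fin (x S') \<in> c S"
      using self[of S] self[of S'] eq by auto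
    moreover have "poly (w k) (x S) \<in> A k" "poly (w k) (x S') \<in> B k"
      using x[of k S] x[of k S'] K_AB[OF k(1) xK] k by (auto simp: P_def)
    then have "Fin (x S) \<in> O1" "Fin (x S') \<in> O2" by (auto simp: O1_def O2_def)
    ultimately show False by blast
  qed
  have "inj_on c (Pow I)"
  proof (rule inj_onI, rule ccontr)
    fix S S' assume *: "S \<in> Pow I" "S' \<in> Pow I" "c S = c S'" "S \<noteq> S'"
    then obtain k where "k \<in> I" "k \<in> S \<and> k \<notin> S' \<or> k \<in> S' \<and> k \<notin> S" by blast
    then show False using sep[of k S S'] sep[of k S' S] *(3) by metis
  qed
  moreover have "c ` Pow I \<subseteq> components (Fin ` K)"
    using xK by (auto simp: c_def components_def)
  moreover have "uncountable (Pow I)" using inf unfolding I_def by (rule uncountable_Pow_infinite)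
  ultimately show ?thesis
    unfolding K_def[symmetric] using countable_subset countable_image_inj_on by metis
qed

section \<open>Independence and recurrence of blocks\<close>

lemma measure_comb_seq:
  assumes A: "A \<in> sets L" and B: "B \<in> sets L" and X: "X \<in> sets L"
    and iff: "\<And>\<omega> \<omega>'. comb_seq m \<omega> \<omega>' \<in> X \<longleftrightarrow> \<omega> \<in> A \<and> \<omega>' \<in> B"
  shows "measure L X = measure L A * measure L B"
proof -
  have "emeasure L X = emeasure (distr (L \<Otimes>\<^sub>M L) L (\<lambda>(\<omega>, \<omega>'). comb_seq m \<omega> \<omega>')) X"
    using seqs.PiM_comb_seq[of m] by (simp add: L_eq)
  also have "\<dots> = emeasure (L \<Otimes>\<^sub>M L) ((\<lambda>(\<omega>, \<omega>'). comb_seq m \<omega> \<omega>') -` X \<inter> space (L \<Otimes>\<^sub>M L))"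
    using X measurable_comb_seq[of m \<tau>] unfolding L_eq by (intro emeasure_distr)
  also have "(\<lambda>(\<omega>, \<omega>'). comb_seq m \<omega> \<omega>') -` X \<inter> space (L \<Otimes>\<^sub>M L) = A \<times> B"
    using iff by (auto simp: space_pair_measure)
  also have "emeasure (L \<Otimes>\<^sub>M L) (A \<times> B) = emeasure L A * emeasure L B"
    using A B by (rule L.emeasure_pair_measure_Times)
  finally show ?thesis by (simp add: measure_def enn2real_mult)
qed

text \<open>Balls around points of the support have positive measure, so a block of \<open>m\<close>
  letters is close to the given word with some probability \<open>q > 0\<close>. Successive blocks
  are independent, and \<open>N\<close> consecutive failures from any starting block have
  probability \<open>(1 - q) ^ N\<close>.\<close>

lemma AE_infinitely_often_close:
  assumes \<gamma>0: "range \<gamma>0 \<subseteq> \<Gamma>" and \<eta>: "\<eta> > 0"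
  shows "AE \<gamma> in L. infinite {k. \<forall>i<m. dist (\<gamma>0 i) (\<gamma> (i + k * m)) < \<eta>}"
proof -
  define E where "E k = {\<gamma>. \<forall>i<m. dist (\<gamma>0 i) (\<gamma> (i + k * m)) < \<eta>}" for k
  define Q where "Q n N = (\<Inter>k\<in>{..<N}. - E (n + k))" for n N
  have E: "E k \<in> sets L" for k
  proof -
    have "E k = {\<gamma> \<in> space L. \<forall>i<m. \<gamma> (i + k * m) \<in> ball (\<gamma>0 i) \<eta>}" by (auto simp: E_def)
    also have "\<dots> \<in> sets L"
    proof -
      have [measurable]: "ball f \<eta> \<in> sets borel" for f :: poly_map by simp
      show ?thesis by measurable
    qed
    finally show ?thesis .
  qed
  then have nE: "- E k \<in> sets L" for k
    using sets.compl_sets[OF E[of k]] by (simp add: Compl_eq_Diff_UNIV)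
  have UL: "UNIV \<in> sets L" using sets.top[of L] by simp
  have Q: "Q n N \<in> sets L" for n N
  proof (induction N)
    case (Suc N)
    have "Q n (Suc N) = - E (n + N) \<inter> Q n N" by (auto simp: Q_def less_Suc_eq)
    then show ?case using Suc nE by auto
  qed (use UL in \<open>simp add: Q_def\<close>)
  define q where "q = measure L (E 0)"
  have ball_pos: "emeasure \<tau> (ball (\<gamma>0 i) \<eta>) > 0" for i
  proof -
    have "\<gamma>0 i \<in> \<Gamma>" using \<gamma>0 by auto
    then show ?thesis using \<eta> by (simp add: topological_support_def)
  qed
  have "emeasure L (E 0) = (\<Prod>i\<in>{..<m}. emeasure \<tau> (ball (\<gamma>0 i) \<eta>))"
    using seqs.emeasure_PiM_Collect[of "{..<m}" "\<lambda>i. ball (\<gamma>0 i) \<eta>"]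
    by (simp add: E_def L_eq[symmetric] Ball_def)
  also have "\<dots> \<noteq> 0"
    using ball_pos by (auto simp: less_le)
  finally have q: "q > 0" unfolding q_def by (simp add: L.emeasure_eq_measure zero_less_measure_iff)
  have E0: "comb_seq m \<omega> \<omega>' \<in> E 0 \<longleftrightarrow> \<omega> \<in> E 0" and ES: "comb_seq m \<omega> \<omega>' \<in> E (Suc k) \<longleftrightarrow> \<omega>' \<in> E k" for \<omega> \<omega>' k
  proof -
    show "comb_seq m \<omega> \<omega>' \<in> E 0 \<longleftrightarrow> \<omega> \<in> E 0" by (auto simp: E_def comb_seq_less)
    have "i + Suc k * m = (i + k * m) + m" for i by simp
    then show "comb_seq m \<omega> \<omega>' \<in> E (Suc k) \<longleftrightarrow> \<omega>' \<in> E k" by (simp only: E_def comb_seq_add mem_Collect_eq)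
  qed
  have Q0: "measure L (Q 0 N) = (1 - q) ^ N" for N
  proof (induction N)
    case 0
    then show ?case using L.prob_space by (simp add: Q_def)
  next
    case (Suc N)
    have "measure L (Q 0 (Suc N)) = measure L (- E 0) * measure L (Q 0 N)"
    proof (rule measure_comb_seq[OF nE Q Q])
      show "comb_seq m \<omega> \<omega>' \<in> Q 0 (Suc N) \<longleftrightarrow> \<omega> \<in> - E 0 \<and> \<omega>' \<in> Q 0 N" for \<omega> \<omega>'
        by (simp add: Q_def lessThan_Suc_eq_insert_0 E0 ES)
    qed
    moreover have "measure L (- E 0) = 1 - q"
      using L.prob_compl[OF E[of 0]] by (simp add: q_def Compl_eq_Diff_UNIV)
    ultimately show ?case using Suc by simp
  qed
  have Qn: "measure L (Q n N) = (1 - q) ^ N" for n N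
  proof (induction n)
    case (Suc n)
    \<comment> \<open>With no condition on the first block, the factorisation is the shift
      invariance of the product law.\<close>
    have "measure L (Q (Suc n) N) = measure L UNIV * measure L (Q n N)"
      by (rule measure_comb_seq[where m = m, OF UL Q Q]) (simp add: Q_def ES)
    then show ?case using Suc L.prob_space by simp
  qed (rule Q0)
  have "AE \<gamma> in L. \<exists>k\<ge>n. \<gamma> \<in> E k" for n
  proof -
    define Z where "Z = (\<Inter>N. Q n N)"
    have Z: "Z \<in> sets L" unfolding Z_def using Q by auto
    have "(\<lambda>N. (1 - q) ^ N) \<longlonglongrightarrow> 0"
      using q L.prob_le_1[of "E 0"] by (intro LIMSEQ_realpow_zero) (auto simp: q_def)
    moreover have "measure L Z \<le> measure L (Q n N)" for N
      using Q by (intro L.finite_measure_mono) (auto simp: Z_def)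
    then have "measure L Z \<le> (1 - q) ^ N" for N by (simp add: Qn)
    ultimately have "measure L Z \<le> 0" by (intro LIMSEQ_le_const) auto
    then have "emeasure L Z = 0" by (simp add: L.emeasure_eq_measure measure_le_0_iff)
    then have "AE \<gamma> in L. \<gamma> \<notin> Z" using Z by (intro AE_not_in) auto
    then show ?thesis
    proof eventually_elim
      case (elim \<gamma>)
      then obtain j where "\<gamma> \<in> E (n + j)" by (auto simp: Z_def Q_def)
      then show ?case by (intro exI[of _ "n + j"]) auto
    qed
  qed
  then have "AE \<gamma> in L. \<forall>n. \<exists>k\<ge>n. \<gamma> \<in> E k" by (simp add: AE_all_countable)
  then show ?thesis
    by eventually_elim (simp add: infinite_nat_iff_unbounded_le E_def)
qed

end

lemma (in escaping_law) AE_uncountable_components: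
  "AE \<gamma> in L. uncountable (components (Fin ` seq_filled_julia_set \<gamma>))"
proof -
  obtain \<gamma>0 m where \<gamma>0: "range \<gamma>0 \<subseteq> \<Gamma>" "m \<ge> 1"
    "\<not> connected {z. cmod (poly (word \<gamma>0 m) z) < 3 * escape_radius}"
    using ex_disconnected_word[of "3 * escape_radius"] escape_radius(1) by auto
  obtain \<eta> where \<eta>: "\<eta> > 0" "\<And>\<delta>. \<forall>i<m. dist (\<gamma>0 i) (\<delta> i) < \<eta> \<Longrightarrow> splits (word \<delta> m) (2 * escape_radius)"
    using splits_perturb[OF \<gamma>0(3) escape_radius(1)] by blast
  show ?thesis
    using AE_infinitely_often_close[OF \<gamma>0(1) \<eta>(1), of m] AE_L_support
  proof eventually_elim
    case (elim \<gamma>)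
    show ?case
    proof (rule uncountable_components_filled_julia[OF elim(2) \<gamma>0(2)])
      show "infinite {k. splits (word (\<lambda>i. \<gamma> (i + k * m)) m) (2 * escape_radius)}"
        using \<eta>(2) by (intro infinite_super[OF _ elim(1)]) auto
    qed
  qed
qed

theorem theorem3p41:
  fixes \<tau> :: "poly_map measure"
  assumes "\<tau> \<in> compactly_supported_prob_measures"
    and "smallest_filled_julia_set (semigroup_of \<tau>) = {}"
  shows "kernel_julia_set (semigroup_of \<tau>) = {} \<and>
    (\<forall>d. metrizes_weak_topology d \<longrightarrow>
       fatou_meas d \<tau> = prob_measures \<and>
       (\<forall>\<epsilon>>0. \<exists>N. \<forall>n\<ge>N. \<forall>\<nu>\<in>prob_measures.
          d ((dual_transition_op \<tau> ^^ n) \<nu>) (return borel Infty) < \<epsilon>)) \<and>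
    (\<forall>z. escape_prob \<tau> z = 1) \<and>
    (AE \<gamma> in product_law \<tau>.
       seq_filled_julia_set \<gamma> \<in> null_sets lebesgue \<and>
       Fin ` seq_filled_julia_set \<gamma> = seq_julia_set \<gamma> \<and>
       uncountable (components (seq_julia_set \<gamma>)))"
proof -
  interpret escaping_law \<tau> using assms by unfold_locales
  have "AE \<gamma> in product_law \<tau>. seq_filled_julia_set \<gamma> \<in> null_sets lebesgue \<and>
       Fin ` seq_filled_julia_set \<gamma> = seq_julia_set \<gamma> \<and>
       uncountable (components (seq_julia_set \<gamma>))"
    using AE_L_support AE_filled_julia_null AE_uncountable_components
  proof eventually_elim
    case (elim \<gamma>)
    then show ?case using seq_julia_eq[OF elim(1,2)] by simp
  qed
  then show ?thesis
    using kernel_julia_set_empty fatou_meas_eq dual_uniform_convergence escape_prob_eq_1 by blast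
qed

end
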